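(* Let $(\mathbf X,Y)$ be a random pair with $\mathbf X\in\mathbb R^\nu$ and $Y\in\mathbb R$, let $(\mathbf X_1,Y_1),\dots,(\mathbf X_n,Y_n)$ be i.i.d. copies of $(\mathbf X,Y)$ (the offline sample), with $(\mathbf X,Y)$ independent of the offline sample and of the randomness used to build the forest. Let $\alpha\in(0,1)$, let $F(y\mid \mathbf x)=\mathbb P(Y\le y\mid \mathbf X=\mathbf x)$, let $v_\alpha(\mathbf x)=\inf\{y\in\mathbb R: F(y\mid\mathbf x)\ge \alpha\}$, and let $\hat v_\alpha(\mathbf x)$ be the quantile regression forest (QRF) estimator built from the offline sample, as defined in the context. Assume: 1. The support $\mathcal X\subset\mathbb R^\nu$ of $\mathbf X$ is bounded, and the density of $\mathbf X$ on $\mathcal X$ is bounded from above and below by positive constants. 2. Writing $k_\theta(l)$ for the number of indices $i\in\{1,\dots,n\}$ such that $\mathbf X_i$ lies in the region of the leaf $l$ of the tree with parameter $\theta$, one has, as $n\to\infty$, $\max_{l,\theta}k_\theta(l)=o(n)$ and $1/\min_{l,\theta}k_\theta(l)=o(1)$. 3. There is a constant $C_0>0$ such that, whenever a node is split, for every coordinate $m\in\{1,\dots,\nu\}$ the probability that coordinate $m$ is selected as the split variable is at least $C_0$. Moreover there is a constant $\gamma\in(0,1/2]$ such that, whenever a node $r$ containing $n_r$ observations is split, each resulting child node $r_c$, containing $n_{r_c}$ observations, satisfies $n_{r_c}/n_r\ge\gamma$. 4. There is a constant $C>0$ such that for all $\mathbf x,\mathbf x'\in\mathcal X$, $\sup_{y\in\mathbb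 R}|F(y\mid\mathbf x)-F(y\mid\mathbf x')|\le C\|\mathbf x-\mathbf x'\|_1$, where $\|\cdot\|_1$ is the $\ell_1$ norm. 5. For every $\mathbf x\in\mathcal X$, $F(y\mid\mathbf x)$ is strictly monotonically increasing in $y$. 6. There exist constants $\delta>0$ and $M<\infty$ such that $\mathbb E[|Y|^{2+\delta}\mid\mathbf X=\mathbf x]\le M$ for all $\mathbf x$. 7. (Honesty) The randomization used to determine the tree structure, i.e., the sequence of splits, is independent of the response samples $\{Y_i\}_{i=1}^n$, so that the responses are used only to estimate quantities within the leaves of a fixed, data-independent partition. Then $$\lim_{n\to\infty}\mathbb E\big[(\hat v_\alpha(\mathbf X)-v_\alpha(\mathbf X))^2\big]=0 .$$
   Context: Quantile regression forest (QRF) estimator. From the offline sample $\{(\mathbf X_i,Y_i)\}_{i=1}^n$ one constructs an ensemble of $B$ regression trees $T(\theta_1),\dots,T(\theta_B)$, using bootstrap resampling and randomized splitting rules; $\theta_b$ collects all randomness in the construction of tree $b$. Each tree is obtained by recursively splitting nodes, each split being made along one coordinate (the split variable) of $\mathbb R^\nu$, and its leaves correspond to regions partitioning the covariate space. For a point $\mathbf x$, let $l(\mathbf x,\theta_b)$ be the leaf of $T(\theta_b)$ into which $\mathbf x$ falls and $R_{l(\mathbf x,\theta_b)}$ its associated region. Define the tree weights and forest weights $$w_i(\mathbf x,\theta_b)=\frac{\mathbf 1\{\mathbf X_i\in R_{l(\mathbf x,\theta_b)}\}}{\#\{j\in\{1,\dots,n\}:\mathbf X_j\in R_{l(\mathbf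 x,\theta_b)}\}},\qquad w_i(\mathbf x)=\frac1B\sum_{b=1}^B w_i(\mathbf x,\theta_b),\qquad i=1,\dots,n,$$ and the QRF estimator $$\hat v_\alpha(\mathbf x)=\inf\Big\{y\in\mathbb R:\ \sum_{i=1}^n w_i(\mathbf x)\,\mathbf 1\{Y_i\le y\}\ge\alpha\Big\}.$$ Interpretation: $\mathbf X$ is the vector of risk factors at the monitoring time, $Y$ is the portfolio loss at the risk horizon, and $v_\alpha(\mathbf x)$ is the conditional Value at Risk at confidence level $\alpha$. *)

theory Defs
  imports "HOL-Probability.Probability" "HOL-Library.Sublist" "HOL-Library.Landau_Symbols"
begin

section \<open>Probabilistic notions\<close>

definition topological_support :: "'a::topological_space measure \<Rightarrow> 'a set" where
  "topological_support \<mu> = {x. \<forall>U. open U \<longrightarrow> x \<in> U \<longrightarrow> 0 < emeasure \<mu> U}"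

text \<open>Independence of two random variables. The constant \<open>indep_var\<close> of the library forces both
  random variables to take values in the same type; here the types may differ.\<close>

definition indep_rv ::
  "'a measure \<Rightarrow> 'b measure \<Rightarrow> ('a \<Rightarrow> 'b) \<Rightarrow> 'c measure \<Rightarrow> ('a \<Rightarrow> 'c) \<Rightarrow> bool" where
  "indep_rv M S U S' V \<longleftrightarrow>
     U \<in> measurable M S \<and> V \<in> measurable M S' \<and>
     prob_space.indep_set M {U -` A \<inter> space M |A. A \<in> sets S} {V -` A \<inter> space M |A. A \<in> sets S'}"

text \<open>\<open>K x\<close> is (a regular version of) the conditional law of \<open>Y\<close> given \<open>X = x\<close>; the conditional
  distribution function \<open>F(y | x)\<close> is then \<open>cdf (K x) y\<close>.\<close>

definition regular_cond_law ::
  "'a measure \<Rightarrow> ('a \<Rightarrow> 'x::topological_space) \<Rightarrow> ('a \<Rightarrow> real) \<Rightarrow> ('x \<Rightarrow> real measure) \<Rightarrow> bool" where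
  "regular_cond_law M X Y K \<longleftrightarrow>
     K \<in> measurable borel (prob_algebra borel) \<and>
     (\<forall>A\<in>sets borel. \<forall>C\<in>sets borel.
        emeasure M (X -` A \<inter> Y -` C \<inter> space M)
        = (\<integral>\<^sup>+x\<in>A. emeasure (K x) C \<partial>distr M borel X))"

definition cond_quantile :: "('x \<Rightarrow> real measure) \<Rightarrow> real \<Rightarrow> 'x \<Rightarrow> real" where
  "cond_quantile K \<alpha> x = Inf {y. \<alpha> \<le> cdf (K x) y}"

definition l1_norm :: "real ^ 'v \<Rightarrow> real" where
  "l1_norm x = (\<Sum>m\<in>UNIV. \<bar>x $ m\<bar>)"


section \<open>Regression trees\<close>

text \<open>\<open>Split m s l r\<close> sends the points with \<open>x $ m \<le> s\<close> to \<open>l\<close> and the others to \<open>r\<close>. A node is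
  addressed by the path leading to it from the root, \<open>True\<close> meaning that the left child is taken.\<close>

datatype 'v rtree = Leaf | Split 'v real "'v rtree" "'v rtree"

fun split_at :: "'v rtree \<Rightarrow> bool list \<Rightarrow> ('v \<times> real) option" where
  "split_at Leaf p = None"
| "split_at (Split m s l r) [] = Some (m, s)"
| "split_at (Split m s l r) (c # p) = split_at (if c then l else r) p"

text \<open>For an address that is not a node of the tree the region is empty.\<close>

fun region :: "'v::finite rtree \<Rightarrow> bool list \<Rightarrow> (real ^ 'v) set" where
  "region t [] = UNIV"
| "region Leaf (c # p) = {}"
| "region (Split m s l r) (c # p) =
     (if c then {x. x $ m \<le> s} \<inter> region l p else {x. s < x $ m} \<inter> region r p)"

fun leaves :: "'v rtree \<Rightarrow> bool list set" where
  "leaves Leaf = {[]}"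
| "leaves (Split m s l r) = Cons True ` leaves l \<union> Cons False ` leaves r"

fun leaf_of :: "'v::finite rtree \<Rightarrow> real ^ 'v \<Rightarrow> bool list" where
  "leaf_of Leaf x = []"
| "leaf_of (Split m s l r) x =
     (if x $ m \<le> s then True # leaf_of l x else False # leaf_of r x)"

text \<open>The sigma-algebra that makes the split variable and the split point at every node
  measurable.\<close>

definition tree_space :: "'v rtree measure" where
  "tree_space = sigma UNIV {{t. \<exists>s\<le>c. split_at t p = Some (m, s)} |p m c. True}"

text \<open>The information carried by the node \<open>p\<close> of a random tree \<open>T\<close> just before its split variable
  is drawn: the splits made at all its proper ancestors, and whether the node is going to be
  split.\<close>

definition node_history :: "'a measure \<Rightarrow> ('a \<Rightarrow> 'v rtree) \<Rightarrow> bool list \<Rightarrow> 'a measure" where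
  "node_history M T p = sigma (space M)
     (insert {\<omega> \<in> space M. split_at (T \<omega>) p \<noteq> None}
       {{\<omega> \<in> space M. \<exists>s\<le>c. split_at (T \<omega>) q = Some (m, s)} |q m c. strict_prefix q p})"


section \<open>Quantile regression forests\<close>

text \<open>Observations are indexed by \<open>{..<n}\<close>, the trees of the forest by \<open>{..<B}\<close>.\<close>

definition node_count :: "nat \<Rightarrow> (nat \<Rightarrow> real ^ 'v) \<Rightarrow> 'v::finite rtree \<Rightarrow> bool list \<Rightarrow> nat" where
  "node_count n xs t p = card {i \<in> {..<n}. xs i \<in> region t p}"

definition leaf_counts ::
  "nat \<Rightarrow> (nat \<Rightarrow> real ^ 'v) \<Rightarrow> nat \<Rightarrow> (nat \<Rightarrow> 'v::finite rtree) \<Rightarrow> nat set" where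
  "leaf_counts n xs B ts = {node_count n xs (ts b) l |b l. b < B \<and> l \<in> leaves (ts b)}"

definition tree_weight ::
  "nat \<Rightarrow> (nat \<Rightarrow> real ^ 'v) \<Rightarrow> 'v::finite rtree \<Rightarrow> real ^ 'v \<Rightarrow> nat \<Rightarrow> real" where
  "tree_weight n xs t x i =
     indicator (region t (leaf_of t x)) (xs i) / real (node_count n xs t (leaf_of t x))"

definition forest_weight ::
  "nat \<Rightarrow> (nat \<Rightarrow> real ^ 'v) \<Rightarrow> nat \<Rightarrow> (nat \<Rightarrow> 'v::finite rtree) \<Rightarrow> real ^ 'v \<Rightarrow> nat \<Rightarrow> real" where
  "forest_weight n xs B ts x i = 1 / real B * (\<Sum>b<B. tree_weight n xs (ts b) x i)"

definition qrf ::
  "real \<Rightarrow> nat \<Rightarrow> (nat \<Rightarrow> real ^ 'v) \<Rightarrow> (nat \<Rightarrow> real) \<Rightarrow> nat \<Rightarrow> (nat \<Rightarrow> 'v::finite rtree)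
    \<Rightarrow> real ^ 'v \<Rightarrow> real" where
  "qrf \<alpha> n xs ys B ts x =
     Inf {y. \<alpha> \<le> (\<Sum>i<n. forest_weight n xs B ts x i * indicator {..y} (ys i))}"

definition sample ::
  "(nat \<Rightarrow> 'a \<Rightarrow> real ^ 'v) \<Rightarrow> (nat \<Rightarrow> 'a \<Rightarrow> real) \<Rightarrow> nat \<Rightarrow> 'a \<Rightarrow> nat \<Rightarrow> (real ^ 'v) \<times> real" where
  "sample Xs Ys n \<omega> = (\<lambda>i\<in>{..<n}. (Xs i \<omega>, Ys i \<omega>))"

text \<open>A tree-growing procedure \<open>grow\<close> maps the sample size, the randomization and the sample to a
  tree; it is honest if the tree does not depend on the responses in the sample.\<close>

definition honest ::
  "'t measure \<Rightarrow> (nat \<Rightarrow> 't \<Rightarrow> (nat \<Rightarrow> (real ^ 'v) \<times> real) \<Rightarrow> 'v rtree) \<Rightarrow> bool" where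
  "honest \<Theta> grow \<longleftrightarrow>
     (\<forall>n. \<forall>u\<in>space \<Theta>. \<forall>d\<in>extensional {..<n}. \<forall>d'\<in>extensional {..<n}.
        (\<forall>i<n. fst (d i) = fst (d' i)) \<longrightarrow> grow n u d = grow n u d')"

end

theory Submission
  imports Defs
begin

text \<open>
  For fixed \<open>y\<close>, the estimated conditional distribution function splits into noise and bias. By
  honesty the noise has, given the covariates, variance at most one over the leaf size. By the
  Lipschitz condition the bias is at most a constant times the side lengths of the leaf of \<open>X\<close>,
  clipped to a box containing the support.

  That the sides shrink is seen from the potential \<open>\<Sum>\<^sub>p \<mu>(R\<^sub>p) \<cdot> width\<^sub>m(R\<^sub>p)\<close> over the nodes \<open>p\<close> of
  depth \<open>d\<close>, where \<open>\<mu>\<close> is the law of \<open>X\<close>. A split along \<open>m\<close> into parts of mass at most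
  \<open>(1 - \<beta>) \<mu>(R\<^sub>p)\<close> multiplies the contribution of \<open>p\<close> by at most \<open>1 - \<beta>\<close>, and no split increases it.
  At bounded depth the nodes contain a fixed fraction of the sample, so a uniform law of large
  numbers turns the balance of the observation counts into balance of the masses with
  \<open>\<beta> = \<gamma> / 2\<close>. Conditioning on the history of each node, the expected potential thus decays
  geometrically in the depth, while leaves of bounded depth disappear as \<open>n\<close> grows.

  Evaluating at \<open>y = v\<^sub>\<alpha>(X) \<plusminus> \<epsilon>\<close>, strict monotonicity gives convergence in probability of the
  quantile estimator. A bound on its moment of order \<open>2 + \<delta>\<close> upgrades this to mean square
  convergence.
\<close>

section \<open>Regression trees\<close>

text \<open>The obstacle is that the cells depend on the sample, and that the split variables are
  controlled only conditionally on the past of a node. Following \<open>X\<close> down the tree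
  would mix this conditioning with the position of \<open>X\<close>. Summing over all addresses of a
  given length keeps each node fixed: its region and width are determined by its proper ancestors,
  hence by \<open>node_history\<close>, and independence of \<open>X\<close> turns the event that
  \<open>X\<close> passes through the node into the mass of its cell. Thresholds may depend on the
  covariates in any way, since the potential is weighted with that mass and balance is all that is
  asked of a split. The limits are taken in a fixed order: the depth \<open>D\<close> comes first
  and determines the precision \<open>\<gamma> ^ Suc D / 8\<close> and the class of cells for the
  law of large numbers; only then does \<open>n\<close> grow. The leaf size assumptions hold almost
  surely, from an index on that depends on the outcome, so they enter through dominated convergence.
  Trees are treated one at a time and averaged at the end, so that dependence between them does no
  harm.\<close>

lemma leaf_of_in_leaves: "leaf_of t x \<in> leaves t"
  by (induction t) auto

lemma finite_leaves: "finite (leaves t)"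
  by (induction t) auto

lemma mem_region_leaf_iff:
  assumes "p \<in> leaves t"
  shows "x \<in> region t p \<longleftrightarrow> leaf_of t x = p"
  using assms by (induction t arbitrary: p) auto

text \<open>Sharing a leaf becomes an equation between addresses, which form a countable type; the
  measurability of the tree weights rests on this.\<close>

lemma mem_region_leaf_of_iff: "x' \<in> region t (leaf_of t x) \<longleftrightarrow> leaf_of t x' = leaf_of t x"
  by (simp add: mem_region_leaf_iff leaf_of_in_leaves)

lemma split_at_leaf_prefix:
  assumes "p @ c # q \<in> leaves t"
  shows "split_at t p \<noteq> None"
  using assms by (induction t p rule: split_at.induct) (auto split: if_splits)

text \<open>\<open>region\<close> recurses from the root, whereas passing from one level to the next
  acts at the far end of an address. This version exposes the last split.\<close>

lemma region_snoc:
  "region t (p @ [c]) =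
     (case split_at t p of None \<Rightarrow> {}
      | Some (k, s) \<Rightarrow> region t p \<inter> (if c then {x. x $ k \<le> s} else {x. s < x $ k}))"
proof (induction t p rule: split_at.induct)
  case (1 p)
  then show ?case by (cases p) auto
qed (auto split: option.split)

lemma region_append_subset: "region t (p @ q) \<subseteq> region t p"
  by (induction t p rule: region.induct) auto

lemma region_disjoint:
  assumes "x \<in> region t p" "x \<in> region t q" "length p = length q"
  shows "p = q"
  using assms
proof (induction p arbitrary: t q)
  case (Cons c p)
  then obtain d q' where q: "q = d # q'" by (cases q) auto
  with Cons show ?case by (cases t) (auto split: if_splits)
qed simp

lemma node_count_Nil [simp]: "node_count n xs t [] = n"
  by (simp add: node_count_def)

text \<open>The length of the side along coordinate \<open>m\<close> of the cell of the node \<open>p\<close>, clipped to an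
  interval with end points \<open>a \<le> b\<close>.\<close>

fun width :: "'v \<Rightarrow> 'v rtree \<Rightarrow> bool list \<Rightarrow> real \<Rightarrow> real \<Rightarrow> real" where
  "width m t [] a b = b - a"
| "width m Leaf (c # p) a b = 0"
| "width m (Split k s l r) (c # p) a b =
     (if k = m then if c then width m l p a (max a (min b s)) else width m r p (max a (min b s)) b
      else width m (if c then l else r) p a b)"

text \<open>\<open>width\<close> clamps each threshold into the current interval, so both parts
  again have ordered end points even if the threshold lies outside; this keeps the induction
  hypothesis applicable.\<close>

lemma width_bounds:
  assumes "a \<le> b"
  shows "0 \<le> width m t p a b \<and> width m t p a b \<le> b - a"
  using assms
proof (induction m t p a b rule: width.induct)
  case (3 m k s l r c p a b)
  then show ?case
    by (auto simp: max_def min_def split: if_splits)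
qed auto

lemma width_append_le:
  assumes "a \<le> b"
  shows "width m t (p @ q) a b \<le> width m t p a b"
  using assms
proof (induction m t p a b rule: width.induct)
  case (1 m t a b)
  then show ?case using width_bounds[of a b m t q] by simp
next
  case (3 m k s l r c p a b)
  then show ?case by (auto simp: max_def min_def)
qed auto

text \<open>The induction descends to a split at the root, where the clamped cut point cancels from
  the two lengths.\<close>

lemma width_split_add:
  assumes "split_at t p = Some (m, s)"
  shows "width m t (p @ [True]) a b + width m t (p @ [False]) a b = width m t p a b"
  using assms
proof (induction m t p a b rule: width.induct)
  case (1 m t a b)
  then show ?case by (cases t) auto
qed auto

lemma width_split_other:
  assumes "split_at t p = Some (k, s)" "k \<noteq> m"
  shows "width m t (p @ [c]) a b = width m t p a b"
  using assms
proof (induction m t p a b rule: width.induct)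
  case (1 m t a b)
  then show ?case by (cases t) auto
qed auto

text \<open>The invariant of the induction is that both coordinates stay in the current interval:
  clamping a threshold never cuts off a point of the interval that lies on the chosen side.\<close>

lemma dist_le_width:
  assumes "x \<in> region t p" "x' \<in> region t p" "a \<le> x $ m" "x $ m \<le> b" "a \<le> x' $ m" "x' $ m \<le> b"
  shows "\<bar>x $ m - x' $ m\<bar> \<le> width m t p a b"
  using assms
proof (induction m t p a b rule: width.induct)
  case (3 m k s l r c p a b)
  then show ?case by (cases "k = m"; cases c) (auto simp: max_def min_def)
qed auto


section \<open>Measurability\<close>

text \<open>The part of \<open>tree_space\<close> generated by the splits at the addresses in
  \<open>S\<close>. Taking for \<open>S\<close> the proper prefixes of \<open>p\<close> gives the
  knowledge about the ancestors of \<open>p\<close> that \<open>node_history\<close>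
  contains.\<close>

definition tree_sigma :: "bool list set \<Rightarrow> 'v rtree measure" where
  "tree_sigma S = sigma UNIV {{t. \<exists>s\<le>c. split_at t p = Some (m, s)} |p m c. p \<in> S}"

lemma tree_space_eq: "tree_space = tree_sigma UNIV"
  by (simp add: tree_space_def tree_sigma_def)

lemma space_tree_sigma [simp]: "space (tree_sigma S) = UNIV"
  by (simp add: tree_sigma_def space_measure_of_conv)

lemma sets_tree_sigma_gen:
  assumes "p \<in> S"
  shows "{t. \<exists>s\<le>c. split_at t p = Some (m, s)} \<in> sets (tree_sigma S)"
  unfolding tree_sigma_def using assms by (auto simp: sets_measure_of_conv)

lemma measurable_tree_sigmaI:
  assumes "\<And>p m c. p \<in> S \<Longrightarrow> {\<omega> \<in> space N. \<exists>s\<le>c. split_at (T \<omega>) p = Some (m, s)} \<in> sets N"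
  shows "T \<in> measurable N (tree_sigma S)"
  unfolding tree_sigma_def
proof (rule measurable_sigma_sets[OF sets_measure_of], goal_cases)
  case (4 y)
  then obtain p m c where y: "y = {t. \<exists>s\<le>c. split_at t p = Some (m, s)}" and p: "p \<in> S" by auto
  have "T -` y \<inter> space N = {\<omega> \<in> space N. \<exists>s\<le>c. split_at (T \<omega>) p = Some (m, s)}"
    by (auto simp: y)
  with assms[OF p] show ?case by simp
qed auto

lemma sets_tree_sigma_var:
  assumes "p \<in> S"
  shows "{t. map_option fst (split_at t p) = Some m} \<in> sets (tree_sigma S)"
proof -
  have "{t. map_option fst (split_at t p) = Some m} =
        (\<Union>c::nat. {t. \<exists>s\<le>real c. split_at t p = Some (m, s)})"
    by (auto intro: real_arch_simple)
  also have "\<dots> \<in> sets (tree_sigma S)"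
    using sets_tree_sigma_gen[OF assms] by (intro sets.countable_UN) auto
  finally show ?thesis .
qed

lemma measurable_split_var [measurable]:
  assumes "p \<in> S"
  shows "Measurable.pred (tree_sigma S) (\<lambda>t. map_option fst (split_at t p) = Some m)"
  using sets_tree_sigma_var[OF assms] by (simp add: pred_def del: map_option_eq_Some)

lemma pred_split_at_None:
  fixes p :: "bool list"
  assumes "p \<in> S"
  shows "Measurable.pred (tree_sigma S :: 'v::finite rtree measure) (\<lambda>t. split_at t p = None)"
proof -
  have "(\<lambda>t::'v rtree. split_at t p = None) = (\<lambda>t. \<not> (\<exists>m. map_option fst (split_at t p) = Some m))"
    by (auto simp: fun_eq_iff) (metis option.exhaust prod.exhaust)
  moreover note [measurable] = measurable_split_var[OF assms]
  ultimately show ?thesis by (simp only:) measurable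
qed

definition threshold :: "bool list \<Rightarrow> 'v rtree \<Rightarrow> real" where
  "threshold p t = (case split_at t p of None \<Rightarrow> 0 | Some (m, s) \<Rightarrow> s)"

lemma measurable_threshold:
  fixes p :: "bool list"
  assumes "p \<in> S"
  shows "threshold p \<in> borel_measurable (tree_sigma S :: 'v::finite rtree measure)"
proof (rule borel_measurableI_le)
  fix c :: real
  \<comment> \<open>An unsplit node has the default threshold 0, so it belongs to the sublevel set
    exactly if \<open>0 \<le> c\<close>.\<close>
  have eq: "{t \<in> space (tree_sigma S). threshold p t \<le> c} =
     (\<Union>m::'v. {t. \<exists>s\<le>c. split_at t p = Some (m, s)}) \<union>
     (if 0 \<le> c then {t. split_at t p = None} else {})"
    by (auto simp: threshold_def split: option.splits) (metis option.exhaust prod.exhaust)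
  show "{t \<in> space (tree_sigma S). threshold p (t::'v rtree) \<le> c} \<in> sets (tree_sigma S)"
    unfolding eq using sets_tree_sigma_gen[OF assms] pred_split_at_None[OF assms]
    by (intro sets.Un sets.finite_UN) (auto simp: pred_def)
qed

text \<open>Mapping \<open>Leaf\<close> to itself makes \<open>split_at_child\<close> hold for every
  tree, so that recursion on trees becomes composition with a measurable map.\<close>

fun child :: "bool \<Rightarrow> 'v rtree \<Rightarrow> 'v rtree" where
  "child c Leaf = Leaf"
| "child c (Split m s l r) = (if c then l else r)"

lemma split_at_child: "split_at (child c t) p = split_at t (c # p)"
  by (cases t) auto

lemma measurable_child: "child c \<in> measurable (tree_sigma S) (tree_sigma {q. c # q \<in> S})"
  by (rule measurable_tree_sigmaI) (auto simp: split_at_child intro: sets_tree_sigma_gen)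

abbreviation root_var :: "'v rtree \<Rightarrow> 'v option" where
  "root_var t \<equiv> map_option fst (split_at t [])"

text \<open>The recursion of \<open>region\<close>, and below those of \<open>leaf_of\<close> and
  \<open>width\<close>, is rewritten without pattern matching on the tree: \<open>root_var\<close>,
  \<open>threshold\<close> and \<open>child\<close> are all measurable.\<close>

lemma mem_region_Cons:
  "x \<in> region t (c # p) \<longleftrightarrow>
     (\<exists>m. root_var t = Some m \<and> (if c then x $ m \<le> threshold [] t else threshold [] t < x $ m)) \<and>
     x \<in> region (child c t) p"
  by (cases t) (auto simp: threshold_def)

lemma leaf_of_eq_Nil: "leaf_of t x = [] \<longleftrightarrow> split_at t [] = None"
  by (cases t) auto

lemma leaf_of_eq_Cons:
  "leaf_of t x = c # p \<longleftrightarrow>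
     (\<exists>m. root_var t = Some m \<and> (if c then x $ m \<le> threshold [] t else threshold [] t < x $ m)) \<and>
     leaf_of (child c t) x = p"
  by (cases t) (auto simp: threshold_def)

lemma width_Cons:
  fixes m :: "'v::finite"
  shows "width m t (c # p) a b =
     (if root_var t = None then 0
      else if root_var t = Some m then
        (if c then width m (child c t) p a (max a (min b (threshold [] t)))
         else width m (child c t) p (max a (min b (threshold [] t))) b)
      else width m (child c t) p a b)"
  by (cases t) (auto simp: threshold_def)

lemma measurable_side:
  assumes "[] \<in> S"
  shows "Measurable.pred (tree_sigma S \<Otimes>\<^sub>M borel)
    (\<lambda>(t, x :: real ^ 'v::finite). \<exists>m. root_var t = Some m \<and>
        (if c then x $ m \<le> threshold [] t else threshold [] t < x $ m))"
proof -
  note [measurable] = measurable_split_var[OF assms] measurable_threshold[OF assms]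
  have [measurable]: "(\<lambda>x. x $ m) \<in> borel_measurable (borel :: (real ^ 'v) measure)" for m
    by (intro borel_measurable_continuous_onI continuous_intros)
  show ?thesis by (cases c) (simp_all add: split_beta' del: map_option_eq_Some)
qed

text \<open>Only the splits at proper ancestors decide a cell. Stating this with a small
  sigma-algebra is what later makes the potential of a node measurable with respect to its history.
  \<open>S\<close> varies in the induction because passing to a child strips the first step from
  every address.\<close>

lemma pred_region:
  assumes "\<And>q. strict_prefix q p \<Longrightarrow> q \<in> S"
  shows "Measurable.pred (tree_sigma S \<Otimes>\<^sub>M borel) (\<lambda>(t, x :: real ^ 'v::finite). x \<in> region t p)"
  using assms
proof (induction p arbitrary: S)
  case (Cons c p)
  note [measurable] = measurable_side[of S c] measurable_child[of c S]
  have S: "[] \<in> S" using Cons.prems[of "[]"] by simp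
  have [measurable]: "Measurable.pred (tree_sigma {q. c # q \<in> S} \<Otimes>\<^sub>M borel)
      (\<lambda>(t, x :: real ^ 'v). x \<in> region t p)"
    using Cons.prems by (intro Cons.IH) auto
  have "Measurable.pred (tree_sigma S \<Otimes>\<^sub>M borel)
      (\<lambda>z :: _ \<times> (real ^ 'v). (\<lambda>(t, x). x \<in> region t p) (child c (fst z), snd z))"
    by measurable
  then have "Measurable.pred (tree_sigma S \<Otimes>\<^sub>M borel)
      (\<lambda>(t, x :: real ^ 'v). x \<in> region (child c t) p)"
    by (simp add: split_beta')
  from pred_intros_logic(3)[OF measurable_side[OF S, of c] this] show ?case
    by (simp add: mem_region_Cons split_beta')
qed simp

lemma pred_leaf_of:
  "Measurable.pred (tree_space \<Otimes>\<^sub>M borel) (\<lambda>(t, x :: real ^ 'v::finite). leaf_of t x = p)"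
proof (induction p)
  case Nil
  note [measurable] = pred_split_at_None[of "[]" UNIV]
  show ?case by (simp add: leaf_of_eq_Nil tree_space_eq split_beta')
next
  case (Cons c p)
  have [measurable]: "child c \<in> measurable tree_space tree_space"
    using measurable_child[of c UNIV] by (simp add: tree_space_eq)
  note [measurable] = Cons.IH
  have "Measurable.pred (tree_space \<Otimes>\<^sub>M borel)
      (\<lambda>z :: _ \<times> (real ^ 'v). (\<lambda>(t, x). leaf_of t x = p) (child c (fst z), snd z))"
    by measurable
  then have "Measurable.pred (tree_space \<Otimes>\<^sub>M borel)
      (\<lambda>(t, x :: real ^ 'v). leaf_of (child c t) x = p)"
    by (simp add: split_beta')
  from pred_intros_logic(3)[OF measurable_side[OF UNIV_I, of c, folded tree_space_eq] this] show ?case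
    by (simp add: leaf_of_eq_Cons split_beta')
qed

lemma measurable_leaf_of:
  "(\<lambda>(t, x :: real ^ 'v::finite). leaf_of t x) \<in> measurable (tree_space \<Otimes>\<^sub>M borel) (count_space UNIV)"
proof (rule measurableI)
  fix A :: "bool list set"
  have "(\<lambda>(t, x :: real ^ 'v). leaf_of t x) -` A \<inter> space (tree_space \<Otimes>\<^sub>M borel) =
    (\<Union>p\<in>A. {z \<in> space (tree_space \<Otimes>\<^sub>M borel). (\<lambda>(t, x). leaf_of t x = p) z})"
    by auto
  also have "\<dots> \<in> sets (tree_space \<Otimes>\<^sub>M borel)"
    using pred_leaf_of by (intro sets.countable_UN') (auto simp: pred_def split_beta')
  finally show "(\<lambda>(t, x :: real ^ 'v). leaf_of t x) -` A \<inter> space (tree_space \<Otimes>\<^sub>M borel)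
    \<in> sets (tree_space \<Otimes>\<^sub>M borel)" .
qed simp

text \<open>The end points are arguments of the measurable map because the recursion replaces one of
  them by a clamped threshold, which depends on the tree.\<close>

lemma measurable_width_aux:
  fixes m :: "'v::finite"
  assumes "\<And>q. strict_prefix q p \<Longrightarrow> q \<in> S"
  shows "(\<lambda>(t, a, b). width m t p a b) \<in> borel_measurable (tree_sigma S \<Otimes>\<^sub>M (borel \<Otimes>\<^sub>M borel))"
  using assms
proof (induction p arbitrary: S)
  case Nil
  show ?case by (simp add: split_beta')
next
  case (Cons c p)
  have S: "[] \<in> S" using Cons.prems[of "[]"] by simp
  note [measurable] = measurable_child[of c S] measurable_split_var[OF S] measurable_threshold[OF S]
    pred_split_at_None[OF S]
  have IH [measurable]: "(\<lambda>(t, a, b). width m t p a b) \<in>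
      borel_measurable (tree_sigma {q. c # q \<in> S} \<Otimes>\<^sub>M (borel \<Otimes>\<^sub>M borel))"
    using Cons.prems by (intro Cons.IH) auto
  have *: "(\<lambda>z. width m (child c (fst z)) p (f z) (g z)) \<in>
      borel_measurable (tree_sigma S \<Otimes>\<^sub>M (borel \<Otimes>\<^sub>M borel))"
    if [measurable]: "f \<in> borel_measurable (tree_sigma S \<Otimes>\<^sub>M (borel \<Otimes>\<^sub>M borel))"
      "g \<in> borel_measurable (tree_sigma S \<Otimes>\<^sub>M (borel \<Otimes>\<^sub>M borel))" for f g
  proof -
    have "(\<lambda>z. (\<lambda>(t, a, b). width m t p a b) (child c (fst z), f z, g z)) \<in>
      borel_measurable (tree_sigma S \<Otimes>\<^sub>M (borel \<Otimes>\<^sub>M borel))" by measurable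
    then show ?thesis by simp
  qed
  have None: "root_var t = None \<longleftrightarrow> split_at t [] = None" for t :: "'v rtree" by simp
  show ?case unfolding width_Cons split_beta' None
    by (intro measurable_If * ) measurable
qed

lemma measurable_width:
  fixes m :: "'v::finite"
  assumes "\<And>q. strict_prefix q p \<Longrightarrow> q \<in> S"
  shows "(\<lambda>t. width m t p a b) \<in> borel_measurable (tree_sigma S)"
proof -
  note [measurable] = measurable_width_aux[where p=p and S=S and m=m, OF assms]
  have "(\<lambda>t. (\<lambda>(t, a, b). width m t p a b) (t, a, b)) \<in> borel_measurable (tree_sigma S)"
    by measurable
  then show ?thesis by simp
qed

lemma measurable_measure_region:
  fixes \<mu> :: "(real ^ 'v::finite) measure"
  assumes "\<And>q. strict_prefix q p \<Longrightarrow> q \<in> S" "prob_space \<mu>" "sets \<mu> = sets borel"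
  shows "(\<lambda>t. measure \<mu> (region t p)) \<in> borel_measurable (tree_sigma S)"
proof -
  interpret prob_space \<mu> by fact
  have sp: "space \<mu> = UNIV" using sets_eq_imp_space_eq[OF assms(3)] by simp
  have "{z \<in> space (tree_sigma S \<Otimes>\<^sub>M \<mu>). snd z \<in> region (fst z) p} \<in> sets (tree_sigma S \<Otimes>\<^sub>M \<mu>)"
    using pred_region[where p=p and S=S, OF assms(1)] sets_pair_measure_cong[OF refl assms(3), of "tree_sigma S :: 'v rtree measure"]
    by (simp add: pred_def split_beta' space_pair_measure sp)
  from measurable_emeasure_Pair[OF this]
  have "(\<lambda>t. emeasure \<mu> (region t p)) \<in> borel_measurable (tree_sigma S)"
    by (simp add: space_pair_measure sp vimage_def)
  then show ?thesis by (simp add: measure_def)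
qed

lemma region_borel: "region (t :: 'v::finite rtree) p \<in> sets borel"
proof (induction t p rule: region.induct)
  case (3 m s l r c p)
  have [measurable]: "(\<lambda>x. x $ m) \<in> borel_measurable (borel :: (real ^ 'v) measure)"
    by (intro borel_measurable_continuous_onI continuous_intros)
  have "{x :: real ^ 'v. x $ m \<le> s} \<in> sets borel" "{x :: real ^ 'v. s < x $ m} \<in> sets borel"
    by measurable
  with 3 show ?case by (auto split: if_splits)
qed auto

section \<open>Laws and conditional laws\<close>

lemma indep_rv_distr_pair:
  assumes "prob_space M" and indep: "indep_rv M S U S' V"
  shows "distr M (S \<Otimes>\<^sub>M S') (\<lambda>\<omega>. (U \<omega>, V \<omega>)) = distr M S U \<Otimes>\<^sub>M distr M S' V"
proof -
  interpret prob_space M by fact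
  have [measurable]: "U \<in> measurable M S" "V \<in> measurable M S'"
    using indep by (auto simp: indep_rv_def)
  interpret U: prob_space "distr M S U" by (rule prob_space_distr) fact
  interpret V: prob_space "distr M S' V" by (rule prob_space_distr) fact
  show ?thesis
  proof (rule pair_measure_eqI[symmetric])
    fix A B assume "A \<in> sets (distr M S U)" "B \<in> sets (distr M S' V)"
    then have [measurable]: "A \<in> sets S" "B \<in> sets S'" by auto
    have "indep_set {U -` A \<inter> space M |A. A \<in> sets S} {V -` A \<inter> space M |A. A \<in> sets S'}"
      using indep by (simp add: indep_rv_def)
    then have "prob ((U -` A \<inter> space M) \<inter> (V -` B \<inter> space M)) =
        prob (U -` A \<inter> space M) * prob (V -` B \<inter> space M)"
      by (rule indep_setD) auto
    moreover have "(U -` A \<inter> space M) \<inter> (V -` B \<inter> space M) =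
        (\<lambda>\<omega>. (U \<omega>, V \<omega>)) -` (A \<times> B) \<inter> space M" by auto
    ultimately show "emeasure (distr M S U) A * emeasure (distr M S' V) B =
        emeasure (distr M (S \<Otimes>\<^sub>M S') (\<lambda>\<omega>. (U \<omega>, V \<omega>))) (A \<times> B)"
      by (simp add: emeasure_distr emeasure_eq_measure ennreal_mult)
  qed (auto intro: U.sigma_finite_measure_axioms V.sigma_finite_measure_axioms)
qed

text \<open>The definition of a regular conditional law speaks about rectangles only. They form an
  intersection-stable generator, so the joint law is determined and every nonnegative integrand can
  be treated.\<close>

lemma nn_integral_regular_cond_law:
  fixes X :: "'a \<Rightarrow> 'x::topological_space" and Y :: "'a \<Rightarrow> real"
  assumes "prob_space M" and [measurable]: "X \<in> borel_measurable M" "Y \<in> borel_measurable M"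
    and law: "regular_cond_law M X Y K"
    and h [measurable]: "h \<in> borel_measurable (borel \<Otimes>\<^sub>M borel)"
  shows "(\<integral>\<^sup>+\<omega>. h (X \<omega>, Y \<omega>) \<partial>M) = (\<integral>\<^sup>+x. \<integral>\<^sup>+y. h (x, y) \<partial>K x \<partial>distr M borel X)"
proof -
  interpret prob_space M by fact
  define \<mu> where "\<mu> = distr M borel X"
  have sets_mu [measurable_cong]: "sets \<mu> = sets borel" by (simp add: \<mu>_def)
  interpret mu: prob_space \<mu> unfolding \<mu>_def by (rule prob_space_distr) fact
  have K [measurable]: "K \<in> measurable borel (prob_algebra borel)"
    using law by (simp add: regular_cond_law_def)
  have K': "K \<in> measurable borel (subprob_algebra borel)"
    using K by (rule measurable_prob_algebraD)
  have sets_K [measurable_cong]: "sets (K x) = sets borel" for x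
    using measurable_space[OF K', of x] by (simp add: space_subprob_algebra)
  have space_K: "space (K x) = UNIV" for x using sets_eq_imp_space_eq[OF sets_K] by simp
  \<comment> \<open>\<open>L x\<close> is the point mass at \<open>x\<close> times
    \<open>K x\<close>, so \<open>\<nu>\<close> is the law of a pair whose response is drawn from
    \<open>K x\<close> once \<open>x\<close> has been drawn from \<open>\<mu>\<close>.\<close>
  define L where "L = (\<lambda>x. distr (K x) (borel \<Otimes>\<^sub>M borel) (Pair x))"
  have L: "L \<in> measurable borel (subprob_algebra (borel \<Otimes>\<^sub>M borel))"
    unfolding L_def by (rule measurable_distr2[OF _ K']) simp
  then have L' [measurable]: "L \<in> measurable \<mu> (subprob_algebra (borel \<Otimes>\<^sub>M borel))"
    by (simp add: \<mu>_def)
  define \<nu> where "\<nu> = \<mu> \<bind> L"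
  have nn: "(\<integral>\<^sup>+z. g z \<partial>\<nu>) = (\<integral>\<^sup>+x. \<integral>\<^sup>+y. g (x, y) \<partial>K x \<partial>\<mu>)"
    if g [measurable]: "g \<in> borel_measurable (borel \<Otimes>\<^sub>M borel)" for g :: "'x \<times> real \<Rightarrow> ennreal"
    unfolding \<nu>_def by (subst nn_integral_bind[OF g L']) (simp add: L_def nn_integral_distr)
  interpret D: prob_space "distr M (borel \<Otimes>\<^sub>M borel) (\<lambda>\<omega>. (X \<omega>, Y \<omega>))"
    by (rule prob_space_distr) measurable
  have "distr M (borel \<Otimes>\<^sub>M borel) (\<lambda>\<omega>. (X \<omega>, Y \<omega>)) = \<nu>"
  proof (rule measure_eqI_generator_eq[OF Int_stable_pair_measure_generator[of borel borel],
        where A="\<lambda>_. UNIV"])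
    fix Q assume "Q \<in> {a \<times> b |a b. a \<in> sets (borel :: 'x measure) \<and> b \<in> sets (borel :: real measure)}"
    then obtain A C where Q: "Q = A \<times> C" and [measurable]: "A \<in> sets borel" "C \<in> sets borel" by auto
    have "emeasure (distr M (borel \<Otimes>\<^sub>M borel) (\<lambda>\<omega>. (X \<omega>, Y \<omega>))) Q =
      emeasure M (X -` A \<inter> Y -` C \<inter> space M)"
      by (subst emeasure_distr) (auto simp: Q intro!: arg_cong2[where f=emeasure])
    also have "\<dots> = (\<integral>\<^sup>+x\<in>A. emeasure (K x) C \<partial>\<mu>)"
      using law by (simp add: regular_cond_law_def \<mu>_def)
    also have "\<dots> = (\<integral>\<^sup>+x. \<integral>\<^sup>+y. indicator Q (x, y) \<partial>K x \<partial>\<mu>)"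
      by (intro nn_integral_cong) (auto simp: Q indicator_times nn_integral_cmult mult.commute)
    also have "\<dots> = (\<integral>\<^sup>+z. indicator Q z \<partial>\<nu>)"
      by (subst nn) (auto simp: Q)
    also have "\<dots> = emeasure \<nu> Q"
      by (subst nn_integral_indicator) (auto simp: Q \<nu>_def sets_bind[OF sets_kernel[OF L']] mu.not_empty)
    finally show "emeasure (distr M (borel \<Otimes>\<^sub>M borel) (\<lambda>\<omega>. (X \<omega>, Y \<omega>))) Q = emeasure \<nu> Q" .
  qed (auto simp: sets_pair_measure \<nu>_def sets_bind[OF sets_kernel[OF L']] mu.not_empty
        D.emeasure_eq_measure intro!: exI[of _ UNIV])
  moreover have "(\<integral>\<^sup>+\<omega>. h (X \<omega>, Y \<omega>) \<partial>M) =
      (\<integral>\<^sup>+z. h z \<partial>distr M (borel \<Otimes>\<^sub>M borel) (\<lambda>\<omega>. (X \<omega>, Y \<omega>)))"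
    by (subst nn_integral_distr) auto
  ultimately show ?thesis
    using nn[OF h] by (simp add: \<mu>_def)
qed

text \<open>By second countability the complement of the support is covered by countably many basic
  open sets of measure zero.\<close>

lemma AE_topological_support:
  fixes X :: "'a \<Rightarrow> 'x::second_countable_topology"
  assumes [measurable]: "X \<in> borel_measurable M"
  shows "AE \<omega> in M. X \<omega> \<in> topological_support (distr M borel X)"
proof -
  define \<mu> where "\<mu> = distr M borel X"
  obtain \<B> :: "'x set set" where \<B>: "countable \<B>" "topological_basis \<B>" "\<And>U. U \<in> \<B> \<Longrightarrow> open U"
    using ex_countable_basis topological_basis_open by metis
  have "AE x in \<mu>. \<forall>U\<in>{U\<in>\<B>. emeasure \<mu> U = 0}. x \<notin> U"
  proof (rule AE_ball_countable')
    fix U assume "U \<in> {U\<in>\<B>. emeasure \<mu> U = 0}"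
    then have "U \<in> null_sets \<mu>" using \<B>(3) by (auto simp: null_sets_def \<mu>_def)
    then show "AE x in \<mu>. x \<notin> U" by (rule AE_not_in)
  qed (use \<B>(1) in auto)
  moreover have "x \<in> topological_support \<mu>"
    if x: "\<forall>U\<in>{U\<in>\<B>. emeasure \<mu> U = 0}. x \<notin> U" for x
    unfolding topological_support_def
  proof (safe, rule ccontr)
    fix U assume U: "open U" "x \<in> U" "\<not> 0 < emeasure \<mu> U"
    then obtain V where V: "V \<in> \<B>" "x \<in> V" "V \<subseteq> U"
      using \<B>(2) topological_basisE by metis
    have "emeasure \<mu> V \<le> emeasure \<mu> U"
      using V U by (intro emeasure_mono) (auto simp: \<mu>_def)
    then have "emeasure \<mu> V = 0" using U(3) by (simp add: not_gr_zero)
    with x V show False by auto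
  qed
  ultimately have "AE x in \<mu>. x \<in> topological_support \<mu>" by (auto elim: AE_mp)
  then show ?thesis unfolding \<mu>_def by (rule AE_distrD[rotated]) simp
qed

section \<open>Quantiles\<close>

text \<open>The witness \<open>z\<close> bounds the superlevel set from below, and without such a
  bound a real infimum has no meaning. In the companion below, the witness makes the set
  nonempty.\<close>

lemma generalized_inverse_le:
  fixes G :: "real \<Rightarrow> real"
  assumes "mono G" "G z < \<alpha>" "\<alpha> \<le> G y"
  shows "Inf {y. \<alpha> \<le> G y} \<le> y"
proof (rule cInf_lower)
  show "bdd_below {y. \<alpha> \<le> G y}"
    using assms(1,2) by (intro bdd_belowI[of _ z]) (metis mem_Collect_eq monoD linear not_le order_trans)
qed (use assms in auto)

lemma generalized_inverse_ge:
  fixes G :: "real \<Rightarrow> real"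
  assumes "mono G" "\<alpha> \<le> G z" "G y < \<alpha>"
  shows "y \<le> Inf {y. \<alpha> \<le> G y}"
proof (rule cInf_greatest)
  fix u assume "u \<in> {y. \<alpha> \<le> G y}"
  then show "y \<le> u" using assms(1,3) by (metis mem_Collect_eq monoD linear not_le order_trans)
qed (use assms in auto)

text \<open>The level is reached at every point to the right of the infimum, and right continuity
  carries it to the infimum itself.\<close>

lemma (in real_distribution) cdf_generalized_inverse_ge:
  assumes "a \<le> cdf M y"
  shows "a \<le> cdf M (Inf {y. a \<le> cdf M y})"
proof (rule tendsto_lowerbound)
  let ?q = "Inf {y. a \<le> cdf M y}"
  show "(cdf M \<longlongrightarrow> cdf M ?q) (at_right ?q)"
    using cdf_is_right_cont by (simp add: continuous_within)
  have "a \<le> cdf M u" if "?q < u" for u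
    using generalized_inverse_ge[of "cdf M", OF monoI assms, of u] cdf_nondecreasing that by fastforce
  then show "\<forall>\<^sub>F u in at_right ?q. a \<le> cdf M u"
    by (auto simp: eventually_at_filter)
qed simp

text \<open>The tail bounds are used at half the quantile, which avoids a limit.\<close>

lemma generalized_inverse_moment:
  fixes G :: "real \<Rightarrow> real"
  assumes "mono G" "G z < \<alpha>" "\<alpha> \<le> G z'" "0 < \<alpha>" "\<alpha> < 1" "0 < q" and S: "0 \<le> S"
    and right: "\<And>t. 0 < t \<Longrightarrow> (1 - G t) * t powr q \<le> S"
    and left: "\<And>t. 0 < t \<Longrightarrow> G (- t) * t powr q \<le> S"
  shows "\<bar>Inf {y. \<alpha> \<le> G y}\<bar> powr q \<le> 2 powr q / min \<alpha> (1 - \<alpha>) * S"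
proof -
  define Q where "Q = Inf {y. \<alpha> \<le> G y}"
  define t where "t = \<bar>Q\<bar> / 2"
  define k where "k = min \<alpha> (1 - \<alpha>)"
  have k: "0 < k" using assms by (simp add: k_def)
  have *: "k * t powr q \<le> S" if "Q \<noteq> 0"
  proof -
    have t: "0 < t" using that by (simp add: t_def)
    show ?thesis
    proof (cases "0 < Q")
      case True
      \<comment> \<open>Here \<open>t\<close> is half of \<open>Q\<close> and lies strictly below
        it, so the tail above \<open>t\<close> still has mass at least
        \<open>1 - \<alpha>\<close>.\<close>
      have "G t < \<alpha>"
      proof (rule ccontr)
        assume "\<not> G t < \<alpha>"
        then have "Q \<le> t" unfolding Q_def using assms(1,2) by (intro generalized_inverse_le) auto
        with True show False by (simp add: t_def)
      qed
      then have "k * t powr q \<le> (1 - G t) * t powr q" by (intro mult_right_mono) (auto simp: k_def)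
      also have "\<dots> \<le> S" by (rule right[OF t])
      finally show ?thesis .
    next
      case False
      \<comment> \<open>For negative \<open>Q\<close> the point \<open>- t\<close> is again half of
        \<open>Q\<close>, now strictly above the infimum, so the lower tail has mass at least
        \<open>\<alpha>\<close>.\<close>
      have "\<alpha> \<le> G (- t)"
      proof (rule ccontr)
        assume "\<not> \<alpha> \<le> G (- t)"
        then have "- t \<le> Q" unfolding Q_def using assms(1,3) by (intro generalized_inverse_ge) auto
        with False that show False by (simp add: t_def)
      qed
      then have "k * t powr q \<le> G (- t) * t powr q" by (intro mult_right_mono) (auto simp: k_def)
      also have "\<dots> \<le> S" by (rule left[OF t])
      finally show ?thesis .
    qed
  qed
  have "\<bar>Q\<bar> powr q = 2 powr q * t powr q"
    by (simp add: t_def powr_mult[symmetric])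
  also have "\<dots> = 2 powr q / k * (k * t powr q)" using k by simp
  also have "\<dots> \<le> 2 powr q / k * S"
  proof (cases "Q = 0")
    case True
    then show ?thesis using S k by (simp add: t_def)
  next
    case False
    then show ?thesis using * k by (intro mult_left_mono) auto
  qed
  finally show ?thesis by (simp add: Q_def k_def)
qed

text \<open>A quantitative form of uniform integrability: squares are truncated at \<open>L\<close>,
  and the excess is paid by the higher moment with a factor that vanishes as \<open>L\<close>
  grows.\<close>

lemma abs_square_le_powr:
  fixes Q L \<delta> :: real
  assumes "0 < L" "0 < \<delta>"
  shows "Q\<^sup>2 \<le> L\<^sup>2 + L powr (- \<delta>) * \<bar>Q\<bar> powr (2 + \<delta>)"
proof (cases "\<bar>Q\<bar> \<le> L")
  case True
  then have "Q\<^sup>2 \<le> L\<^sup>2" using assms by (simp add: abs_le_square_iff[symmetric])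
  then show ?thesis by (simp add: add_increasing2)
next
  case False
  then have "L powr \<delta> \<le> \<bar>Q\<bar> powr \<delta>" using assms by (intro powr_mono2) auto
  then have "1 \<le> L powr (- \<delta>) * \<bar>Q\<bar> powr \<delta>" using assms by (simp add: powr_minus field_simps)
  then have "\<bar>Q\<bar> powr 2 * 1 \<le> \<bar>Q\<bar> powr 2 * (L powr (- \<delta>) * \<bar>Q\<bar> powr \<delta>)"
    by (intro mult_left_mono) auto
  moreover have "\<bar>Q\<bar> powr 2 = Q\<^sup>2" using False assms by (subst powr_numeral) auto
  ultimately have "Q\<^sup>2 \<le> L powr (- \<delta>) * \<bar>Q\<bar> powr (2 + \<delta>)"
    by (simp add: powr_add mult_ac)
  then show ?thesis by (simp add: add_increasing)
qed

section \<open>Honest weighted averages\<close>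

text \<open>\<open>P\<close> is the law of one observation, obtained by drawing the covariate from
  \<open>\<mu>\<close> and the response from \<open>K\<close>; \<open>N\<close> is the law of the
  sample. Conditioning on covariates then means integrating out single responses with the
  kernel.\<close>

locale cond_sample = P: prob_space P
  for P :: "('x::second_countable_topology \<times> real) measure" +
  fixes \<mu> :: "'x measure" and K :: "'x \<Rightarrow> real measure" and I :: "nat set"
  assumes sets_P: "sets P = sets (borel \<Otimes>\<^sub>M borel)"
    and sets_mu: "sets \<mu> = sets borel"
    and K_kernel: "K \<in> measurable borel (prob_algebra borel)"
    and disintegration: "\<And>h. h \<in> borel_measurable (borel \<Otimes>\<^sub>M borel) \<Longrightarrow>
          (\<integral>\<^sup>+z. h z \<partial>P) = (\<integral>\<^sup>+x. \<integral>\<^sup>+y. h (x, y) \<partial>K x \<partial>\<mu>)"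
    and finite_I: "finite I"
begin

abbreviation N :: "(nat \<Rightarrow> 'x \<times> real) measure" where
  "N \<equiv> PiM I (\<lambda>_. P)"

sublocale prod: product_prob_space "\<lambda>_. P" ..

lemma K_prob: "prob_space (K x)"
  using measurable_space[OF K_kernel, of x] by (simp add: space_prob_algebra)

lemma K_measurable [measurable]: "K \<in> measurable borel (subprob_algebra borel)"
  using K_kernel by (rule measurable_prob_algebraD)

lemmas [measurable_cong] = sets_P sets_mu

lemma space_P: "space P = UNIV"
  using sets_eq_imp_space_eq[OF sets_P] by (simp add: space_pair_measure)

lemma space_N: "space N = extensional I"
  by (simp add: space_PiM space_P PiE_UNIV_domain PiE_def)

lemma measurable_coordinate:
  assumes "i \<in> I"
  shows "(\<lambda>d. d i) \<in> measurable N (borel \<Otimes>\<^sub>M borel)"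
  using measurable_component_singleton[OF assms, of "\<lambda>_. P"] measurable_cong_sets[OF refl sets_P, of N] by simp

lemma nn_integral_kernel_measurable:
  assumes [measurable]: "h \<in> borel_measurable (borel \<Otimes>\<^sub>M borel)"
  shows "(\<lambda>x. \<integral>\<^sup>+y. h (x, y) \<partial>K x) \<in> borel_measurable borel"
  by (rule nn_integral_measurable_subprob_algebra2[OF _ K_measurable]) simp

lemma nn_integral_P_cond:
  assumes W [measurable]: "W \<in> borel_measurable (borel \<Otimes>\<^sub>M borel)"
    and h [measurable]: "h \<in> borel_measurable (borel \<Otimes>\<^sub>M borel)"
    and const: "\<And>x y y'. W (x, y) = W (x, y')"
  shows "(\<integral>\<^sup>+z. W z * h z \<partial>P) = (\<integral>\<^sup>+z. W z * (\<integral>\<^sup>+y. h (fst z, y) \<partial>K (fst z)) \<partial>P)"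
proof -
  note [measurable] = nn_integral_kernel_measurable[OF h]
  have "(\<integral>\<^sup>+z. W z * h z \<partial>P) = (\<integral>\<^sup>+x. \<integral>\<^sup>+y. W (x, y) * h (x, y) \<partial>K x \<partial>\<mu>)"
    by (intro disintegration) measurable
  also have "\<dots> = (\<integral>\<^sup>+x. W (x, 0) * (\<integral>\<^sup>+y. h (x, y) \<partial>K x) \<partial>\<mu>)"
    by (subst const[of _ _ 0]) (simp add: nn_integral_cmult)
  \<comment> \<open>The inner integral over \<open>K x\<close> may be put back because its integrand
    is constant in \<open>y\<close> and \<open>K x\<close> has mass one; this returns to the form
    covered by \<open>disintegration\<close>.\<close>
  also have "\<dots> = (\<integral>\<^sup>+x. \<integral>\<^sup>+y. W (x, y) * (\<integral>\<^sup>+y. h (x, y) \<partial>K x) \<partial>K x \<partial>\<mu>)"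
    by (subst const[of _ _ 0]) (simp add: prob_space.emeasure_space_1[OF K_prob])
  also have "\<dots> = (\<integral>\<^sup>+z. W z * (\<integral>\<^sup>+y. h (fst z, y) \<partial>K (fst z)) \<partial>P)"
    by (subst disintegration) auto
  finally show ?thesis .
qed

text \<open>A tower property: Fubini isolates the coordinate \<open>i\<close>, where
  \<open>W\<close> sees only the covariate. \<open>W\<close> may still involve the responses of the
  other observations, and the cross terms below make use of this.\<close>

lemma nn_integral_resample:
  assumes i: "i \<in> I"
    and W [measurable]: "W \<in> borel_measurable N"
    and h [measurable]: "h \<in> borel_measurable (borel \<Otimes>\<^sub>M borel)"
    and const: "\<And>d x y y'. d \<in> space N \<Longrightarrow> W (d(i := (x, y))) = W (d(i := (x, y')))"
  shows "(\<integral>\<^sup>+d. W d * h (d i) \<partial>N) = (\<integral>\<^sup>+d. W d * (\<integral>\<^sup>+y. h (fst (d i), y) \<partial>K (fst (d i))) \<partial>N)"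
proof -
  note [measurable] = nn_integral_kernel_measurable[OF h]
  define J where "J = I - {i}"
  have J: "finite J" "i \<notin> J" "insert i J = I" using i finite_I by (auto simp: J_def)
  note [measurable] = measurable_coordinate[OF i]
  have upd: "(\<lambda>z. d(i := z)) \<in> measurable P N" if "d \<in> space (PiM J (\<lambda>_. P))" for d
    using measurable_compose[OF measurable_Pair1'[OF that] measurable_add_dim[of i J "\<lambda>_. P"]]
    by (simp add: J(3))
  have m: "(\<lambda>d. W d * h (d i)) \<in> borel_measurable N"
    "(\<lambda>d. W d * (\<integral>\<^sup>+y. h (fst (d i), y) \<partial>K (fst (d i)))) \<in> borel_measurable N"
    by measurable
  have "(\<integral>\<^sup>+d. W d * h (d i) \<partial>N) =
      (\<integral>\<^sup>+d. \<integral>\<^sup>+z. W (d(i := z)) * h z \<partial>P \<partial>PiM J (\<lambda>_. P))"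
    using prod.product_nn_integral_insert[OF J(1,2), of "\<lambda>d. W d * h (d i)"] m(1) by (simp add: J(3))
  also have "\<dots> = (\<integral>\<^sup>+d. \<integral>\<^sup>+z. W (d(i := z)) * (\<integral>\<^sup>+y. h (fst z, y) \<partial>K (fst z)) \<partial>P \<partial>PiM J (\<lambda>_. P))"
  proof (rule nn_integral_cong)
    fix d assume d: "d \<in> space (PiM J (\<lambda>_. P))"
    have "(\<lambda>z. W (d(i := z))) \<in> borel_measurable P"
      by (rule measurable_compose[OF upd[OF d] W])
    moreover have "W (d(i := (x, y))) = W (d(i := (x, y')))" for x y y'
    proof -
      have "d(i := (x, y)) \<in> space N" using measurable_space[OF upd[OF d], of "(x, y)"]
        by (simp add: space_P)
      from const[OF this, of x y y'] show ?thesis by simp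
    qed
    ultimately show "(\<integral>\<^sup>+z. W (d(i := z)) * h z \<partial>P) =
        (\<integral>\<^sup>+z. W (d(i := z)) * (\<integral>\<^sup>+y. h (fst z, y) \<partial>K (fst z)) \<partial>P)"
      by (intro nn_integral_P_cond) auto
  qed
  also have "\<dots> = (\<integral>\<^sup>+d. W d * (\<integral>\<^sup>+y. h (fst (d i), y) \<partial>K (fst (d i))) \<partial>N)"
    using prod.product_nn_integral_insert[OF J(1,2), of "\<lambda>d. W d * (\<integral>\<^sup>+y. h (fst (d i), y) \<partial>K (fst (d i)))"]
      m(2) by (simp add: J(3))
  finally show ?thesis .
qed

lemma cdf_K_measurable [measurable]: "(\<lambda>x. cdf (K x) y) \<in> borel_measurable borel"
  unfolding cdf_def by measurable

lemma cdf_K_bounds: "0 \<le> cdf (K x) y" "cdf (K x) y \<le> 1"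
  using prob_space.prob_le_1[OF K_prob] by (auto simp: cdf_def)

lemma integral_resample_indicator:
  assumes i: "i \<in> I"
    and W [measurable]: "W \<in> borel_measurable N"
    and nonneg: "\<And>d. 0 \<le> W d" and bounded: "\<And>d. W d \<le> (1::real)"
    and const: "\<And>d x y y'. d \<in> space N \<Longrightarrow> W (d(i := (x, y))) = W (d(i := (x, y')))"
  shows "(\<integral>d. W d * indicator {..y} (snd (d i)) \<partial>N) = (\<integral>d. W d * cdf (K (fst (d i))) y \<partial>N)"
proof -
  note [measurable] = measurable_coordinate[OF i]
  have [measurable]: "(\<lambda>d. cdf (K (fst (d i))) y) \<in> borel_measurable N"
    "(\<lambda>d. indicator {..y} (snd (d i)) :: real) \<in> borel_measurable N"
    by measurable
  have "(\<integral>\<^sup>+d. ennreal (W d * indicator {..y} (snd (d i))) \<partial>N) =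
    (\<integral>\<^sup>+d. ennreal (W d) * (\<lambda>z. indicator {..y} (snd z)) (d i) \<partial>N)"
    using nonneg by (intro nn_integral_cong) (auto simp: indicator_def)
  also have "\<dots> = (\<integral>\<^sup>+d. ennreal (W d) * (\<integral>\<^sup>+y'. indicator {..y} y' \<partial>K (fst (d i))) \<partial>N)"
    using const by (subst nn_integral_resample[OF i]) (auto simp: nonneg)
  also have "\<dots> = (\<integral>\<^sup>+d. ennreal (W d * cdf (K (fst (d i))) y) \<partial>N)"
    using nonneg
    by (intro nn_integral_cong)
      (simp add: cdf_def ennreal_mult finite_measure.emeasure_eq_measure[OF prob_space.finite_measure[OF K_prob]])
  finally show ?thesis
    using nonneg cdf_K_bounds
    by (subst (1 2) integral_eq_nn_integral) auto
qed

text \<open>The cross terms vanish since, given all covariates, the responses are independent; honesty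
  enters as the assumption that the weights are functions of the covariates.\<close>

lemma second_moment_weighted_noise:
  assumes w [measurable]: "\<And>i. i \<in> I \<Longrightarrow> w i \<in> borel_measurable N"
    and nonneg: "\<And>i d. 0 \<le> w i d" and bounded: "\<And>i d. w i d \<le> (1::real)"
    and honest: "\<And>i d d'. d \<in> space N \<Longrightarrow> d' \<in> space N \<Longrightarrow> (\<And>j. j \<in> I \<Longrightarrow> fst (d j) = fst (d' j)) \<Longrightarrow>
      w i d = w i d'"
  shows "(\<integral>\<^sup>+d. ennreal ((\<Sum>i\<in>I. w i d * (indicator {..y} (snd (d i)) - cdf (K (fst (d i))) y))\<^sup>2) \<partial>N)
    \<le> (\<integral>\<^sup>+d. ennreal (\<Sum>i\<in>I. (w i d)\<^sup>2) \<partial>N)"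
proof -
  note [simp] = nonneg bounded cdf_K_bounds
  note comp [measurable] = measurable_coordinate
  define a where "a i d = (indicator {..y} (snd (d i)) :: real)" for i :: nat and d :: "nat \<Rightarrow> 'x \<times> real"
  define F where "F i d = cdf (K (fst (d i))) y" for i :: nat and d :: "nat \<Rightarrow> 'x \<times> real"
  have [measurable]: "a i \<in> borel_measurable N" "F i \<in> borel_measurable N" if "i \<in> I" for i
    using that comp[OF that] unfolding a_def F_def by measurable
  have aF [simp]: "0 \<le> a i d" "a i d \<le> 1" "0 \<le> F i d" "F i d \<le> 1" for i d
    by (auto simp: a_def F_def)
  have upd: "d(i := z) \<in> space N" if "d \<in> space N" "i \<in> I" for d i z
    using that by (auto simp: space_N extensional_def)
  have honest_upd: "w j (d(i := (x, y1))) = w j (d(i := (x, y2)))"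
    if "d \<in> space N" "i \<in> I" for d i j x y1 y2
    by (rule honest) (use that upd in auto)
  have int: "integrable N g" if "g \<in> borel_measurable N" "\<And>d. \<bar>g d\<bar> \<le> 1" for g :: "_ \<Rightarrow> real"
    using that by (intro prod.integrable_const_bound[where B=1]) auto
  have prod1: "\<bar>p * q\<bar> \<le> 1" if "\<bar>p\<bar> \<le> 1" "\<bar>q\<bar> \<le> 1" for p q :: real
    using that by (simp add: abs_mult mult_le_one)
  have cross: "(\<integral>d. (w i d * (a i d - F i d)) * (w j d * (a j d - F j d)) \<partial>N) = 0"
    if i: "i \<in> I" and j: "j \<in> I" and ij: "i \<noteq> j" for i j
  proof -
    note [measurable] = comp[OF i] comp[OF j]
    \<comment> \<open>The weight contains the response of \<open>j\<close> but not that of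
      \<open>i\<close>, so only \<open>a i\<close> is averaged. The next fact does the same with
      \<open>F j\<close> in place of \<open>a j\<close>, and together they cancel the four terms of
      the product.\<close>
    have 1: "(\<integral>d. (w i d * w j d * a j d) * a i d \<partial>N) = (\<integral>d. (w i d * w j d * a j d) * F i d \<partial>N)"
      unfolding a_def[of i] F_def
    proof (rule integral_resample_indicator[OF i])
      show "w i (d(i := (x, y1))) * w j (d(i := (x, y1))) * a j (d(i := (x, y1))) =
          w i (d(i := (x, y2))) * w j (d(i := (x, y2))) * a j (d(i := (x, y2)))"
        if "d \<in> space N" for d x y1 y2
        using honest_upd[OF that i, of i x y1 y2] honest_upd[OF that i, of j x y1 y2] ij
        by (simp add: a_def)
    qed (use i j in \<open>auto intro!: mult_le_one\<close>)
    have 2: "(\<integral>d. (w i d * w j d * F j d) * a i d \<partial>N) = (\<integral>d. (w i d * w j d * F j d) * F i d \<partial>N)"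
      unfolding a_def[of i] F_def[of i]
    proof (rule integral_resample_indicator[OF i])
      show "w i (d(i := (x, y1))) * w j (d(i := (x, y1))) * F j (d(i := (x, y1))) =
          w i (d(i := (x, y2))) * w j (d(i := (x, y2))) * F j (d(i := (x, y2)))"
        if "d \<in> space N" for d x y1 y2
        using honest_upd[OF that i, of i x y1 y2] honest_upd[OF that i, of j x y1 y2] ij
        by (simp add: F_def)
    qed (use i j in \<open>auto intro!: mult_le_one\<close>)
    have "(\<integral>d. (w i d * (a i d - F i d)) * (w j d * (a j d - F j d)) \<partial>N) =
      (\<integral>d. ((w i d * w j d * a j d) * a i d - (w i d * w j d * a j d) * F i d) -
        ((w i d * w j d * F j d) * a i d - (w i d * w j d * F j d) * F i d) \<partial>N)"
      by (intro Bochner_Integration.integral_cong) (auto simp: algebra_simps)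
    also have "\<dots> = ((\<integral>d. (w i d * w j d * a j d) * a i d \<partial>N) - (\<integral>d. (w i d * w j d * a j d) * F i d \<partial>N)) -
       ((\<integral>d. (w i d * w j d * F j d) * a i d \<partial>N) - (\<integral>d. (w i d * w j d * F j d) * F i d \<partial>N))"
      using i j by (subst Bochner_Integration.integral_diff, (intro Bochner_Integration.integrable_diff int prod1; simp)+)+ auto
    also have "\<dots> = 0" using 1 2 by simp
    finally show ?thesis .
  qed
  define g where "g i d = w i d * (a i d - F i d)" for i d
  have g1: "\<bar>g i d\<bar> \<le> 1" for i d
  proof -
    have "\<bar>a i d - F i d\<bar> \<le> 1" using aF[of i d] by linarith
    then show ?thesis unfolding g_def by (intro prod1) auto
  qed
  have [measurable]: "g i \<in> borel_measurable N" if "i \<in> I" for i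
    using that unfolding g_def by measurable
  have int_g: "integrable N (\<lambda>d. g i d * g j d)" if "i \<in> I" "j \<in> I" for i j
    using that by (intro int prod1 g1) auto
  have "(\<integral>d. (\<Sum>i\<in>I. g i d)\<^sup>2 \<partial>N) = (\<Sum>i\<in>I. \<Sum>j\<in>I. \<integral>d. g i d * g j d \<partial>N)"
    unfolding power2_eq_square sum_product
    using int_g by (simp add: Bochner_Integration.integral_sum)
  also have "\<dots> = (\<Sum>i\<in>I. \<Sum>j\<in>I. if i = j then \<integral>d. (g i d)\<^sup>2 \<partial>N else 0)"
    using cross by (intro sum.cong) (auto simp: g_def power2_eq_square)
  also have "\<dots> = (\<Sum>i\<in>I. \<integral>d. (g i d)\<^sup>2 \<partial>N)"
    using finite_I by (simp add: sum.delta)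
  also have "\<dots> \<le> (\<Sum>i\<in>I. \<integral>d. (w i d)\<^sup>2 \<partial>N)"
  proof (intro sum_mono integral_mono)
    fix i d assume i: "i \<in> I"
    show "integrable N (\<lambda>d. (g i d)\<^sup>2)" using int_g[OF i i] by (simp add: power2_eq_square)
    show "integrable N (\<lambda>d. (w i d)\<^sup>2)" unfolding power2_eq_square using i by (intro int prod1) auto
    have "\<bar>a i d - F i d\<bar> \<le> 1" using aF[of i d] by linarith
    then have "(a i d - F i d)\<^sup>2 \<le> 1" by (simp add: abs_square_le_1)
    then show "(g i d)\<^sup>2 \<le> (w i d)\<^sup>2"
      unfolding g_def power_mult_distrib by (intro mult_left_le) auto
  qed
  also have "\<dots> = (\<integral>d. (\<Sum>i\<in>I. (w i d)\<^sup>2) \<partial>N)"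
    by (intro Bochner_Integration.integral_sum[symmetric]) (auto simp: power2_eq_square intro!: int prod1)
  finally have le: "(\<integral>d. (\<Sum>i\<in>I. g i d)\<^sup>2 \<partial>N) \<le> (\<integral>d. (\<Sum>i\<in>I. (w i d)\<^sup>2) \<partial>N)" .
  have "integrable N (\<lambda>d. (\<Sum>i\<in>I. g i d)\<^sup>2)" unfolding power2_eq_square sum_product
    using int_g by (intro Bochner_Integration.integrable_sum) auto
  moreover have "integrable N (\<lambda>d. \<Sum>i\<in>I. (w i d)\<^sup>2)"
    by (intro Bochner_Integration.integrable_sum) (auto simp: power2_eq_square intro!: int prod1)
  ultimately show ?thesis
    using le unfolding g_def a_def F_def
    by (subst (1 2) nn_integral_eq_integral) (auto intro!: sum_nonneg ennreal_leI)
qed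

end

section \<open>A uniform law of large numbers\<close>

text \<open>Finiteness of the bracketing numbers in \<open>L1(\<mu>)\<close>, the classical
  sufficient condition for the Glivenko-Cantelli property. The brackets may be arbitrary Borel
  sets.\<close>

definition bracketed :: "'x::topological_space measure \<Rightarrow> 'x set set \<Rightarrow> bool" where
  "bracketed \<mu> \<C> \<longleftrightarrow> (\<forall>\<epsilon>>0. \<exists>F. finite F \<and> F \<subseteq> sets borel \<and>
     (\<forall>A\<in>\<C>. \<exists>L\<in>F. \<exists>U\<in>F. L \<subseteq> A \<and> A \<subseteq> U \<and> measure \<mu> (U - L) \<le> \<epsilon>))"

lemma bracketedE:
  assumes "bracketed \<mu> \<C>" "0 < \<epsilon>"
  obtains F where "finite F" "F \<subseteq> sets borel"
    "\<forall>A\<in>\<C>. \<exists>L\<in>F. \<exists>U\<in>F. L \<subseteq> A \<and> A \<subseteq> U \<and> measure \<mu> (U - L) \<le> \<epsilon>"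
  using assms unfolding bracketed_def by (elim allE[of _ \<epsilon>] impE exE conjE) (assumption, rule that)

lemma bracketed_singleton: "A \<in> sets borel \<Longrightarrow> bracketed \<mu> {A}"
  unfolding bracketed_def by (intro allI impI exI[of _ "{A}"]) auto

lemma bracketed_subset: "bracketed \<mu> \<C> \<Longrightarrow> \<D> \<subseteq> \<C> \<Longrightarrow> bracketed \<mu> \<D>"
  unfolding bracketed_def by (meson subsetD)

lemma bracketed_Un:
  assumes "bracketed \<mu> \<C>" "bracketed \<mu> \<D>"
  shows "bracketed \<mu> (\<C> \<union> \<D>)"
  unfolding bracketed_def
proof (intro allI impI)
  fix \<epsilon> :: real assume "0 < \<epsilon>"
  obtain F where F: "finite F" "F \<subseteq> sets borel"
      "\<forall>A\<in>\<C>. \<exists>L\<in>F. \<exists>U\<in>F. L \<subseteq> A \<and> A \<subseteq> U \<and> measure \<mu> (U - L) \<le> \<epsilon>"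
    by (rule bracketedE[OF assms(1) \<open>0 < \<epsilon>\<close>])
  obtain G where G: "finite G" "G \<subseteq> sets borel"
      "\<forall>A\<in>\<D>. \<exists>L\<in>G. \<exists>U\<in>G. L \<subseteq> A \<and> A \<subseteq> U \<and> measure \<mu> (U - L) \<le> \<epsilon>"
    by (rule bracketedE[OF assms(2) \<open>0 < \<epsilon>\<close>])
  have "\<exists>L\<in>F \<union> G. \<exists>U\<in>F \<union> G. L \<subseteq> A \<and> A \<subseteq> U \<and> measure \<mu> (U - L) \<le> \<epsilon>"
    if "A \<in> \<C> \<union> \<D>" for A
    using that
  proof
    assume "A \<in> \<C>"
    from bspec[OF F(3) this] show ?thesis by blast
  next
    assume "A \<in> \<D>"
    from bspec[OF G(3) this] show ?thesis by blast
  qed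
  then show "\<exists>F. finite F \<and> F \<subseteq> sets borel \<and>
      (\<forall>A\<in>\<C> \<union> \<D>. \<exists>L\<in>F. \<exists>U\<in>F. L \<subseteq> A \<and> A \<subseteq> U \<and> measure \<mu> (U - L) \<le> \<epsilon>)"
    using F(1,2) G(1,2) by (intro exI[of _ "F \<union> G"] conjI ballI) simp_all
qed

lemma bracketed_UN:
  assumes "finite I" "\<And>i. i \<in> I \<Longrightarrow> bracketed \<mu> (\<C> i)"
  shows "bracketed \<mu> (\<Union>i\<in>I. \<C> i)"
  using assms
proof (induction I)
  case empty
  then show ?case using bracketed_subset[OF bracketed_singleton[of "{}" \<mu>], of "{}"] by simp
next
  case (insert i I)
  then show ?case using bracketed_Un[of \<mu> "\<C> i"] by simp
qed

text \<open>The gap between the intersected brackets is covered by the two original gaps, so half of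
  the tolerance goes to each.\<close>

lemma bracketed_Int:
  assumes fin: "finite_measure \<mu>" and sets: "sets \<mu> = sets borel"
    and "bracketed \<mu> \<C>" "bracketed \<mu> \<D>"
  shows "bracketed \<mu> {A \<inter> B |A B. A \<in> \<C> \<and> B \<in> \<D>}"
  unfolding bracketed_def
proof (intro allI impI)
  interpret finite_measure \<mu> by fact
  fix \<epsilon> :: real assume "0 < \<epsilon>"
  then have "0 < \<epsilon> / 2" by simp
  obtain F where F: "finite F" "F \<subseteq> sets borel"
      "\<forall>A\<in>\<C>. \<exists>L\<in>F. \<exists>U\<in>F. L \<subseteq> A \<and> A \<subseteq> U \<and> measure \<mu> (U - L) \<le> \<epsilon> / 2"
    by (rule bracketedE[OF assms(3) \<open>0 < \<epsilon> / 2\<close>])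
  obtain G where G: "finite G" "G \<subseteq> sets borel"
      "\<forall>A\<in>\<D>. \<exists>L\<in>G. \<exists>U\<in>G. L \<subseteq> A \<and> A \<subseteq> U \<and> measure \<mu> (U - L) \<le> \<epsilon> / 2"
    by (rule bracketedE[OF assms(4) \<open>0 < \<epsilon> / 2\<close>])
  define H where "H = (\<lambda>(A, B). A \<inter> B) ` (F \<times> G)"
  have "\<exists>L\<in>H. \<exists>U\<in>H. L \<subseteq> A \<inter> B \<and> A \<inter> B \<subseteq> U \<and> measure \<mu> (U - L) \<le> \<epsilon>"
    if AB: "A \<in> \<C>" "B \<in> \<D>" for A B
  proof -
    obtain L U where LU: "L \<in> F" "U \<in> F" "L \<subseteq> A" "A \<subseteq> U" "measure \<mu> (U - L) \<le> \<epsilon> / 2"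
      using bspec[OF F(3) AB(1)] by blast
    obtain L' U' where LU': "L' \<in> G" "U' \<in> G" "L' \<subseteq> B" "B \<subseteq> U'" "measure \<mu> (U' - L') \<le> \<epsilon> / 2"
      using bspec[OF G(3) AB(2)] by blast
    have [measurable]: "L \<in> sets \<mu>" "U \<in> sets \<mu>" "L' \<in> sets \<mu>" "U' \<in> sets \<mu>"
      using LU LU' F G sets by auto
    have "measure \<mu> (U \<inter> U' - L \<inter> L') \<le> measure \<mu> ((U - L) \<union> (U' - L'))"
      by (intro finite_measure_mono) auto
    also have "\<dots> \<le> measure \<mu> (U - L) + measure \<mu> (U' - L')"
      by (intro measure_Un_le) auto
    also have "\<dots> \<le> \<epsilon>" using LU LU' by simp
    finally show ?thesis
      using LU LU' by (intro bexI[of _ "L \<inter> L'"] bexI[of _ "U \<inter> U'"]) (auto simp: H_def)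
  qed
  moreover have "finite H" "H \<subseteq> sets borel" using F(1,2) G(1,2) by (auto simp: H_def)
  ultimately show "\<exists>F. finite F \<and> F \<subseteq> sets borel \<and>
      (\<forall>A\<in>{A \<inter> B |A B. A \<in> \<C> \<and> B \<in> \<D>}. \<exists>L\<in>F. \<exists>U\<in>F. L \<subseteq> A \<and> A \<subseteq> U \<and> measure \<mu> (U - L) \<le> \<epsilon>)"
    by (intro exI[of _ H] conjI ballI) (assumption, assumption, elim CollectE exE conjE, simp only:)
qed

lemma bracketed_compl:
  assumes "bracketed \<mu> \<C>"
  shows "bracketed \<mu> (uminus ` \<C>)"
  unfolding bracketed_def
proof (intro allI impI)
  fix \<epsilon> :: real assume "0 < \<epsilon>"
  obtain F where F: "finite F" "F \<subseteq> sets borel"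
      "\<forall>A\<in>\<C>. \<exists>L\<in>F. \<exists>U\<in>F. L \<subseteq> A \<and> A \<subseteq> U \<and> measure \<mu> (U - L) \<le> \<epsilon>"
    by (rule bracketedE[OF assms \<open>0 < \<epsilon>\<close>])
  have "\<exists>L\<in>uminus ` F. \<exists>U\<in>uminus ` F. L \<subseteq> - A \<and> - A \<subseteq> U \<and> measure \<mu> (U - L) \<le> \<epsilon>" if A: "A \<in> \<C>" for A
  proof -
    obtain L U where "L \<in> F" "U \<in> F" "L \<subseteq> A" "A \<subseteq> U" "measure \<mu> (U - L) \<le> \<epsilon>"
      using bspec[OF F(3) A] by blast
    moreover have "- L - - U = U - L" by auto
    ultimately show ?thesis by (intro bexI[of _ "- U"] bexI[of _ "- L"]) auto
  qed
  moreover have "uminus ` F \<subseteq> sets borel" using F(2) by (auto intro: borel_comp)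
  ultimately show "\<exists>F. finite F \<and> F \<subseteq> sets borel \<and>
      (\<forall>A\<in>uminus ` \<C>. \<exists>L\<in>F. \<exists>U\<in>F. L \<subseteq> A \<and> A \<subseteq> U \<and> measure \<mu> (U - L) \<le> \<epsilon>)"
    using F(1) by (intro exI[of _ "uminus ` F"] conjI ballI) (simp, assumption, elim imageE, simp only:)
qed

text \<open>The brackets have quantiles of \<open>g\<close> as thresholds.\<close>

lemma bracketed_sublevels:
  fixes g :: "'x::topological_space \<Rightarrow> real"
  assumes "prob_space \<mu>" "sets \<mu> = sets borel" "g \<in> borel_measurable borel"
  shows "bracketed \<mu> (range (\<lambda>s. {x. g x \<le> s}))"
  unfolding bracketed_def
proof (intro allI impI)
  interpret mu: prob_space \<mu> by fact
  note [measurable_cong] = assms(2) and [measurable] = assms(3)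
  define \<nu> where "\<nu> = distr \<mu> borel g"
  interpret nu: real_distribution \<nu> unfolding \<nu>_def by (intro mu.real_distribution_distr) simp
  have sp: "space \<mu> = UNIV" using sets_eq_imp_space_eq[OF assms(2)] by simp
  have meas: "measure \<mu> {x. g x \<in> A} = measure \<nu> A" if "A \<in> sets borel" for A
    using that by (simp add: \<nu>_def measure_distr sp vimage_def)
  have mono: "mono (cdf \<nu>)" by (intro monoI nu.cdf_nondecreasing)
  have low: "\<exists>z. cdf \<nu> z < a" if "0 < a" for a
    using order_tendstoD(2)[OF nu.cdf_lim_neg_infty that] by (auto simp: eventually_sequentially)
  fix \<epsilon> :: real assume eps: "0 < \<epsilon>"
  then obtain K where K: "0 < K" "1 / real K < \<epsilon>"
    using nat_approx_posE[OF eps] by (metis of_nat_Suc zero_less_Suc)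
  define q where "q k = Inf {y. real k / real K \<le> cdf \<nu> y}" for k :: nat
  \<comment> \<open>The law of \<open>g\<close> may have atoms. Closed sublevels at a quantile have
    mass at least the level and serve from below; open ones have mass at most the level and serve
    from above.\<close>
  define F where "F = {{}, UNIV} \<union> (\<lambda>k. {x. g x \<le> q k}) ` {..K} \<union> (\<lambda>k. {x. g x < q k}) ` {..K + 1}"
  have upper: "measure \<nu> {..<q k} \<le> real k / real K" if k0: "0 < k" for k
  proof (rule tendsto_upperbound[OF nu.cdf_at_left])
    obtain z where z: "cdf \<nu> z < real k / real K" using low[of "real k / real K"] k0 K by auto
    have "cdf \<nu> y \<le> real k / real K" if "y < q k" for y
      using generalized_inverse_le[OF mono z, of y] that by (fastforce simp: q_def)
    then show "\<forall>\<^sub>F y in at_left (q k). cdf \<nu> y \<le> real k / real K"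
      by (auto simp: eventually_at_filter)
  qed simp
  have lower: "real k / real K \<le> cdf \<nu> (q k)" if "real k / real K \<le> cdf \<nu> y" for k y
    unfolding q_def by (rule nu.cdf_generalized_inverse_ge[OF that])
  have "\<exists>L\<in>F. \<exists>U\<in>F. L \<subseteq> {x. g x \<le> s} \<and> {x. g x \<le> s} \<subseteq> U \<and> measure \<mu> (U - L) \<le> \<epsilon>" for s
  proof -
    \<comment> \<open>Rounding down puts \<open>cdf \<nu> s\<close> between the levels
      \<open>k / K\<close> and \<open>(k + 1) / K\<close>, so the bracket gap is at most
      \<open>1 / K\<close>.\<close>
    define k where "k = nat \<lfloor>real K * cdf \<nu> s\<rfloor>"
    have "real k \<le> real K * cdf \<nu> s" "real K * cdf \<nu> s < real k + 1"
      using nu.cdf_nonneg[of s] by (auto simp: k_def)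
    then have k: "real k / real K \<le> cdf \<nu> s" "cdf \<nu> s < real (k + 1) / real K"
      using K by (auto simp: field_simps)
    have "k \<le> K"
    proof -
      have "real k / real K \<le> 1" using k(1) nu.cdf_bounded_prob[of s] by linarith
      then show ?thesis using K by (simp add: field_simps)
    qed
    obtain L where L: "L \<in> F" "L \<subseteq> {x. g x \<le> s}" "real k / real K \<le> measure \<mu> L"
    proof (cases "k = 0")
      case True
      then show ?thesis by (intro that[of "{}"]) (auto simp: F_def)
    next
      case False
      then obtain z where z: "cdf \<nu> z < real k / real K" using low[of "real k / real K"] K by auto
      have "q k \<le> s" unfolding q_def by (rule generalized_inverse_le[OF mono z k(1)])
      moreover have "measure \<mu> {x. g x \<le> q k} = cdf \<nu> (q k)"
        using meas[of "{..q k}"] by (simp add: cdf_def)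
      ultimately show ?thesis using lower[OF k(1)] \<open>k \<le> K\<close>
        by (intro that[of "{x. g x \<le> q k}"]) (auto simp: F_def)
    qed
    obtain U where U: "U \<in> F" "{x. g x \<le> s} \<subseteq> U" "measure \<mu> U \<le> real (k + 1) / real K"
    proof (cases "\<exists>y. real (k + 1) / real K \<le> cdf \<nu> y")
      case True
      then obtain y where y: "real (k + 1) / real K \<le> cdf \<nu> y" by auto
      have "s < q (k + 1)"
        using lower[OF y] generalized_inverse_ge[OF mono y k(2)] k(2) unfolding q_def
        by (metis less_le not_le)
      moreover have "measure \<mu> {x. g x < q (k + 1)} = measure \<nu> {..<q (k + 1)}"
        using meas[of "{..<q (k + 1)}"] by simp
      ultimately show ?thesis using upper[of "k + 1"] \<open>k \<le> K\<close>
        by (intro that[of "{x. g x < q (k + 1)}"]) (auto simp: F_def)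
    next
      \<comment> \<open>If the level \<open>(k + 1) / K\<close> is never reached, it is at least the
        total mass, and the whole space is a good enough upper bracket.\<close>
      case False
      then have "1 \<le> real (k + 1) / real K"
        by (intro tendsto_upperbound[OF nu.cdf_lim_at_top_prob]) (auto intro!: always_eventually simp: not_le less_imp_le)
      then show ?thesis using mu.prob_space sp by (intro that[of UNIV]) (auto simp: F_def)
    qed
    have "F \<subseteq> sets \<mu>" by (auto simp: F_def assms(2))
    then have "measure \<mu> (U - L) = measure \<mu> U - measure \<mu> L"
      using L U by (intro mu.finite_measure_Diff) auto
    also have "\<dots> \<le> 1 / real K" using L U by (simp add: add_divide_distrib)
    finally show ?thesis using L U K by (intro bexI[of _ L] bexI[of _ U]) auto
  qed
  then show "\<exists>F. finite F \<and> F \<subseteq> sets borel \<and> (\<forall>A\<in>range (\<lambda>s. {x. g x \<le> s}).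
      \<exists>L\<in>F. \<exists>U\<in>F. L \<subseteq> A \<and> A \<subseteq> U \<and> measure \<mu> (U - L) \<le> \<epsilon>)"
    by (intro exI[of _ F]) (auto simp: F_def)
qed

text \<open>For a fixed address, a nonempty cell is an intersection of at most
  \<open>length p\<close> half spaces. The coordinates come from a finite set and the thresholds are
  handled by quantiles, so the class stays small although all trees are allowed. The empty set is
  added for trees that end above the address.\<close>

lemma bracketed_regions:
  fixes \<mu> :: "(real ^ 'v::finite) measure"
  assumes \<mu>: "prob_space \<mu>" "sets \<mu> = sets borel"
  shows "bracketed \<mu> (range (\<lambda>t. region t p))"
proof (induction p)
  case Nil
  show ?case using bracketed_singleton[of UNIV] by simp
next
  case (Cons c p)
  define H where "H m = range (\<lambda>s. {x :: real ^ 'v. x $ m \<le> s})" for m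
  have H: "bracketed \<mu> (H m)" for m
    unfolding H_def using \<mu>
    by (intro bracketed_sublevels borel_measurable_continuous_onI continuous_intros)
  define H' where "H' m = (if c then H m else uminus ` H m)" for m
  have "bracketed \<mu> (H' m)" for m
    using H[of m] bracketed_compl[OF H[of m]] by (simp add: H'_def)
  from bracketed_Int[OF prob_space.finite_measure[OF \<mu>(1)] \<mu>(2) this Cons]
  have "bracketed \<mu> (\<Union>m. {A \<inter> B |A B. A \<in> H' m \<and> B \<in> range (\<lambda>t. region t p)})"
    by (intro bracketed_UN) auto
  from bracketed_Un[OF bracketed_singleton[of "{}"] this]
  have "bracketed \<mu> ({{}} \<union> (\<Union>m. {A \<inter> B |A B. A \<in> H' m \<and> B \<in> range (\<lambda>t. region t p)}))" by simp
  then show ?case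
  proof (rule bracketed_subset, intro subsetI)
    fix A assume "A \<in> range (\<lambda>t :: 'v rtree. region t (c # p))"
    then obtain t :: "'v rtree" where A: "A = region t (c # p)" by auto
    show "A \<in> {{}} \<union> (\<Union>m. {A \<inter> B |A B. A \<in> H' m \<and> B \<in> range (\<lambda>t. region t p)})"
    proof (cases t)
      case Leaf
      then show ?thesis by (simp add: A)
    next
      case (Split m s l r)
      have compl: "{x :: real ^ 'v. s < x $ m} = - {x. x $ m \<le> s}" by auto
      have "\<exists>A\<in>H' m. region t (c # p) = A \<inter> region (if c then l else r) p"
        by (cases c) (auto simp: Split H'_def H_def compl)
      then obtain A' where "A' \<in> H' m" "A = A' \<inter> region (if c then l else r) p" by (auto simp: A)
      then have "A \<in> {A \<inter> B |A B. A \<in> H' m \<and> B \<in> range (\<lambda>t. region t p)}" by blast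
      then show ?thesis by blast
    qed
  qed
qed

text \<open>Hoeffding and a union bound control the finitely many bracketing sets, and monotonicity
  of counts and measure squeezes every member of the class. The exceptional events refer to the
  bracketing sets only, which makes them measurable for uncountable classes too.\<close>

lemma (in prob_space) uniform_law_of_large_numbers:
  fixes Xs :: "nat \<Rightarrow> 'a \<Rightarrow> 'x::topological_space"
  assumes indep: "indep_vars (\<lambda>_. borel) Xs UNIV"
    and distr: "\<And>i. distr M borel (Xs i) = \<mu>"
    and br: "bracketed \<mu> \<C>" and "0 < \<epsilon>"
  obtains G where "\<And>n. G n \<in> sets M" "(\<lambda>n. prob (G n)) \<longlonglongrightarrow> 0"
    "\<And>n \<omega> A. \<omega> \<in> space M - G n \<Longrightarrow> 0 < n \<Longrightarrow> A \<in> \<C> \<Longrightarrow> A \<in> sets borel \<Longrightarrow>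
       \<bar>real (card {i\<in>{..<n}. Xs i \<omega> \<in> A}) / real n - measure \<mu> A\<bar> \<le> \<epsilon>"
proof -
  have rv [measurable]: "Xs i \<in> borel_measurable M" for i
    using indep by (auto simp: indep_vars_def)
  have mu_distr: "\<mu> = distr M borel (Xs 0)" by (simp add: distr)
  then have mu: "prob_space \<mu>" "sets \<mu> = sets borel" by (auto intro: prob_space_distr)
  interpret mu: prob_space \<mu> by fact
  \<comment> \<open>One half of the tolerance is for the deviation on the bracketing sets, the other
    for the bracket gap.\<close>
  define \<eta> where "\<eta> = \<epsilon> / 2"
  have eta: "0 < \<eta>" using \<open>0 < \<epsilon>\<close> by (simp add: \<eta>_def)
  obtain F where F: "finite F" "F \<subseteq> sets borel"
      "\<forall>A\<in>\<C>. \<exists>L\<in>F. \<exists>U\<in>F. L \<subseteq> A \<and> A \<subseteq> U \<and> measure \<mu> (U - L) \<le> \<eta>"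
    by (rule bracketedE[OF br eta])
  define E where "E n A = {\<omega> \<in> space M. \<bar>(\<Sum>i<n. indicator A (Xs i \<omega>)) - real n * measure \<mu> A\<bar> \<ge> real n * \<eta>}" for n A
  define G where "G n = (\<Union>A\<in>F. E n A)" for n
  have E_meas: "E n A \<in> sets M" if "A \<in> F" for n A
  proof -
    have [measurable]: "A \<in> sets borel" using that F by auto
    show ?thesis unfolding E_def by measurable
  qed
  have hoeff: "prob (E n A) \<le> 2 * exp (-2 * \<eta>\<^sup>2 * real n)" if A: "A \<in> F" and n: "0 < n" for n A
  proof -
    have [measurable]: "A \<in> sets borel" using A F by auto
    define Z where "Z i \<omega> = (indicator A (Xs i \<omega>) :: real)" for i \<omega>
    have Z: "indep_vars (\<lambda>_. borel) Z UNIV"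
      unfolding Z_def by (rule indep_vars_compose2[OF indep]) auto
    have dZ: "distr M borel (Z i) = distr \<mu> borel (indicator A)" for i
      unfolding distr[of i, symmetric] Z_def by (subst distr_distr) (simp_all add: comp_def)
    interpret Z: Hoeffding_ineq_iid M "{..<n}" Z "Z 0" 0 1 "expectation (Z 0)"
    proof unfold_locales
      show "indep_vars (\<lambda>_. borel) Z {..<n}" by (rule indep_vars_subset[OF Z]) simp
      show "distr M borel (Z i) = distr M borel (Z 0)" for i by (simp only: dZ)
      show "random_variable borel (Z 0)" unfolding Z_def by measurable
    qed (simp_all add: Z_def)
    have "expectation (Z 0) = (\<integral>x. indicator A x \<partial>\<mu>)"
      unfolding mu_distr Z_def by (subst integral_distr) auto
    also have "\<dots> = measure \<mu> A" using sets_eq_imp_space_eq[OF mu(2)] by simp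
    finally have EZ: "expectation (Z 0) = measure \<mu> A" .
    have "{..<n} \<noteq> {}" using n by auto
    then have "prob (E n A) \<le> 2 * exp (-2 * (real n * \<eta>)\<^sup>2 / (real n * (1 - 0)\<^sup>2))"
      using Z.Hoeffding_ineq_abs_ge[of "real n * \<eta>"] eta n unfolding EZ by (simp add: E_def Z_def)
    also have "-2 * (real n * \<eta>)\<^sup>2 / (real n * (1 - 0)\<^sup>2) = -2 * \<eta>\<^sup>2 * real n"
      using n by (simp add: power2_eq_square)
    finally show ?thesis .
  qed
  have G_bound: "prob (G n) \<le> real (card F) * (2 * exp (-2 * \<eta>\<^sup>2 * real n))" if "0 < n" for n
  proof -
    have "prob (G n) \<le> (\<Sum>A\<in>F. prob (E n A))"
      unfolding G_def using F E_meas by (intro finite_measure_subadditive_finite) auto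
    also have "\<dots> \<le> (\<Sum>A\<in>F. 2 * exp (-2 * \<eta>\<^sup>2 * real n))"
      using hoeff that by (intro sum_mono) auto
    finally show ?thesis by simp
  qed
  have "(\<lambda>n. real (card F) * (2 * exp (-2 * \<eta>\<^sup>2 * real n))) \<longlonglongrightarrow> 0"
  proof -
    have "(\<lambda>n. exp (-2 * \<eta>\<^sup>2) ^ n) \<longlonglongrightarrow> 0" using eta by (intro LIMSEQ_power_zero) simp
    moreover have "exp (-2 * \<eta>\<^sup>2) ^ n = exp (-2 * \<eta>\<^sup>2 * real n)" for n
      by (subst exp_of_nat_mult[symmetric]) (simp only: mult.commute)
    ultimately have "(\<lambda>n. exp (-2 * \<eta>\<^sup>2 * real n)) \<longlonglongrightarrow> 0" by (simp only:)
    from tendsto_mult_left[OF this, of "real (card F) * 2"] show ?thesis by (simp add: mult.assoc)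
  qed
  moreover have "\<forall>\<^sub>F n in sequentially. norm (prob (G n)) \<le>
      real (card F) * (2 * exp (-2 * \<eta>\<^sup>2 * real n))"
    using eventually_gt_at_top[of 0]
  proof eventually_elim
    case (elim n)
    then show ?case using G_bound[of n] by simp
  qed
  ultimately have lim: "(\<lambda>n. prob (G n)) \<longlonglongrightarrow> 0"
    by (rule Lim_null_comparison[rotated])
  have good: "\<bar>real (card {i\<in>{..<n}. Xs i \<omega> \<in> A}) / real n - measure \<mu> A\<bar> \<le> \<epsilon>"
    if \<omega>: "\<omega> \<in> space M - G n" and n: "0 < n" and A: "A \<in> \<C>" "A \<in> sets borel" for n \<omega> A
  proof -
    obtain L U where LU: "L \<in> F" "U \<in> F" "L \<subseteq> A" "A \<subseteq> U" "measure \<mu> (U - L) \<le> \<eta>"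
      using bspec[OF F(3) A(1)] by blast
    have sets: "L \<in> sets \<mu>" "U \<in> sets \<mu>" "A \<in> sets \<mu>" using LU F A mu(2) by auto
    define c where "c S = real (card {i\<in>{..<n}. Xs i \<omega> \<in> S}) / real n" for S
    have c_mono: "c S \<le> c S'" if "S \<subseteq> S'" for S S'
      unfolding c_def using that by (intro divide_right_mono of_nat_mono card_mono) auto
    have c_close: "\<bar>c S - measure \<mu> S\<bar> \<le> \<eta>" if "S \<in> F" for S
    proof -
      have "(\<Sum>i<n. indicator S (Xs i \<omega>)) = real (card {i\<in>{..<n}. Xs i \<omega> \<in> S})"
        by (simp add: indicator_def sum.If_cases Int_def)
      moreover have "\<omega> \<notin> E n S" using \<omega> that by (auto simp: G_def)
      ultimately have "\<bar>real (card {i\<in>{..<n}. Xs i \<omega> \<in> S}) - real n * measure \<mu> S\<bar> < real n * \<eta>"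
        using \<omega> by (simp add: E_def)
      moreover have "real (card {i\<in>{..<n}. Xs i \<omega> \<in> S}) - real n * measure \<mu> S =
          real n * (c S - measure \<mu> S)"
        using n by (simp add: c_def right_diff_distrib)
      ultimately show ?thesis using n by (simp add: abs_mult)
    qed
    have "measure \<mu> U = measure \<mu> L + measure \<mu> (U - L)"
      using sets LU by (subst mu.finite_measure_Diff) auto
    moreover have "measure \<mu> L \<le> measure \<mu> A" "measure \<mu> A \<le> measure \<mu> U"
      using sets LU by (auto intro!: mu.finite_measure_mono)
    ultimately have "\<bar>c A - measure \<mu> A\<bar> \<le> 2 * \<eta>"
      using c_close[OF LU(1)] c_close[OF LU(2)] c_mono[OF LU(3)] c_mono[OF LU(4)] LU(5) by linarith
    then show ?thesis by (simp add: c_def \<eta>_def)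
  qed
  have "G n \<in> sets M" for n using E_meas F(1) by (auto simp: G_def)
  then show ?thesis using lim good by (rule that)
qed

section \<open>Balanced trees\<close>

lemma split_at_snocD: "split_at t (p @ [c]) \<noteq> None \<Longrightarrow> split_at t p \<noteq> None"
  by (induction t p rule: split_at.induct) (auto split: if_splits)

text \<open>Each of the \<open>length p\<close> splits above \<open>p\<close> passes at least the
  fraction \<open>\<gamma>\<close> on. The condition on \<open>butlast p\<close> says that
  \<open>p\<close> is the root or a child of a split node, which covers leaves and inner nodes at
  once.\<close>

lemma node_count_lower_bound:
  assumes balance: "\<And>p c. split_at t p \<noteq> None \<Longrightarrow>
      \<gamma> \<le> real (node_count n xs t (p @ [c])) / real (node_count n xs t p)"
    and "0 \<le> \<gamma>"
    and p: "p = [] \<or> split_at t (butlast p) \<noteq> None"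
  shows "\<gamma> ^ length p * real n \<le> real (node_count n xs t p)"
  using p
proof (induction p rule: rev_induct)
  case (snoc c p)
  then have split: "split_at t p \<noteq> None" by simp
  have "p = [] \<or> split_at t (butlast p) \<noteq> None"
    using split split_at_snocD[of t "butlast p" "last p"] by (cases "p = []") auto
  from snoc.IH[OF this] have IH: "\<gamma> ^ length p * real n \<le> real (node_count n xs t p)" .
  have "\<gamma> ^ length (p @ [c]) * real n = \<gamma> * (\<gamma> ^ length p * real n)" by simp
  also have "\<dots> \<le> \<gamma> * real (node_count n xs t p)"
    using IH \<open>0 \<le> \<gamma>\<close> by (intro mult_left_mono)
  also have "\<dots> \<le> real (node_count n xs t (p @ [c]))"
    using balance[OF split, of c]
    by (cases "node_count n xs t p = 0") (auto simp: field_simps)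
  finally show ?case .
qed simp

lemma leaf_node:
  assumes "p \<in> leaves t"
  shows "p = [] \<or> split_at t (butlast p) \<noteq> None"
proof (cases "p = []")
  case False
  then have "butlast p @ last p # [] \<in> leaves t" using assms by simp
  then show ?thesis using split_at_leaf_prefix by blast
qed simp

text \<open>A level consists of all addresses of its length, whatever the tree. The index set is
  thus not random and expectations pass through the sum; an address that is not a node has an empty
  region and adds nothing to the potential.\<close>

abbreviation nodes_at :: "nat \<Rightarrow> bool list set" where
  "nodes_at d \<equiv> {p. length p = d}"

lemma finite_nodes_at: "finite (nodes_at d)"
  using finite_lists_length_eq[of "UNIV :: bool set" d] by simp

lemma sum_nodes_at_Suc:
  "(\<Sum>p\<in>nodes_at (Suc d). g p) = (\<Sum>p\<in>nodes_at d. g (p @ [True]) + g (p @ [False]))"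
proof -
  have eq: "nodes_at (Suc d) = (\<lambda>p. p @ [True]) ` nodes_at d \<union> (\<lambda>p. p @ [False]) ` nodes_at d"
  proof (intro equalityI subsetI)
    fix p assume "p \<in> nodes_at (Suc d)"
    then show "p \<in> (\<lambda>p. p @ [True]) ` nodes_at d \<union> (\<lambda>p. p @ [False]) ` nodes_at d"
      by (cases p rule: rev_cases) (auto simp: image_iff)
  qed auto
  show ?thesis
    unfolding eq
    by (subst sum.union_disjoint)
      (auto simp: finite_nodes_at sum.reindex inj_on_def sum.distrib)
qed

definition potential :: "(real ^ 'v) measure \<Rightarrow> 'v::finite \<Rightarrow> real \<Rightarrow> 'v rtree \<Rightarrow> bool list \<Rightarrow> real" where
  "potential \<mu> m r t p = measure \<mu> (region t p) * width m t p (- r) r"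

lemma potential_bounds:
  assumes "0 \<le> r"
  shows "0 \<le> potential \<mu> m r t p" "potential \<mu> m r t p \<le> measure \<mu> (region t p) * (2 * r)"
  using width_bounds[of "- r" r m t p] assms
  by (auto simp: potential_def intro!: mult_left_mono)

lemma sum_measure_region_le_1:
  fixes \<mu> :: "(real ^ 'v::finite) measure"
  assumes "prob_space \<mu>" "sets \<mu> = sets borel"
  shows "(\<Sum>p\<in>nodes_at d. measure \<mu> (region t p)) \<le> 1"
proof -
  interpret prob_space \<mu> by fact
  have "disjoint_family_on (region t) (nodes_at d)"
    unfolding disjoint_family_on_def using region_disjoint by fastforce
  then have "(\<Sum>p\<in>nodes_at d. measure \<mu> (region t p)) = measure \<mu> (\<Union>p\<in>nodes_at d. region t p)"
    using finite_nodes_at by (intro finite_measure_finite_Union[symmetric]) (auto simp: assms(2) region_borel)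
  also have "\<dots> \<le> 1" by simp
  finally show ?thesis .
qed

lemma sum_potential_le:
  fixes \<mu> :: "(real ^ 'v::finite) measure"
  assumes "prob_space \<mu>" "sets \<mu> = sets borel" "0 \<le> r"
  shows "(\<Sum>p\<in>nodes_at d. potential \<mu> m r t p) \<le> 2 * r"
proof -
  have "(\<Sum>p\<in>nodes_at d. potential \<mu> m r t p) \<le> (\<Sum>p\<in>nodes_at d. measure \<mu> (region t p) * (2 * r))"
    using potential_bounds[OF assms(3)] by (intro sum_mono)
  also have "\<dots> = (\<Sum>p\<in>nodes_at d. measure \<mu> (region t p)) * (2 * r)"
    by (simp add: sum_distrib_right)
  also have "\<dots> \<le> 1 * (2 * r)"
    using sum_measure_region_le_1[OF assms(1,2)] assms(3) by (intro mult_right_mono) auto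
  finally show ?thesis by simp
qed

text \<open>A split along \<open>m\<close> divides the width, and each part is weighted with at most the fraction
  \<open>1 - \<beta>\<close> of the mass; a split along another coordinate leaves the sum unchanged.\<close>

lemma potential_split:
  fixes \<mu> :: "(real ^ 'v::finite) measure"
  assumes \<mu>: "prob_space \<mu>" "sets \<mu> = sets borel" and "0 \<le> r"
    and bal: "\<And>c. split_at t p \<noteq> None \<Longrightarrow> \<beta> * measure \<mu> (region t p) \<le> measure \<mu> (region t (p @ [c]))"
  shows "potential \<mu> m r t (p @ [True]) + potential \<mu> m r t (p @ [False]) \<le>
    indicator {t. split_at t p \<noteq> None} t * potential \<mu> m r t p *
      (1 - \<beta> * indicator {t. map_option fst (split_at t p) = Some m} t)"
proof (cases "split_at t p")
  case None
  then show ?thesis by (simp add: potential_def region_snoc)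
next
  case (Some ks)
  then obtain k s where ks: "split_at t p = Some (k, s)" by (cases ks) auto
  interpret prob_space \<mu> by fact
  define A where "A c = measure \<mu> (region t (p @ [c]))" for c
  define w where "w c = width m t (p @ [c]) (- r) r" for c
  have "region t p = region t (p @ [True]) \<union> region t (p @ [False])"
    "region t (p @ [True]) \<inter> region t (p @ [False]) = {}"
    by (auto simp: region_snoc ks)
  then have add: "measure \<mu> (region t p) = A True + A False"
    unfolding A_def by (metis finite_measure_Union \<mu>(2) region_borel)
  have w0: "0 \<le> w c" for c using width_bounds[of "- r" r m t "p @ [c]"] \<open>0 \<le> r\<close> by (simp add: w_def)
  show ?thesis
  proof (cases "k = m")
    case True
    have wadd: "w True + w False = width m t p (- r) r"
      unfolding w_def by (rule width_split_add) (use ks True in auto)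
    \<comment> \<open>The lower bound on the mass of the sibling is an upper bound on the mass of
      the child.\<close>
    have le: "A c \<le> (1 - \<beta>) * measure \<mu> (region t p)" for c
      using bal[of "\<not> c"] ks add by (cases c) (auto simp: A_def algebra_simps)
    have "A True * w True + A False * w False \<le>
      (1 - \<beta>) * measure \<mu> (region t p) * w True + (1 - \<beta>) * measure \<mu> (region t p) * w False"
      using le w0 by (intro add_mono mult_right_mono)
    also have "\<dots> = (1 - \<beta>) * measure \<mu> (region t p) * (w True + w False)"
      by (simp add: algebra_simps)
    also have "\<dots> = potential \<mu> m r t p * (1 - \<beta>)"
      by (simp add: wadd potential_def)
    finally show ?thesis using ks True by (simp add: potential_def A_def w_def)
  next
    case False
    have "w c = width m t p (- r) r" for c
      unfolding w_def by (rule width_split_other) (use ks False in auto)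
    then show ?thesis using ks False add
      by (simp add: potential_def A_def w_def algebra_simps)
  qed
qed

text \<open>A leaf at depth at least \<open>d\<close> lies below a node of that depth containing
  \<open>x\<close>, which is at least as wide. A shallower leaf is charged the full side
  \<open>2 * r\<close> of the box.\<close>

lemma width_leaf_le:
  fixes t :: "'v::finite rtree"
  assumes "0 \<le> r"
  shows "width m t (leaf_of t x) (- r) r \<le>
    (\<Sum>p\<in>nodes_at d. indicator (region t p) x * width m t p (- r) r) +
      2 * r * indicator {..<d} (length (leaf_of t x))"
proof (cases "length (leaf_of t x) < d")
  case True
  have "0 \<le> (\<Sum>p\<in>nodes_at d. indicator (region t p) x * width m t p (- r) r)"
    using width_bounds[of "- r" r m t] assms by (intro sum_nonneg mult_nonneg_nonneg) auto
  then show ?thesis using True width_bounds[of "- r" r m t "leaf_of t x"] assms by simp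
next
  case False
  define q where "q = take d (leaf_of t x)"
  have q: "q \<in> nodes_at d" using False by (simp add: q_def)
  have split: "leaf_of t x = q @ drop d (leaf_of t x)" by (simp add: q_def)
  have "x \<in> region t (leaf_of t x)" by (simp add: mem_region_leaf_of_iff)
  then have x: "x \<in> region t q" by (subst (asm) split) (use region_append_subset in blast)
  have "width m t (leaf_of t x) (- r) r \<le> width m t q (- r) r"
    by (subst split) (rule width_append_le, use assms in simp)
  also have "\<dots> = indicator (region t q) x * width m t q (- r) r" using x by simp
  also have "\<dots> \<le> (\<Sum>p\<in>nodes_at d. indicator (region t p) x * width m t p (- r) r)"
    using width_bounds[of "- r" r m t] assms q
    by (intro member_le_sum finite_nodes_at mult_nonneg_nonneg) auto
  finally show ?thesis using assms by (simp add: indicator_def)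
qed

text \<open>The share of the observations is transferred to the mass by the uniform law of large numbers;
  as the nodes at bounded depth contain a fixed fraction of the sample, half of \<open>\<gamma>\<close> survives.\<close>

lemma measure_balance:
  assumes "0 < \<gamma>" "\<gamma> \<le> 1" and n: "0 < n"
    and balance: "\<And>p c. split_at t p \<noteq> None \<Longrightarrow>
      \<gamma> \<le> real (node_count n xs t (p @ [c])) / real (node_count n xs t p)"
    and close: "\<And>p. length p \<le> D \<Longrightarrow>
      \<bar>real (node_count n xs t p) / real n - measure \<mu> (region t p)\<bar> \<le> \<gamma> ^ Suc D / 8"
    and p: "length p < D" "split_at t p \<noteq> None"
  shows "\<gamma> / 2 * measure \<mu> (region t p) \<le> measure \<mu> (region t (p @ [c]))"
proof -
  \<comment> \<open>A split node of depth below \<open>D\<close> has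
    \<open>a p \<ge> \<gamma> ^ D\<close>, so \<open>\<gamma> * a p\<close> is at least
    \<open>8 * e\<close>. Replacing shares by masses costs \<open>3 / 2 * e\<close> in total, which
    the surrendered half of \<open>\<gamma> * a p\<close> covers.\<close>
  define e where "e = \<gamma> ^ Suc D / 8"
  define a where "a q = real (node_count n xs t q) / real n" for q
  have "p = [] \<or> split_at t (butlast p) \<noteq> None"
    using p(2) split_at_snocD[of t "butlast p" "last p"] by (cases "p = []") auto
  with node_count_lower_bound[OF balance] assms(1)
  have "\<gamma> ^ length p * real n \<le> real (node_count n xs t p)" by auto
  then have "\<gamma> ^ length p \<le> a p" using n by (simp add: a_def field_simps)
  moreover have "\<gamma> ^ D \<le> \<gamma> ^ length p" using assms(1,2) p by (intro power_decreasing) auto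
  ultimately have ap: "\<gamma> ^ D \<le> a p" by simp
  have ap0: "0 < a p" using ap assms(1) by (smt (verit) zero_less_power)
  have "\<gamma> \<le> a (p @ [c]) / a p"
    using balance[OF p(2), of c] n by (simp add: a_def)
  then have 1: "\<gamma> * a p \<le> a (p @ [c])" using ap0 by (simp add: field_simps)
  have 2: "\<bar>a p - measure \<mu> (region t p)\<bar> \<le> e" "\<bar>a (p @ [c]) - measure \<mu> (region t (p @ [c]))\<bar> \<le> e"
    using close[of p] close[of "p @ [c]"] p by (auto simp: a_def e_def)
  have 3: "\<gamma> * \<gamma> ^ D \<le> \<gamma> * a p" using ap assms(1) by (intro mult_left_mono) auto
  have e8: "\<gamma> * \<gamma> ^ D = 8 * e" by (simp add: e_def)
  have e0: "0 < e" using assms(1) by (simp add: e_def)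
  have "\<gamma> * measure \<mu> (region t p) \<le> \<gamma> * (a p + e)" using 2 assms(1) by (intro mult_left_mono) auto
  also have "\<dots> \<le> \<gamma> * a p + e" using assms(2) e0 by (simp add: algebra_simps mult_left_le_one_le assms(1) less_imp_le)
  finally have "\<gamma> / 2 * measure \<mu> (region t p) \<le> \<gamma> * a p / 2 + e / 2" by simp
  also have "\<dots> \<le> \<gamma> * a p - e" using 3 e8 e0 by linarith
  also have "\<dots> \<le> measure \<mu> (region t (p @ [c]))" using 1 2 by linarith
  finally show ?thesis .
qed

section \<open>The forest\<close>

text \<open>Collects what the consistency of the estimated distribution function for a single tree
  rests on. The quantile level, strict monotonicity, the moments and the existence of a tree are
  assumed where the forest and its quantiles are studied.\<close>

locale regression_forest = prob_space M
  for M :: "'a measure"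
    and X :: "'a \<Rightarrow> real ^ 'v" and Y :: "'a \<Rightarrow> real"
    and Xs :: "nat \<Rightarrow> 'a \<Rightarrow> real ^ 'v" and Ys :: "nat \<Rightarrow> 'a \<Rightarrow> real"
    and \<Theta> :: "'t measure" and \<theta> :: "nat \<Rightarrow> nat \<Rightarrow> 'a \<Rightarrow> 't"
    and grow :: "nat \<Rightarrow> 't \<Rightarrow> (nat \<Rightarrow> (real ^ 'v) \<times> real) \<Rightarrow> 'v::finite rtree"
    and T :: "nat \<Rightarrow> nat \<Rightarrow> 'a \<Rightarrow> 'v rtree"
    and K :: "real ^ 'v \<Rightarrow> real measure"
    and \<X> :: "(real ^ 'v) set"
    and B :: nat
    and C\<^sub>0 \<gamma> C :: real +
  assumes pair: "X \<in> borel_measurable M" "Y \<in> borel_measurable M"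
    and sample_indep: "indep_vars (\<lambda>_. borel) (\<lambda>i \<omega>. (Xs i \<omega>, Ys i \<omega>)) UNIV"
    and sample_distr: "\<And>i. distr M borel (\<lambda>\<omega>. (Xs i \<omega>, Ys i \<omega>)) = distr M borel (\<lambda>\<omega>. (X \<omega>, Y \<omega>))"
    and pair_indep: "\<And>n. indep_rv M borel (\<lambda>\<omega>. (X \<omega>, Y \<omega>))
          (PiM {..<n} (\<lambda>_. borel) \<Otimes>\<^sub>M PiM {..<B} (\<lambda>_. \<Theta>))
          (\<lambda>\<omega>. (sample Xs Ys n \<omega>, \<lambda>b\<in>{..<B}. \<theta> n b \<omega>))"
    and grow_measurable: "\<And>n. (\<lambda>(u, d). grow n u d)
          \<in> measurable (\<Theta> \<Otimes>\<^sub>M PiM {..<n} (\<lambda>_. borel)) tree_space"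
    and T_eq: "\<And>n b \<omega>. T n b \<omega> = grow n (\<theta> n b \<omega>) (sample Xs Ys n \<omega>)"
    and cond_law: "regular_cond_law M X Y K"
    and support: "\<X> = topological_support (distr M borel X)" "bounded \<X>"
    and max_leaf: "AE \<omega> in M.
          (\<lambda>n. real (Max (leaf_counts n (\<lambda>i. Xs i \<omega>) B (\<lambda>b. T n b \<omega>)))) \<in> o(\<lambda>n. real n)"
    and min_leaf: "AE \<omega> in M.
          (\<forall>\<^sub>F n in sequentially. 0 < Min (leaf_counts n (\<lambda>i. Xs i \<omega>) B (\<lambda>b. T n b \<omega>))) \<and>
          (\<lambda>n. 1 / real (Min (leaf_counts n (\<lambda>i. Xs i \<omega>) B (\<lambda>b. T n b \<omega>)))) \<in> o(\<lambda>n. 1)"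
    and split_prob: "0 < C\<^sub>0"
      "\<And>n b p m. 0 < n \<Longrightarrow> b < B \<Longrightarrow>
         AE \<omega> in M. split_at (T n b \<omega>) p \<noteq> None \<longrightarrow>
           C\<^sub>0 \<le> real_cond_exp M (node_history M (T n b) p)
             (indicator {\<omega> \<in> space M. map_option fst (split_at (T n b \<omega>) p) = Some m}) \<omega>"
    and balance: "0 < \<gamma>" "\<gamma> \<le> 1/2"
      "\<And>n b. 0 < n \<Longrightarrow> b < B \<Longrightarrow>
         AE \<omega> in M. \<forall>p c. split_at (T n b \<omega>) p \<noteq> None \<longrightarrow>
           \<gamma> \<le> real (node_count n (\<lambda>i. Xs i \<omega>) (T n b \<omega>) (p @ [c]))
                / real (node_count n (\<lambda>i. Xs i \<omega>) (T n b \<omega>) p)"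
    and lipschitz: "0 < C"
      "\<And>x x'. x \<in> \<X> \<Longrightarrow> x' \<in> \<X> \<Longrightarrow>
         (SUP y. \<bar>cdf (K x) y - cdf (K x') y\<bar>) \<le> C * l1_norm (x - x')"
    and honesty: "honest \<Theta> grow"
      "\<And>n. indep_rv M (PiM {..<B} (\<lambda>_. \<Theta>)) (\<lambda>\<omega>. \<lambda>b\<in>{..<B}. \<theta> n b \<omega>)
         (PiM {..<n} (\<lambda>_. borel)) (sample Xs Ys n)"
begin

section \<open>Joint law of the test pair, the sample and the randomization\<close>

declare pair [measurable]

definition \<mu> :: "(real ^ 'v) measure" where "\<mu> = distr M borel X"
definition P :: "((real ^ 'v) \<times> real) measure" where "P = distr M borel (\<lambda>\<omega>. (X \<omega>, Y \<omega>))"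
definition \<theta>s :: "nat \<Rightarrow> 'a \<Rightarrow> nat \<Rightarrow> 't" where "\<theta>s n \<omega> = (\<lambda>b\<in>{..<B}. \<theta> n b \<omega>)"

abbreviation data_space :: "nat \<Rightarrow> (nat \<Rightarrow> (real ^ 'v) \<times> real) measure" where
  "data_space n \<equiv> PiM {..<n} (\<lambda>_. borel)"
abbreviation \<Theta>s :: "(nat \<Rightarrow> 't) measure" where
  "\<Theta>s \<equiv> PiM {..<B} (\<lambda>_. \<Theta>)"
abbreviation joint_space ::
  "nat \<Rightarrow> (((real ^ 'v) \<times> real) \<times> (nat \<Rightarrow> (real ^ 'v) \<times> real) \<times> (nat \<Rightarrow> 't)) measure" where
  "joint_space n \<equiv> borel \<Otimes>\<^sub>M (data_space n \<Otimes>\<^sub>M \<Theta>s)"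
abbreviation joint where
  "joint n \<omega> \<equiv> ((X \<omega>, Y \<omega>), (sample Xs Ys n \<omega>, \<theta>s n \<omega>))"

lemma fst_snd_borel [measurable]:
  "fst \<in> borel_measurable (borel :: ((real ^ 'v) \<times> real) measure)"
  "snd \<in> borel_measurable (borel :: ((real ^ 'v) \<times> real) measure)"
  by (simp_all add: borel_prod[symmetric])

lemma rv_XYs [measurable]: "(\<lambda>\<omega>. (Xs i \<omega>, Ys i \<omega>)) \<in> borel_measurable M"
  using sample_indep by (auto simp: indep_vars_def)

lemma rv_Xs [measurable]: "Xs i \<in> borel_measurable M" "Ys i \<in> borel_measurable M"
  using measurable_compose[OF rv_XYs fst_snd_borel(1)] measurable_compose[OF rv_XYs fst_snd_borel(2)]
  by simp_all

lemma rv_joint: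
  "(\<lambda>\<omega>. (sample Xs Ys n \<omega>, \<theta>s n \<omega>)) \<in> measurable M (data_space n \<Otimes>\<^sub>M \<Theta>s)"
  using pair_indep[of n] by (simp add: indep_rv_def \<theta>s_def)

lemma rv_sample [measurable]: "sample Xs Ys n \<in> measurable M (data_space n)"
  using measurable_compose[OF rv_joint measurable_fst] by simp

lemma rv_\<theta>s [measurable]: "\<theta>s n \<in> measurable M \<Theta>s"
  using measurable_compose[OF rv_joint measurable_snd] by simp

lemma rv_\<theta>: "b < B \<Longrightarrow> \<theta> n b \<in> measurable M \<Theta>"
  using measurable_compose[OF rv_\<theta>s measurable_component_singleton[of b "{..<B}"]]
  by (simp add: \<theta>s_def)

lemma rv_T [measurable]: "b < B \<Longrightarrow> T n b \<in> measurable M tree_space"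
proof -
  assume "b < B"
  note [measurable] = rv_\<theta>[OF this, of n] grow_measurable[of n]
  have "(\<lambda>\<omega>. (\<lambda>(u, d). grow n u d) (\<theta> n b \<omega>, sample Xs Ys n \<omega>)) \<in> measurable M tree_space"
    by measurable
  then show ?thesis by (simp add: T_eq[abs_def])
qed

lemma prob_space_\<mu>: "prob_space \<mu>" and sets_\<mu> [measurable_cong]: "sets \<mu> = sets borel"
  by (auto simp: \<mu>_def intro!: prob_space_distr)

lemma prob_space_P: "prob_space P" and sets_P [measurable_cong]: "sets P = sets borel"
  by (auto simp: P_def intro!: prob_space_distr)

lemma distr_Xs: "distr M borel (Xs i) = \<mu>"
proof -
  have "distr M borel (Xs i) = distr (distr M borel (\<lambda>\<omega>. (Xs i \<omega>, Ys i \<omega>))) borel fst"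
    by (subst distr_distr) (auto simp: comp_def)
  also have "\<dots> = \<mu>"
    unfolding sample_distr \<mu>_def by (subst distr_distr) (auto simp: comp_def)
  finally show ?thesis .
qed

lemma indep_Xs: "indep_vars (\<lambda>_. borel) Xs UNIV"
  using indep_vars_compose2[OF sample_indep, of "\<lambda>_. fst" "\<lambda>_. borel"] by simp

lemma AE_X: "AE \<omega> in M. X \<omega> \<in> \<X>"
  using AE_topological_support[OF pair(1)] by (simp add: support(1))

lemma AE_Xs: "AE \<omega> in M. \<forall>i. Xs i \<omega> \<in> \<X>"
proof -
  have "AE \<omega> in M. Xs i \<omega> \<in> \<X>" for i
    using AE_topological_support[OF rv_Xs(1), of i] distr_Xs[of i] by (simp add: support(1) \<mu>_def)
  then show ?thesis by (simp add: AE_all_countable)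
qed

lemma K_kernel: "K \<in> measurable borel (prob_algebra borel)"
  using cond_law by (simp add: regular_cond_law_def)

lemma K_prob: "prob_space (K x)" and K_sets [measurable_cong]: "sets (K x) = sets borel"
  using measurable_space[OF K_kernel, of x] by (simp_all add: space_prob_algebra)

lemma cond_sample: "cond_sample P \<mu> K {..<n}"
proof -
  interpret P: prob_space P by (rule prob_space_P)
  show ?thesis
  proof unfold_locales
    show "K \<in> measurable borel (prob_algebra borel)" by (rule K_kernel)
    show "(\<integral>\<^sup>+z. h z \<partial>P) = (\<integral>\<^sup>+x. \<integral>\<^sup>+y. h (x, y) \<partial>K x \<partial>\<mu>)"
      if h: "h \<in> borel_measurable (borel \<Otimes>\<^sub>M borel)" for h :: "(real ^ 'v) \<times> real \<Rightarrow> ennreal"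
      using nn_integral_regular_cond_law[OF prob_space_axioms pair cond_law h] h
      by (simp add: P_def \<mu>_def nn_integral_distr borel_prod)
    show "sets P = sets (borel \<Otimes>\<^sub>M borel)" unfolding borel_prod by (rule sets_P)
  qed (simp_all add: sets_\<mu>)
qed

lemma distr_sample: "0 < n \<Longrightarrow> distr M (data_space n) (sample Xs Ys n) = PiM {..<n} (\<lambda>_. P)"
proof -
  assume n: "0 < n"
  have "indep_vars (\<lambda>_. borel) (\<lambda>i \<omega>. (Xs i \<omega>, Ys i \<omega>)) {..<n}"
    by (rule indep_vars_subset[OF sample_indep]) simp
  then have "distr M (data_space n) (\<lambda>\<omega>. \<lambda>i\<in>{..<n}. (Xs i \<omega>, Ys i \<omega>)) =
      PiM {..<n} (\<lambda>i. distr M borel (\<lambda>\<omega>. (Xs i \<omega>, Ys i \<omega>)))"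
    using n by (subst (asm) indep_vars_iff_distr_eq_PiM') auto
  then show ?thesis by (simp add: sample_def[abs_def] sample_distr P_def)
qed

lemma distr_joint:
  "distr M (joint_space n) (joint n) = P \<Otimes>\<^sub>M distr M (data_space n \<Otimes>\<^sub>M \<Theta>s) (\<lambda>\<omega>. (sample Xs Ys n \<omega>, \<theta>s n \<omega>))"
  using indep_rv_distr_pair[OF prob_space_axioms pair_indep[of n]] by (simp add: \<theta>s_def P_def)

text \<open>The test pair is independent of sample and randomization together, so Fubini applies in
  both orders. The second order integrates \<open>X\<close> out inside, which turns the indicator of
  a cell into its mass.\<close>

lemma nn_integral_joint:
  assumes h [measurable]: "h \<in> borel_measurable (joint_space n)"
  shows "(\<integral>\<^sup>+\<omega>. h (joint n \<omega>) \<partial>M) =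
      (\<integral>\<^sup>+z. \<integral>\<^sup>+\<omega>. h (z, (sample Xs Ys n \<omega>, \<theta>s n \<omega>)) \<partial>M \<partial>P)" (is ?eq1)
    and "(\<integral>\<^sup>+\<omega>. h (joint n \<omega>) \<partial>M) =
      (\<integral>\<^sup>+\<omega>. \<integral>\<^sup>+z. h (z, (sample Xs Ys n \<omega>, \<theta>s n \<omega>)) \<partial>P \<partial>M)" (is ?eq2)
proof -
  note [measurable] = rv_joint[of n]
  define S where "S = distr M (data_space n \<Otimes>\<^sub>M \<Theta>s) (\<lambda>\<omega>. (sample Xs Ys n \<omega>, \<theta>s n \<omega>))"
  interpret P: prob_space P by (rule prob_space_P)
  interpret S: prob_space S unfolding S_def by (rule prob_space_distr) measurable
  interpret PS: pair_sigma_finite P S ..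
  have "sets (P \<Otimes>\<^sub>M S) = sets (joint_space n)"
    by (intro sets_pair_measure_cong) (simp_all add: sets_P S_def)
  then have h' [measurable]: "h \<in> borel_measurable (P \<Otimes>\<^sub>M S)"
    using h measurable_cong_sets by blast
  have "(\<integral>\<^sup>+\<omega>. h (joint n \<omega>) \<partial>M) = (\<integral>\<^sup>+w. h w \<partial>distr M (joint_space n) (joint n))"
    by (subst nn_integral_distr) auto
  then have 1: "(\<integral>\<^sup>+\<omega>. h (joint n \<omega>) \<partial>M) = (\<integral>\<^sup>+w. h w \<partial>(P \<Otimes>\<^sub>M S))"
    by (simp add: distr_joint S_def)
  show ?eq1
    unfolding 1 S.nn_integral_fst[OF h', symmetric]
    by (intro nn_integral_cong) (subst S_def, subst nn_integral_distr, auto)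
  have m: "(\<lambda>s. \<integral>\<^sup>+z. h (z, s) \<partial>P) \<in> borel_measurable (data_space n \<Otimes>\<^sub>M \<Theta>s)"
    by measurable
  show ?eq2
    unfolding 1 PS.nn_integral_snd[OF h', symmetric]
    by (subst S_def, subst nn_integral_distr) (use m in auto)
qed

lemma nn_integral_sample_\<theta>s:
  assumes n: "0 < n" and h [measurable]: "h \<in> borel_measurable (data_space n \<Otimes>\<^sub>M \<Theta>s)"
  shows "(\<integral>\<^sup>+\<omega>. h (sample Xs Ys n \<omega>, \<theta>s n \<omega>) \<partial>M) =
    (\<integral>\<^sup>+\<omega>. \<integral>\<^sup>+d. h (d, \<theta>s n \<omega>) \<partial>PiM {..<n} (\<lambda>_. P) \<partial>M)"
proof -
  define Q where "Q = distr M \<Theta>s (\<theta>s n)"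
  define N where "N = PiM {..<n} (\<lambda>_. P)"
  have sets_N [measurable_cong]: "sets N = sets (data_space n)"
    unfolding N_def by (intro sets_PiM_cong) (auto simp: sets_P)
  interpret Q: prob_space Q unfolding Q_def by (rule prob_space_distr) measurable
  interpret N: prob_space N unfolding N_def distr_sample[OF n, symmetric]
    by (rule prob_space_distr) measurable
  have law: "distr M (\<Theta>s \<Otimes>\<^sub>M data_space n) (\<lambda>\<omega>. (\<theta>s n \<omega>, sample Xs Ys n \<omega>)) = Q \<Otimes>\<^sub>M N"
    using indep_rv_distr_pair[OF prob_space_axioms honesty(2)[of n]] distr_sample[OF n]
    by (simp add: \<theta>s_def[abs_def] Q_def N_def)
  have "(\<integral>\<^sup>+\<omega>. h (sample Xs Ys n \<omega>, \<theta>s n \<omega>) \<partial>M) =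
      (\<integral>\<^sup>+w. h (snd w, fst w) \<partial>distr M (\<Theta>s \<Otimes>\<^sub>M data_space n) (\<lambda>\<omega>. (\<theta>s n \<omega>, sample Xs Ys n \<omega>)))"
    by (subst nn_integral_distr) auto
  also have "\<dots> = (\<integral>\<^sup>+u. \<integral>\<^sup>+d. h (d, u) \<partial>N \<partial>Q)"
    unfolding law by (subst N.nn_integral_fst[symmetric]) (auto simp: Q_def)
  also have "\<dots> = (\<integral>\<^sup>+\<omega>. \<integral>\<^sup>+d. h (d, \<theta>s n \<omega>) \<partial>N \<partial>M)"
    unfolding Q_def by (subst nn_integral_distr) auto
  finally show ?thesis by (simp add: N_def)
qed

text \<open>Combines the independence of the test pair with that of sample and randomization: test
  pair and randomization are frozen while the sample is integrated over its product law.\<close>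

lemma nn_integral_joint_sample:
  assumes n: "0 < n" and h [measurable]: "h \<in> borel_measurable (joint_space n)"
  shows "(\<integral>\<^sup>+\<omega>. h (joint n \<omega>) \<partial>M) =
    (\<integral>\<^sup>+\<omega>. \<integral>\<^sup>+d. h ((X \<omega>, Y \<omega>), (d, \<theta>s n \<omega>)) \<partial>PiM {..<n} (\<lambda>_. P) \<partial>M)"
proof -
  define N where "N = PiM {..<n} (\<lambda>_. P)"
  have sets_N [measurable_cong]: "sets N = sets (data_space n)"
    unfolding N_def by (intro sets_PiM_cong) (auto simp: sets_P)
  interpret N: prob_space N unfolding N_def distr_sample[OF n, symmetric]
    by (rule prob_space_distr) measurable
  define h' :: "((real ^ 'v) \<times> real) \<times> (nat \<Rightarrow> (real ^ 'v) \<times> real) \<times> (nat \<Rightarrow> 't) \<Rightarrow> ennreal"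
    where "h' w = (\<integral>\<^sup>+d. h (fst w, (d, snd (snd w))) \<partial>N)" for w
  have h' [measurable]: "h' \<in> borel_measurable (joint_space n)"
    unfolding h'_def by measurable
  have "(\<integral>\<^sup>+\<omega>. h (joint n \<omega>) \<partial>M) = (\<integral>\<^sup>+z. \<integral>\<^sup>+\<omega>. h (z, (sample Xs Ys n \<omega>, \<theta>s n \<omega>)) \<partial>M \<partial>P)"
    by (rule nn_integral_joint(1)[OF h])
  also have "\<dots> = (\<integral>\<^sup>+z. \<integral>\<^sup>+\<omega>. h' (z, (sample Xs Ys n \<omega>, \<theta>s n \<omega>)) \<partial>M \<partial>P)"
  proof (rule nn_integral_cong)
    fix z
    have "(\<lambda>s. h (z, s)) \<in> borel_measurable (data_space n \<Otimes>\<^sub>M \<Theta>s)"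
      by measurable
    from nn_integral_sample_\<theta>s[OF n this]
    show "(\<integral>\<^sup>+\<omega>. h (z, (sample Xs Ys n \<omega>, \<theta>s n \<omega>)) \<partial>M) =
        (\<integral>\<^sup>+\<omega>. h' (z, (sample Xs Ys n \<omega>, \<theta>s n \<omega>)) \<partial>M)"
      by (simp add: h'_def N_def)
  qed
  also have "\<dots> = (\<integral>\<^sup>+\<omega>. h' (joint n \<omega>) \<partial>M)"
    by (rule nn_integral_joint(1)[OF h', symmetric])
  finally show ?thesis by (simp add: h'_def N_def)
qed

end

context prob_space begin

lemma prob_tendsto_0_of_AE:
  assumes [measurable]: "\<And>n. A n \<in> sets M" and "AE \<omega> in M. \<forall>\<^sub>F n in sequentially. \<omega> \<notin> A n"
  shows "(\<lambda>n::nat. prob (A n)) \<longlonglongrightarrow> 0"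
proof -
  have "(\<lambda>n. \<integral>\<omega>. indicator (A n) \<omega> \<partial>M) \<longlonglongrightarrow> (\<integral>\<omega>. (0::real) \<partial>M)"
  proof (rule integral_dominated_convergence[where w="\<lambda>_. 1"])
    show "AE \<omega> in M. (\<lambda>n. indicator (A n) \<omega> :: real) \<longlonglongrightarrow> 0"
      using assms(2)
    proof eventually_elim
      case (elim \<omega>)
      then show ?case by (intro tendsto_eventually) (auto elim: eventually_mono)
    qed
  qed (auto simp: indicator_def)
  then show ?thesis by simp
qed

end

context regression_forest begin

section \<open>Leaves shrink\<close>

text \<open>Half the side of a centered box containing the support; the cells are clipped to this
  box. It is a choice because only boundedness is assumed.\<close>

definition r :: real where "r = (SOME r. 0 < r \<and> (\<forall>x\<in>\<X>. \<forall>m. \<bar>x $ m\<bar> \<le> r))"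

lemma r: "0 < r" "x \<in> \<X> \<Longrightarrow> \<bar>x $ m\<bar> \<le> r"
proof -
  obtain a where a: "0 < a" "\<And>x. x \<in> \<X> \<Longrightarrow> norm x \<le> a"
    using support(2) by (auto simp: bounded_pos)
  have "\<exists>r. 0 < r \<and> (\<forall>x\<in>\<X>. \<forall>m. \<bar>x $ m\<bar> \<le> r)"
    using a component_le_norm_cart order_trans by (intro exI[of _ a]) blast
  from someI_ex[OF this] have "0 < r \<and> (\<forall>x\<in>\<X>. \<forall>m. \<bar>x $ m\<bar> \<le> r)" by (simp add: r_def)
  then show "0 < r" "x \<in> \<X> \<Longrightarrow> \<bar>x $ m\<bar> \<le> r" by auto
qed

abbreviation count :: "nat \<Rightarrow> nat \<Rightarrow> 'a \<Rightarrow> bool list \<Rightarrow> nat" where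
  "count n b \<omega> p \<equiv> node_count n (\<lambda>i. Xs i \<omega>) (T n b \<omega>) p"

abbreviation leaf :: "nat \<Rightarrow> nat \<Rightarrow> 'a \<Rightarrow> bool list" where
  "leaf n b \<omega> \<equiv> leaf_of (T n b \<omega>) (X \<omega>)"

lemma AE_balance:
  "AE \<omega> in M. \<forall>n b. 0 < n \<longrightarrow> b < B \<longrightarrow> (\<forall>p c. split_at (T n b \<omega>) p \<noteq> None \<longrightarrow>
     \<gamma> \<le> real (count n b \<omega> (p @ [c])) / real (count n b \<omega> p))"
proof -
  have "AE \<omega> in M. 0 < n \<longrightarrow> b < B \<longrightarrow> (\<forall>p c. split_at (T n b \<omega>) p \<noteq> None \<longrightarrow>
     \<gamma> \<le> real (count n b \<omega> (p @ [c])) / real (count n b \<omega> p))" for n b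
  proof (cases "0 < n \<and> b < B")
    case True
    then show ?thesis using balance(3)[of n b] by simp
  qed auto
  then show ?thesis unfolding AE_all_countable by (intro allI)
qed

lemma AE_leaf_count:
  "AE \<omega> in M. \<forall>n b. 0 < n \<longrightarrow> b < B \<longrightarrow> \<gamma> ^ length (leaf n b \<omega>) * real n \<le> real (count n b \<omega> (leaf n b \<omega>))"
  using AE_balance
proof eventually_elim
  case (elim \<omega>)
  show ?case
  proof (intro allI impI)
    fix n b :: nat assume nb: "0 < n" "b < B"
    show "\<gamma> ^ length (leaf n b \<omega>) * real n \<le> real (count n b \<omega> (leaf n b \<omega>))"
    proof (rule node_count_lower_bound)
      show "\<gamma> \<le> real (count n b \<omega> (p @ [c])) / real (count n b \<omega> p)"
        if "split_at (T n b \<omega>) p \<noteq> None" for p c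
        using elim nb that by blast
    qed (use balance(1) leaf_node[OF leaf_of_in_leaves, of "T n b \<omega>" "X \<omega>"] in auto)
  qed
qed

lemma leaf_counts_finite: "finite (leaf_counts n xs B ts)"
proof -
  have "leaf_counts n xs B ts = (\<Union>b\<in>{..<B}. node_count n xs (ts b) ` leaves (ts b))"
    by (auto simp: leaf_counts_def)
  then show ?thesis by (simp add: finite_leaves)
qed

lemma leaf_counts_bounds:
  assumes "b < B"
  shows "Min (leaf_counts n xs B ts) \<le> node_count n xs (ts b) (leaf_of (ts b) x)"
    "node_count n xs (ts b) (leaf_of (ts b) x) \<le> Max (leaf_counts n xs B ts)"
proof -
  have "node_count n xs (ts b) (leaf_of (ts b) x) \<in> leaf_counts n xs B ts"
    using assms leaf_of_in_leaves by (auto simp: leaf_counts_def)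
  then show "Min (leaf_counts n xs B ts) \<le> node_count n xs (ts b) (leaf_of (ts b) x)"
    "node_count n xs (ts b) (leaf_of (ts b) x) \<le> Max (leaf_counts n xs B ts)"
    using leaf_counts_finite by (auto intro: Min_le Max_ge)
qed

lemma rv_leaf [measurable]: "b < B \<Longrightarrow> leaf n b \<in> measurable M (count_space UNIV)"
proof -
  assume "b < B"
  note [measurable] = rv_T[OF this, of n] measurable_leaf_of
  have "(\<lambda>\<omega>. (\<lambda>(t, x). leaf_of t x) (T n b \<omega>, X \<omega>)) \<in> measurable M (count_space UNIV)"
    by measurable
  then show ?thesis by simp
qed

text \<open>A leaf of depth below \<open>D\<close> holds at least \<open>\<gamma> ^ D * n\<close>
  observations, which contradicts the bound \<open>o(n)\<close> on leaf sizes once \<open>n\<close>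
  is large. How large depends on the outcome, so the result is a limit of probabilities.\<close>

lemma prob_short_leaf:
  assumes b: "b < B"
  shows "(\<lambda>n. prob {\<omega> \<in> space M. length (leaf n b \<omega>) < D}) \<longlonglongrightarrow> 0"
proof (rule prob_tendsto_0_of_AE)
  note [measurable] = rv_leaf[OF b]
  show "{\<omega> \<in> space M. length (leaf n b \<omega>) < D} \<in> sets M" for n by measurable
  show "AE \<omega> in M. \<forall>\<^sub>F n in sequentially. \<omega> \<notin> {\<omega> \<in> space M. length (leaf n b \<omega>) < D}"
    using max_leaf AE_leaf_count
  proof eventually_elim
    case (elim \<omega>)
    note count_ge = elim(2)
    have "0 < \<gamma> ^ D / 2" using balance(1) by simp
    from landau_o.smallD[OF elim(1) this] eventually_gt_at_top[of 0] show ?case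
    proof eventually_elim
      case (elim n)
      show ?case
      proof
        assume "\<omega> \<in> {\<omega> \<in> space M. length (leaf n b \<omega>) < D}"
        then have "\<gamma> ^ D * real n \<le> \<gamma> ^ length (leaf n b \<omega>) * real n"
          using balance by (intro mult_right_mono power_decreasing) auto
        also have "\<dots> \<le> real (count n b \<omega> (leaf n b \<omega>))"
          using count_ge elim(2) b by blast
        also have "\<dots> \<le> \<gamma> ^ D / 2 * real n"
          using leaf_counts_bounds(2)[OF b, of n "\<lambda>i. Xs i \<omega>" "\<lambda>b. T n b \<omega>" "X \<omega>"] elim(1) by simp
        also have "\<dots> < \<gamma> ^ D * real n" using elim(2) balance(1) by simp
        finally show False by simp
      qed
    qed
  qed
qed

section \<open>Node histories and the choice of the split variable\<close>

lemma measurable_from_node_history: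
  "T n b \<in> measurable (node_history M (T n b) p) (tree_sigma {q. strict_prefix q p})"
proof (rule measurable_tree_sigmaI)
  fix q m c assume "q \<in> {q. strict_prefix q p}"
  then have "{\<omega> \<in> space M. \<exists>s\<le>c. split_at (T n b \<omega>) q = Some (m, s)} \<in>
      insert {\<omega> \<in> space M. split_at (T n b \<omega>) p \<noteq> None}
       {{\<omega> \<in> space M. \<exists>s\<le>c. split_at (T n b \<omega>) q = Some (m, s)} |q m c. strict_prefix q p}"
    by blast
  then show "{\<omega> \<in> space (node_history M (T n b) p). \<exists>s\<le>c. split_at (T n b \<omega>) q = Some (m, s)}
      \<in> sets (node_history M (T n b) p)"
    unfolding node_history_def space_measure_of_conv
    by (subst sets_measure_of) (auto simp del: insert_iff intro!: sigma_sets.Basic)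
qed

lemma split_event_node_history:
  "{\<omega> \<in> space M. split_at (T n b \<omega>) p \<noteq> None} \<in> sets (node_history M (T n b) p)"
  unfolding node_history_def by (subst sets_measure_of) (auto intro!: sigma_sets.Basic)

lemma space_node_history: "space (node_history M (T n b) p) = space M"
  by (simp add: node_history_def space_measure_of_conv)

lemma subalgebra_node_history:
  assumes b: "b < B"
  shows "subalgebra M (node_history M (T n b) p)"
proof -
  have T: "T n b \<in> measurable M (tree_sigma UNIV)" using rv_T[OF b] by (simp add: tree_space_eq)
  have "{\<omega> \<in> space M. split_at (T n b \<omega>) p \<noteq> None} \<in> sets M"
    using measurable_compose[OF T pred_split_at_None[of p UNIV, OF UNIV_I]]
    by (simp add: pred_def sets.sets_Collect_neg del: not_None_eq)
  moreover have "{\<omega> \<in> space M. \<exists>s\<le>c. split_at (T n b \<omega>) q = Some (m, s)} \<in> sets M" for q m c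
    using measurable_sets[OF T sets_tree_sigma_gen[of q UNIV c m]]
    by (auto simp: vimage_def Int_def conj_commute)
  ultimately have "sets (node_history M (T n b) p) \<subseteq> sets M"
    unfolding node_history_def by (subst sets_measure_of) (auto intro!: sets.sigma_sets_subset)
  then show ?thesis by (simp add: subalgebra_def space_node_history)
qed

text \<open>The bound on the selection probability holds only where the node is split. The indicator
  restricts to that event, and the event belongs to the history.\<close>

abbreviation split_mass :: "nat \<Rightarrow> nat \<Rightarrow> 'v \<Rightarrow> bool list \<Rightarrow> 'a \<Rightarrow> real" where
  "split_mass n b m p \<omega> \<equiv> indicator {t. split_at t p \<noteq> None} (T n b \<omega>) * potential \<mu> m r (T n b \<omega>) p"

lemma potential_le_2r: "0 \<le> potential \<mu> m r t p" "potential \<mu> m r t p \<le> 2 * r"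
proof -
  interpret mu: prob_space \<mu> by (rule prob_space_\<mu>)
  show "0 \<le> potential \<mu> m r t p" using potential_bounds[of r \<mu> m t p] r(1) by simp
  have "potential \<mu> m r t p \<le> measure \<mu> (region t p) * (2 * r)"
    using potential_bounds[of r \<mu> m t p] r(1) by simp
  also have "\<dots> \<le> 1 * (2 * r)" using r(1) by (intro mult_right_mono) auto
  finally show "potential \<mu> m r t p \<le> 2 * r" by simp
qed

text \<open>Region and width of \<open>p\<close> look at proper ancestors only, and the event that
  \<open>p\<close> is split is adjoined to its history by definition.\<close>

lemma measurable_split_mass_history:
  "split_mass n b m p \<in> borel_measurable (node_history M (T n b) p)"
proof -
  let ?S = "{q. strict_prefix q p}"
  note [measurable] = measurable_from_node_history[of n b p]
    measurable_width[of p ?S m "- r" r] measurable_measure_region[of p ?S \<mu>, OF _ prob_space_\<mu> sets_\<mu>]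
  have "(\<lambda>\<omega>. potential \<mu> m r (T n b \<omega>) p) \<in> borel_measurable (node_history M (T n b) p)"
    unfolding potential_def by measurable
  moreover have "(\<lambda>\<omega>. indicator {t. split_at t p \<noteq> None} (T n b \<omega>) :: real)
      \<in> borel_measurable (node_history M (T n b) p)"
  proof -
    have "(indicator {\<omega> \<in> space M. split_at (T n b \<omega>) p \<noteq> None} :: 'a \<Rightarrow> real)
        \<in> borel_measurable (node_history M (T n b) p)"
      by (intro borel_measurable_indicator split_event_node_history)
    moreover have "(indicator {\<omega> \<in> space M. split_at (T n b \<omega>) p \<noteq> None} :: 'a \<Rightarrow> real) \<omega> =
        indicator {t. split_at t p \<noteq> None} (T n b \<omega>)"
      if "\<omega> \<in> space (node_history M (T n b) p)" for \<omega>
      using that by (auto simp: space_node_history indicator_def)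
    ultimately show ?thesis by (simp cong: measurable_cong)
  qed
  ultimately show ?thesis by measurable
qed

lemma rv_var:
  assumes b: "b < B"
  shows "(\<lambda>\<omega>. indicator {t. map_option fst (split_at t p) = Some m} (T n b \<omega>) :: real) \<in>
      borel_measurable M"
proof -
  note [measurable] = rv_T[OF b, of n, unfolded tree_space_eq] sets_tree_sigma_var[OF UNIV_I, of p m]
  show ?thesis by measurable
qed

lemma rv_potential [measurable]:
  assumes b: "b < B"
  shows "(\<lambda>\<omega>. potential \<mu> m r (T n b \<omega>) p) \<in> borel_measurable M"
proof -
  note [measurable] = rv_T[OF b, of n, unfolded tree_space_eq]
    measurable_width[of p UNIV m "- r" r] measurable_measure_region[of p UNIV \<mu>, OF _ prob_space_\<mu> sets_\<mu>]
  show ?thesis unfolding potential_def by measurable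
qed

lemma expectation_split_along:
  assumes n: "0 < n" and b: "b < B"
  shows "C\<^sub>0 * expectation (split_mass n b m p) \<le>
    expectation (\<lambda>\<omega>. split_mass n b m p \<omega> * indicator {t. map_option fst (split_at t p) =
        Some m} (T n b \<omega>))"
proof -
  let ?F = "node_history M (T n b) p"
  let ?A = "{\<omega> \<in> space M. map_option fst (split_at (T n b \<omega>) p) = Some m}"
  interpret F: finite_measure_subalgebra M ?F
    by unfold_locales (rule subalgebra_node_history[OF b])
  define h where "h = split_mass n b m p"
  have meas: "h \<in> borel_measurable ?F" unfolding h_def by (rule measurable_split_mass_history)
  note [measurable] = measurable_from_subalg[OF subalgebra_node_history[OF b] meas] rv_var[OF b, where p=p and m=m and n=n]
  have A: "(indicator ?A :: 'a \<Rightarrow> real) \<omega> = indicator {t. map_option fst (split_at t p) =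
      Some m} (T n b \<omega>)"
    if "\<omega> \<in> space M" for \<omega> using that by (auto simp: indicator_def)
  have gm: "(indicator ?A :: 'a \<Rightarrow> real) \<in> borel_measurable M"
    using rv_var[OF b, where p=p and m=m and n=n] A by (simp cong: measurable_cong)
  define gA where "gA = (indicator ?A :: 'a \<Rightarrow> real)"
  have [measurable]: "gA \<in> borel_measurable M" unfolding gA_def by (rule gm)
  have gA: "\<bar>gA \<omega>\<bar> \<le> 1" for \<omega> by (simp add: gA_def indicator_def)
  have bnd: "\<bar>h \<omega>\<bar> \<le> 2 * r" for \<omega>
    using potential_le_2r[of m "T n b \<omega>" p] r(1) by (auto simp: h_def indicator_def)
  have int: "integrable M h"
    using bnd by (intro integrable_const_bound[where B="2 * r"]) auto
  have int2: "integrable M (\<lambda>\<omega>. h \<omega> * gA \<omega>)"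
    using mult_mono[OF bnd gA] r(1)
    by (intro integrable_const_bound[where B="2 * r"]) (auto simp: abs_mult)
  have "C\<^sub>0 * expectation (h) = expectation (\<lambda>\<omega>. h \<omega> * C\<^sub>0)"
    by (simp add: mult.commute)
  also have "\<dots> \<le> expectation (\<lambda>\<omega>. h \<omega> * real_cond_exp M ?F gA \<omega>)"
  proof (rule integral_mono_AE)
    show "integrable M (\<lambda>\<omega>. h \<omega> * real_cond_exp M ?F gA \<omega>)"
      by (rule F.real_cond_exp_intg(1)[OF int2 meas]) measurable
    show "AE \<omega> in M. h \<omega> * C\<^sub>0 \<le>
        h \<omega> * real_cond_exp M ?F gA \<omega>"
      using split_prob(2)[OF n b, of p m, folded gA_def]
    proof eventually_elim
      case (elim \<omega>)
      then show ?case using potential_le_2r(1)[of m "T n b \<omega>" p] unfolding h_def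
        by (cases "split_at (T n b \<omega>) p = None") (auto intro!: mult_left_mono)
    qed
  qed (use int in auto)
  also have "\<dots> = expectation (\<lambda>\<omega>. h \<omega> * gA \<omega>)"
    by (rule F.real_cond_exp_intg(2)[OF int2 meas]) measurable
  also have "\<dots> = expectation (\<lambda>\<omega>. h \<omega> *
      indicator {t. map_option fst (split_at t p) = Some m} (T n b \<omega>))"
    using A unfolding gA_def by (intro Bochner_Integration.integral_cong) auto
  finally show ?thesis by (simp add: h_def)
qed

section \<open>Decay of the expected potential with the depth\<close>

definition level_potential :: "nat \<Rightarrow> nat \<Rightarrow> 'v \<Rightarrow> nat \<Rightarrow> real" where
  "level_potential n b m d = expectation (\<lambda>\<omega>. \<Sum>p\<in>nodes_at d. potential \<mu> m r (T n b \<omega>) p)"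

text \<open>Given its history, a split node is cut along \<open>m\<close> with probability at least
  \<open>C\<^sub>0\<close>, and it then loses at least the fraction \<open>\<gamma> / 2\<close> of
  its potential. Of \<open>C\<^sub>0\<close> only positivity is known, so the minimum is needed to
  keep \<open>\<rho>\<close> nonnegative.\<close>

definition \<rho> :: real where "\<rho> = 1 - \<gamma> / 2 * min C\<^sub>0 1"

lemma \<rho>: "0 \<le> \<rho>" "\<rho> < 1"
proof -
  have "\<gamma> / 2 * min C\<^sub>0 1 \<le> 1 * 1" using balance split_prob(1) by (intro mult_mono) auto
  then show "0 \<le> \<rho>" by (simp add: \<rho>_def)
  show "\<rho> < 1" using balance split_prob(1) by (simp add: \<rho>_def)
qed

text \<open>Outside \<open>G\<close> the masses are balanced and \<open>potential_split\<close>
  applies node by node. On \<open>G\<close> nothing is known about balance, and the whole level is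
  bounded by \<open>2 * r\<close>.\<close>

lemma level_potential_step:
  assumes n: "0 < n" and b: "b < B" and d: "d < D" and G [measurable]: "G \<in> sets M"
    and close: "\<And>\<omega> p. \<omega> \<in> space M - G \<Longrightarrow> length p \<le> D \<Longrightarrow>
      \<bar>real (count n b \<omega> p) / real n - measure \<mu> (region (T n b \<omega>) p)\<bar> \<le> \<gamma> ^ Suc D / 8"
  shows "level_potential n b m (Suc d) \<le> \<rho> * level_potential n b m d + 2 * r * prob G"
proof -
  define V where "V p \<omega> = (indicator {t. map_option fst (split_at t p) =
      Some m} (T n b \<omega>) :: real)" for p \<omega>
  define h where "h p = split_mass n b m p" for p
  have [measurable]: "V p \<in> borel_measurable M" for p
    unfolding V_def by (rule rv_var[OF b])
  have [measurable]: "h p \<in> borel_measurable M" for p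
    unfolding h_def by (rule measurable_from_subalg[OF subalgebra_node_history[OF b] measurable_split_mass_history])
  note [measurable] = rv_potential[OF b]
  have h: "0 \<le> h p \<omega>" "h p \<omega> \<le> potential \<mu> m r (T n b \<omega>) p" "h p \<omega> \<le> 2 * r" for p \<omega>
    using potential_le_2r[of m "T n b \<omega>" p] r(1) by (auto simp: h_def indicator_def)
  have int_h: "integrable M (h p)" for p
    using h by (intro integrable_const_bound[where B="2 * r"]) auto
  have int_hV: "integrable M (\<lambda>\<omega>. h p \<omega> * V p \<omega>)" for p
  proof (rule integrable_const_bound[where B="2 * r"])
    have "norm (h p \<omega> * V p \<omega>) \<le> 2 * r" for \<omega>
      using h[of p \<omega>] r(1) by (auto simp: V_def indicator_def)
    then show "AE \<omega> in M. norm (h p \<omega> * V p \<omega>) \<le> 2 * r" by simp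
  qed measurable
  have int_pot: "integrable M (\<lambda>\<omega>. potential \<mu> m r (T n b \<omega>) p)" for p
    using potential_le_2r by (intro integrable_const_bound[where B="2 * r"]) auto
  have lin: "expectation (\<lambda>\<omega>. (\<Sum>p\<in>nodes_at d. h p \<omega> - c * (h p \<omega> * V p \<omega>)) + 2 * r * indicator G \<omega>) =
      (\<Sum>p\<in>nodes_at d. expectation (h p) - c * expectation (\<lambda>\<omega>. h p \<omega> * V p \<omega>)) + 2 * r * prob G" for c
    using int_h int_hV by (simp add: emeasure_eq_measure)
  have "level_potential n b m (Suc d) \<le>
    expectation (\<lambda>\<omega>. (\<Sum>p\<in>nodes_at d. h p \<omega> - \<gamma> / 2 * (h p \<omega> * V p \<omega>)) + 2 * r * indicator G \<omega>)"
    unfolding level_potential_def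
  proof (rule integral_mono_AE)
    show "AE \<omega> in M. (\<Sum>p\<in>nodes_at (Suc d). potential \<mu> m r (T n b \<omega>) p) \<le>
      (\<Sum>p\<in>nodes_at d. h p \<omega> - \<gamma> / 2 * (h p \<omega> * V p \<omega>)) + 2 * r * indicator G \<omega>"
      using AE_balance AE_space
    proof eventually_elim
      case (elim \<omega>)
      have bal: "\<gamma> \<le> real (count n b \<omega> (p @ [c])) / real (count n b \<omega> p)"
        if "split_at (T n b \<omega>) p \<noteq> None" for p c
        using elim(1) n b that by blast
      show ?case
      proof (cases "\<omega> \<in> G")
        case True
        have "0 \<le> h p \<omega> - \<gamma> / 2 * (h p \<omega> * V p \<omega>)" for p
        proof -
          have "\<gamma> / 2 * V p \<omega> \<le> 1" using balance by (auto simp: V_def indicator_def)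
          then have "h p \<omega> * (\<gamma> / 2 * V p \<omega>) \<le> h p \<omega>" using h by (intro mult_left_le) auto
          then show ?thesis by (simp add: mult_ac)
        qed
        then have "0 \<le> (\<Sum>p\<in>nodes_at d. h p \<omega> - \<gamma> / 2 * (h p \<omega> * V p \<omega>))" by (intro sum_nonneg)
        then show ?thesis
          using True sum_potential_le[OF prob_space_\<mu> sets_\<mu>, of r m "T n b \<omega>" "Suc d"] r(1) by simp
      next
        case False
        have "potential \<mu> m r (T n b \<omega>) (p @ [True]) + potential \<mu> m r (T n b \<omega>) (p @ [False]) \<le>
            h p \<omega> - \<gamma> / 2 * (h p \<omega> * V p \<omega>)" if p: "p \<in> nodes_at d" for p
        proof -
          have "\<gamma> / 2 * measure \<mu> (region (T n b \<omega>) p) \<le> measure \<mu> (region (T n b \<omega>) (p @ [c]))"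
            if "split_at (T n b \<omega>) p \<noteq> None" for c
            using balance(1,2) n bal close[of \<omega>] p d that False elim(2)
            by (intro measure_balance[where n=n and D=D and xs="\<lambda>i. Xs i \<omega>"]) auto
          from potential_split[OF prob_space_\<mu> sets_\<mu>, of r "T n b \<omega>" p "\<gamma> / 2" m, OF _ this] r(1)
          show ?thesis by (simp add: h_def V_def algebra_simps)
        qed
        then have "(\<Sum>p\<in>nodes_at d. potential \<mu> m r (T n b \<omega>) (p @ [True]) + potential \<mu> m r (T n b \<omega>) (p @ [False])) \<le>
            (\<Sum>p\<in>nodes_at d. h p \<omega> - \<gamma> / 2 * (h p \<omega> * V p \<omega>))"
          by (intro sum_mono)
        then show ?thesis using False by (simp add: sum_nodes_at_Suc)
      qed
    qed
    show "integrable M (\<lambda>\<omega>. (\<Sum>p\<in>nodes_at d. h p \<omega> - \<gamma> / 2 * (h p \<omega> * V p \<omega>)) + 2 * r * indicator G \<omega>)"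
      by (intro Bochner_Integration.integrable_add Bochner_Integration.integrable_sum
          Bochner_Integration.integrable_diff integrable_mult_right int_h int_hV)
        (simp add: emeasure_eq_measure)
  qed (use int_pot in auto)
  also have "\<dots> = (\<Sum>p\<in>nodes_at d. expectation (h p) - \<gamma> / 2 * expectation (\<lambda>\<omega>. h p \<omega> * V p \<omega>)) + 2 * r * prob G"
    by (rule lin)
  also have "\<dots> \<le> (\<Sum>p\<in>nodes_at d. \<rho> * expectation (\<lambda>\<omega>. potential \<mu> m r (T n b \<omega>) p)) + 2 * r * prob G"
  proof (intro add_right_mono sum_mono)
    fix p
    have Eh: "0 \<le> expectation (h p)" using h(1) by (intro integral_nonneg_AE) auto
    have "min C\<^sub>0 1 * expectation (h p) \<le> C\<^sub>0 * expectation (h p)" using Eh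
      by (intro mult_right_mono) auto
    also have "\<dots> \<le> expectation (\<lambda>\<omega>. h p \<omega> * V p \<omega>)"
      using expectation_split_along[OF n b, where m=m and p=p] by (simp add: h_def V_def)
    finally have "\<gamma> / 2 * (min C\<^sub>0 1 * expectation (h p)) \<le> \<gamma> / 2 * expectation (\<lambda>\<omega>. h p \<omega> * V p \<omega>)"
      using balance(1) by (intro mult_left_mono) auto
    \<comment> \<open>What an unsplit node carried is lost altogether, so the estimate is by
      \<open>h p\<close> first and by the full potential only afterwards.\<close>
    then have "expectation (h p) - \<gamma> / 2 * expectation (\<lambda>\<omega>. h p \<omega> * V p \<omega>) \<le> \<rho> * expectation (h p)"
      by (simp add: \<rho>_def algebra_simps)
    also have "\<dots> \<le> \<rho> * expectation (\<lambda>\<omega>. potential \<mu> m r (T n b \<omega>) p)"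
      using h \<rho>(1) int_h int_pot by (intro mult_left_mono integral_mono) auto
    finally show "expectation (h p) - \<gamma> / 2 * expectation (\<lambda>\<omega>. h p \<omega> * V p \<omega>) \<le>
      \<rho> * expectation (\<lambda>\<omega>. potential \<mu> m r (T n b \<omega>) p)" .
  qed
  also have "\<dots> = \<rho> * level_potential n b m d + 2 * r * prob G"
    using int_pot by (simp add: level_potential_def sum_distrib_left)
  finally show ?thesis .
qed

text \<open>The error terms of the levels are summed without discount, bounding
  \<open>\<rho>\<close> by 1; since \<open>D\<close> stays fixed as \<open>n\<close> grows, this
  costs nothing in the limit.\<close>

lemma level_potential_le:
  assumes n: "0 < n" and b: "b < B" and G: "G \<in> sets M"
    and close: "\<And>\<omega> p. \<omega> \<in> space M - G \<Longrightarrow> length p \<le> D \<Longrightarrow>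
      \<bar>real (count n b \<omega> p) / real n - measure \<mu> (region (T n b \<omega>) p)\<bar> \<le> \<gamma> ^ Suc D / 8"
    and d: "d \<le> D"
  shows "level_potential n b m d \<le> \<rho> ^ d * (2 * r) + real d * (2 * r * prob G)"
  using d
proof (induction d)
  case 0
  have "level_potential n b m 0 \<le> expectation (\<lambda>_. 2 * r)"
    unfolding level_potential_def
    using rv_potential[OF b] potential_le_2r
    by (intro integral_mono) (auto intro!: integrable_const_bound[where B="2 * r"])
  then show ?case by (simp add: prob_space)
next
  case (Suc d)
  have "level_potential n b m (Suc d) \<le> \<rho> * level_potential n b m d + 2 * r * prob G"
    using Suc.prems by (intro level_potential_step[OF n b _ G close]) auto
  also have "\<dots> \<le> \<rho> * (\<rho> ^ d * (2 * r) + real d * (2 * r * prob G)) + 2 * r * prob G"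
    using Suc \<rho>(1) by (intro add_right_mono mult_left_mono) auto
  also have "\<dots> \<le> \<rho> ^ Suc d * (2 * r) + 1 * (real d * (2 * r * prob G)) + 2 * r * prob G"
  proof -
    have "\<rho> * (real d * (2 * r * prob G)) \<le> 1 * (real d * (2 * r * prob G))"
      using \<rho> r(1) by (intro mult_right_mono) auto
    then show ?thesis by (simp add: algebra_simps)
  qed
  finally show ?case by (simp add: algebra_simps)
qed

lemma tree_of_joint: "b < B \<Longrightarrow> T n b \<omega> = grow n (\<theta>s n \<omega> b) (sample Xs Ys n \<omega>)"
  by (simp add: T_eq \<theta>s_def)

lemma measurable_tree [measurable]:
  assumes b: "b < B"
  shows "(\<lambda>s. grow n (snd s b) (fst s)) \<in> measurable (data_space n \<Otimes>\<^sub>M \<Theta>s) tree_space"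
proof -
  note [measurable] = grow_measurable[of n]
  have [measurable]: "(\<lambda>u. u b) \<in> measurable \<Theta>s \<Theta>"
    using b by (intro measurable_component_singleton) simp
  have "(\<lambda>s. (\<lambda>(u, d). grow n u d) (snd s b, fst s)) \<in> measurable (data_space n \<Otimes>\<^sub>M \<Theta>s) tree_space"
    by measurable
  then show ?thesis by simp
qed

lemma nn_integral_P_fst:
  assumes [measurable]: "g \<in> borel_measurable borel"
  shows "(\<integral>\<^sup>+z. g (fst z) \<partial>P) = (\<integral>\<^sup>+x. g x \<partial>\<mu>)"
  unfolding P_def \<mu>_def by (subst (1 2) nn_integral_distr) auto

text \<open>\<open>X\<close> is independent of the tree. Integrating it out first replaces each
  indicator by the mass of the cell, which produces the potential.\<close>

lemma nn_integral_width_level: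
  assumes b: "b < B"
  shows "(\<integral>\<^sup>+\<omega>. ennreal (\<Sum>p\<in>nodes_at d. indicator (region (T n b \<omega>) p) (X \<omega>) * width m (T n b \<omega>) p (- r) r) \<partial>M) =
    ennreal (level_potential n b m d)"
proof -
  interpret mu: prob_space \<mu> by (rule prob_space_\<mu>)
  define tr where "tr = (\<lambda>s. grow n (snd s b) (fst s))"
  have [measurable]: "tr \<in> measurable (data_space n \<Otimes>\<^sub>M \<Theta>s) (tree_sigma UNIV)"
    using measurable_tree[OF b, of n] by (simp add: tr_def tree_space_eq)
  have T: "T n b \<omega> = tr (sample Xs Ys n \<omega>, \<theta>s n \<omega>)" for \<omega>
    by (simp add: tr_def tree_of_joint[OF b])
  note [measurable] = pred_region[of _ UNIV] measurable_width[of _ UNIV m "- r" r]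
  have w: "0 \<le> width m t p (- r) r" for t :: "'v rtree" and p
    using width_bounds[of "- r" r m t p] r(1) by simp
  define h where "h = (\<lambda>z :: ((real ^ 'v) \<times> real) \<times> (nat \<Rightarrow> (real ^ 'v) \<times> real) \<times> (nat \<Rightarrow> 't).
      \<Sum>p\<in>nodes_at d. ennreal (width m (tr (snd z)) p (- r) r) *
        indicator {x. x \<in> region (tr (snd z)) p} (fst (fst z)))"
  have [measurable]: "Measurable.pred (joint_space n) (\<lambda>z. fst (fst z) \<in> region (tr (snd z)) p)" for p
  proof -
    have "(\<lambda>z. (tr (snd z), fst (fst z))) \<in> measurable (joint_space n) (tree_sigma UNIV \<Otimes>\<^sub>M borel)"
      by measurable
    from measurable_compose[OF this pred_region[of p UNIV]] show ?thesis by simp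
  qed
  have h [measurable]: "h \<in> borel_measurable (joint_space n)"
    unfolding h_def indicator_def mem_Collect_eq of_bool_def by measurable
  have "(\<integral>\<^sup>+\<omega>. ennreal (\<Sum>p\<in>nodes_at d. indicator (region (T n b \<omega>) p) (X \<omega>) * width m (T n b \<omega>) p (- r) r) \<partial>M) =
      (\<integral>\<^sup>+\<omega>. h (joint n \<omega>) \<partial>M)"
  proof (rule nn_integral_cong)
    fix \<omega>
    have "ennreal (\<Sum>p\<in>nodes_at d. indicator (region (T n b \<omega>) p) (X \<omega>) * width m (T n b \<omega>) p (- r) r) =
        (\<Sum>p\<in>nodes_at d. ennreal (indicator (region (T n b \<omega>) p) (X \<omega>) * width m (T n b \<omega>) p (- r) r))"
      using w by (intro sum_ennreal[symmetric]) simp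
    also have "\<dots> = h (joint n \<omega>)"
      unfolding h_def T by (intro sum.cong) (auto simp: indicator_def)
    finally show "ennreal (\<Sum>p\<in>nodes_at d. indicator (region (T n b \<omega>) p) (X \<omega>) * width m (T n b \<omega>) p (- r) r) =
        h (joint n \<omega>)" .
  qed
  also have "\<dots> = (\<integral>\<^sup>+\<omega>. \<integral>\<^sup>+z. h (z, (sample Xs Ys n \<omega>, \<theta>s n \<omega>)) \<partial>P \<partial>M)"
    by (rule nn_integral_joint(2)[OF h])
  also have "\<dots> = (\<integral>\<^sup>+\<omega>. ennreal (\<Sum>p\<in>nodes_at d. potential \<mu> m r (T n b \<omega>) p) \<partial>M)"
  proof (rule nn_integral_cong)
    fix \<omega>
    note [measurable] = region_borel
    have "(\<integral>\<^sup>+z. h (z, (sample Xs Ys n \<omega>, \<theta>s n \<omega>)) \<partial>P) =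
        (\<integral>\<^sup>+x. (\<Sum>p\<in>nodes_at d. ennreal (width m (T n b \<omega>) p (- r) r) * indicator (region (T n b \<omega>) p) x) \<partial>\<mu>)"
      unfolding h_def T[symmetric] fst_conv snd_conv Collect_mem_eq by (subst nn_integral_P_fst) auto
    also have "\<dots> = (\<Sum>p\<in>nodes_at d. ennreal (width m (T n b \<omega>) p (- r) r) * emeasure \<mu> (region (T n b \<omega>) p))"
      by (subst nn_integral_sum) (auto simp: nn_integral_cmult)
    also have "\<dots> = (\<Sum>p\<in>nodes_at d. ennreal (potential \<mu> m r (T n b \<omega>) p))"
      using w by (intro sum.cong) (auto simp: potential_def mu.emeasure_eq_measure ennreal_mult mult.commute)
    also have "\<dots> = ennreal (\<Sum>p\<in>nodes_at d. potential \<mu> m r (T n b \<omega>) p)"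
      using potential_le_2r(1) by (intro sum_ennreal)
    finally show "(\<integral>\<^sup>+z. h (z, (sample Xs Ys n \<omega>, \<theta>s n \<omega>)) \<partial>P) =
        ennreal (\<Sum>p\<in>nodes_at d. potential \<mu> m r (T n b \<omega>) p)" .
  qed
  also have "\<dots> = ennreal (level_potential n b m d)"
    unfolding level_potential_def
  proof (rule nn_integral_eq_integral)
    show "integrable M (\<lambda>\<omega>. \<Sum>p\<in>nodes_at d. potential \<mu> m r (T n b \<omega>) p)"
      using rv_potential[OF b] potential_le_2r
      by (intro Bochner_Integration.integrable_sum integrable_const_bound[where B="2 * r"]) auto
  qed (auto intro!: sum_nonneg potential_le_2r)
  finally show ?thesis .
qed

section \<open>Width of the leaf that contains the test point\<close>

definition leaf_width :: "nat \<Rightarrow> nat \<Rightarrow> 'v \<Rightarrow> 'a \<Rightarrow> real" where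
  "leaf_width n b m \<omega> = width m (T n b \<omega>) (leaf n b \<omega>) (- r) r"

lemma leaf_width_bounds: "0 \<le> leaf_width n b m \<omega>" "leaf_width n b m \<omega> \<le> 2 * r"
  using width_bounds[of "- r" r m "T n b \<omega>" "leaf n b \<omega>"] r(1) by (auto simp: leaf_width_def)

lemma rv_leaf_width [measurable]:
  assumes b: "b < B"
  shows "leaf_width n b m \<in> borel_measurable M"
proof -
  note [measurable] = rv_T[OF b, of n, unfolded tree_space_eq] rv_leaf[OF b, of n]
    measurable_width[of _ UNIV m "- r" r]
  show ?thesis unfolding leaf_width_def
    by (rule measurable_compose_countable[where g="leaf n b" and f="\<lambda>p \<omega>. width m (T n b \<omega>) p (- r) r"]) measurable
qed

lemma nn_integral_leaf_width_le:
  assumes b: "b < B"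
  shows "(\<integral>\<^sup>+\<omega>. ennreal (leaf_width n b m \<omega>) \<partial>M) \<le>
    ennreal (level_potential n b m D + 2 * r * prob {\<omega> \<in> space M. length (leaf n b \<omega>) < D})"
proof -
  note [measurable] = rv_leaf[OF b, of n]
  let ?S = "{\<omega> \<in> space M. length (leaf n b \<omega>) < D}"
  let ?f = "\<lambda>\<omega>. \<Sum>p\<in>nodes_at D. indicator (region (T n b \<omega>) p) (X \<omega>) * width m (T n b \<omega>) p (- r) r"
  have w: "0 \<le> width m t p (- r) r" for t :: "'v rtree" and p
    using width_bounds[of "- r" r m t p] r(1) by simp
  have f0: "0 \<le> ?f \<omega>" for \<omega> using w by (intro sum_nonneg) auto
  have [measurable]: "?f \<in> borel_measurable M"
  proof -
    note [measurable] = rv_T[OF b, of n, unfolded tree_space_eq] measurable_width[of _ UNIV m "- r" r] pred_region[of _ UNIV]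
    have [measurable]: "Measurable.pred M (\<lambda>\<omega>. X \<omega> \<in> region (T n b \<omega>) p)" for p
    proof -
      have "Measurable.pred M (\<lambda>\<omega>. (\<lambda>(t, x). x \<in> region t p) (T n b \<omega>, X \<omega>))"
        by measurable
      then show ?thesis by simp
    qed
    show ?thesis unfolding indicator_def of_bool_def by measurable
  qed
  have "(\<integral>\<^sup>+\<omega>. ennreal (leaf_width n b m \<omega>) \<partial>M) \<le> (\<integral>\<^sup>+\<omega>. ennreal (?f \<omega>) + ennreal (2 * r) * indicator ?S \<omega> \<partial>M)"
  proof (rule nn_integral_mono)
    fix \<omega> assume \<omega>: "\<omega> \<in> space M"
    have "leaf_width n b m \<omega> \<le> ?f \<omega> + 2 * r * indicator {..<D} (length (leaf n b \<omega>))"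
      unfolding leaf_width_def using r(1) by (intro width_leaf_le) simp
    also have "indicator {..<D} (length (leaf n b \<omega>)) = (indicator ?S \<omega> :: real)"
      using \<omega> by (simp add: indicator_def)
    finally have "ennreal (leaf_width n b m \<omega>) \<le> ennreal (?f \<omega> + 2 * r * indicator ?S \<omega>)"
      by (rule ennreal_leI)
    also have "\<dots> = ennreal (?f \<omega>) + ennreal (2 * r * indicator ?S \<omega>)"
      using f0 r(1) by (intro ennreal_plus) auto
    also have "ennreal (2 * r * indicator ?S \<omega>) = ennreal (2 * r) * indicator ?S \<omega>"
      by (simp add: indicator_def)
    finally show "ennreal (leaf_width n b m \<omega>) \<le> ennreal (?f \<omega>) + ennreal (2 * r) * indicator ?S \<omega>" .
  qed
  also have "\<dots> = (\<integral>\<^sup>+\<omega>. ennreal (?f \<omega>) \<partial>M) + ennreal (2 * r) * emeasure M ?S"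
    by (subst nn_integral_add) (auto simp: nn_integral_cmult)
  also have "\<dots> = ennreal (level_potential n b m D) + ennreal (2 * r * prob ?S)"
    using r(1) by (simp add: nn_integral_width_level[OF b] emeasure_eq_measure ennreal_mult)
  also have "\<dots> = ennreal (level_potential n b m D + 2 * r * prob ?S)"
    using r(1) potential_le_2r(1) unfolding level_potential_def
    by (intro ennreal_plus[symmetric]) (auto intro!: integral_nonneg_AE sum_nonneg)
  finally show ?thesis .
qed

text \<open>\<open>D\<close> is chosen first, to make the decay term small. Then \<open>n\<close>
  makes the exceptional event of the law of large numbers and the event of a leaf above depth
  \<open>D\<close> improbable.\<close>

lemma leaf_width_tendsto_0:
  assumes b: "b < B"
  shows "(\<lambda>n. \<integral>\<^sup>+\<omega>. ennreal (leaf_width n b m \<omega>) \<partial>M) \<longlonglongrightarrow> 0"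
proof (rule order_tendstoI)
  fix e :: ennreal assume "0 < e"
  obtain e' where e': "0 < e'" "ennreal e' < e"
  proof -
    obtain c where c: "0 < c" "c < e" using dense[OF \<open>0 < e\<close>] by auto
    then show ?thesis using that by (cases c) auto
  qed
  have "(\<lambda>D. \<rho> ^ D * (2 * r)) \<longlonglongrightarrow> 0 * (2 * r)"
    using \<rho> by (intro tendsto_mult LIMSEQ_power_zero) auto
  then obtain D where D: "\<rho> ^ D * (2 * r) < e'"
    using order_tendstoD(2)[of _ 0 sequentially e'] e'(1) by (auto simp: eventually_sequentially)
  \<comment> \<open>Up to depth \<open>D\<close> there are finitely many addresses, so the cells of
    all trees at these addresses still form a bracketed class.\<close>
  let ?\<C> = "\<Union>p\<in>(\<Union>d\<le>D. nodes_at d). range (\<lambda>t :: 'v rtree. region t p)"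
  have "bracketed \<mu> ?\<C>"
    using finite_nodes_at bracketed_regions[OF prob_space_\<mu> sets_\<mu>] by (intro bracketed_UN) auto
  moreover have "0 < \<gamma> ^ Suc D / 8" using balance(1) by simp
  ultimately obtain G where G: "\<And>n. G n \<in> sets M" "(\<lambda>n. prob (G n)) \<longlonglongrightarrow> 0"
    "\<And>n \<omega> A. \<omega> \<in> space M - G n \<Longrightarrow> 0 < n \<Longrightarrow> A \<in> ?\<C> \<Longrightarrow> A \<in> sets borel \<Longrightarrow>
       \<bar>real (card {i\<in>{..<n}. Xs i \<omega> \<in> A}) / real n - measure \<mu> A\<bar> \<le> \<gamma> ^ Suc D / 8"
    using uniform_law_of_large_numbers[OF indep_Xs distr_Xs, where \<C>="?\<C>" and \<epsilon>="\<gamma> ^ Suc D / 8"]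
    by blast
  define S where "S n = {\<omega> \<in> space M. length (leaf n b \<omega>) < D}" for n
  have bound: "level_potential n b m D \<le> \<rho> ^ D * (2 * r) + real D * (2 * r * prob (G n))" if n: "0 < n" for n
  proof (rule level_potential_le[OF n b G(1)])
    fix \<omega> and p :: "bool list" assume "\<omega> \<in> space M - G n" "length p \<le> D"
    then show "\<bar>real (count n b \<omega> p) / real n - measure \<mu> (region (T n b \<omega>) p)\<bar> \<le> \<gamma> ^ Suc D / 8"
      unfolding node_count_def by (intro G(3) n region_borel) auto
  qed simp
  have "(\<lambda>n. \<rho> ^ D * (2 * r) + real D * (2 * r * prob (G n)) + 2 * r * prob (S n)) \<longlonglongrightarrow>
      \<rho> ^ D * (2 * r) + real D * (2 * r * 0) + 2 * r * 0"
    unfolding S_def by (intro tendsto_intros G(2) prob_short_leaf b)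
  then have "\<forall>\<^sub>F n in sequentially. \<rho> ^ D * (2 * r) + real D * (2 * r * prob (G n)) + 2 * r * prob (S n) < e'"
    using D by (intro order_tendstoD(2)) auto
  then show "\<forall>\<^sub>F n in sequentially. (\<integral>\<^sup>+\<omega>. ennreal (leaf_width n b m \<omega>) \<partial>M) < e"
    using eventually_gt_at_top[of 0]
  proof eventually_elim
    case (elim n)
    have "(\<integral>\<^sup>+\<omega>. ennreal (leaf_width n b m \<omega>) \<partial>M) \<le> ennreal (level_potential n b m D + 2 * r * prob (S n))"
      unfolding S_def by (rule nn_integral_leaf_width_le[OF b])
    also have "\<dots> \<le> ennreal e'" using bound[OF elim(2)] elim(1) by (intro ennreal_leI) linarith
    also have "\<dots> < e" by (rule e'(2))
    finally show ?case .
  qed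
qed simp

end

section \<open>Variance and bias\<close>

lemma node_count_cong:
  "(\<And>j. j < n \<Longrightarrow> xs j = xs' j) \<Longrightarrow> node_count n xs t p = node_count n xs' t p"
  unfolding node_count_def by (intro arg_cong[where f=card]) auto

lemma tree_weight_cong:
  "(\<And>j. j < n \<Longrightarrow> xs j = xs' j) \<Longrightarrow> xs i = xs' i \<Longrightarrow> tree_weight n xs t x i = tree_weight n xs' t x i"
  unfolding tree_weight_def using node_count_cong[of n xs xs'] by simp

lemma tree_weight_bounds: "0 \<le> tree_weight n xs t x i" "tree_weight n xs t x i \<le> 1"
proof -
  show "0 \<le> tree_weight n xs t x i" by (simp add: tree_weight_def)
  show "tree_weight n xs t x i \<le> 1"
    by (cases "node_count n xs t (leaf_of t x) = 0") (auto simp: tree_weight_def indicator_def)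
qed

lemma sum_indicator_region: "(\<Sum>i<n. indicator (region t p) (xs i)) = real (node_count n xs t p)"
  by (simp add: node_count_def indicator_def sum.If_cases Int_def)

lemma sum_tree_weight:
  assumes "0 < node_count n xs t (leaf_of t x)"
  shows "(\<Sum>i<n. tree_weight n xs t x i) = 1"
  using assms by (simp add: tree_weight_def sum_divide_distrib[symmetric] sum_indicator_region)

text \<open>An occupied leaf with \<open>k\<close> observations contributes \<open>k\<close> squares
  of \<open>1 / k\<close>; an empty leaf gives 0 on both sides, as division by zero yields 0. This
  is the source of the variance bound by the inverse leaf size.\<close>

lemma sum_tree_weight_square:
  "(\<Sum>i<n. (tree_weight n xs t x i)\<^sup>2) = 1 / real (node_count n xs t (leaf_of t x))"
proof -
  have "(tree_weight n xs t x i)\<^sup>2 =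
      indicator (region t (leaf_of t x)) (xs i) / (real (node_count n xs t (leaf_of t x)))\<^sup>2" for i
    by (simp add: tree_weight_def power_divide indicator_def)
  then show ?thesis
    by (simp add: sum_divide_distrib[symmetric] sum_indicator_region power2_eq_square)
qed

lemma tree_weight_leaf_of:
  "tree_weight n xs t x i = of_bool (leaf_of t (xs i) = leaf_of t x) /
     (\<Sum>j<n. of_bool (leaf_of t (xs j) = leaf_of t x))"
proof -
  have *: "indicator (region t (leaf_of t x)) x' = (of_bool (leaf_of t x' =
      leaf_of t x) :: real)" for x'
    by (simp add: indicator_def mem_region_leaf_of_iff)
  show ?thesis unfolding tree_weight_def sum_indicator_region[symmetric] * ..
qed

lemma measurable_tree_weight:
  fixes x :: "'w \<Rightarrow> real ^ 'v::finite"
  assumes [measurable]: "t \<in> measurable N tree_space" "x \<in> borel_measurable N"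
    and xs: "\<And>j. j < n \<Longrightarrow> xs j \<in> borel_measurable N" and i: "i < n"
  shows "(\<lambda>w. tree_weight n (\<lambda>j. xs j w) (t w) (x w) i) \<in> borel_measurable N"
proof -
  have eq: "Measurable.pred N (\<lambda>w. leaf_of (t w) (xs j w) = leaf_of (t w) (x w))" if "j < n" for j
  proof -
    note [measurable] = xs[OF that]
    have 1: "Measurable.pred N (\<lambda>w. leaf_of (t w) (y w) = p)"
      if [measurable]: "y \<in> borel_measurable N" for y :: "'w \<Rightarrow> real ^ 'v" and p
    proof -
      have "(\<lambda>w. (t w, y w)) \<in> measurable N (tree_space \<Otimes>\<^sub>M borel)" by measurable
      from measurable_compose[OF this pred_leaf_of[of p]] show ?thesis by simp
    qed
    note [measurable] = 1[OF xs[OF that]] 1[OF assms(2)]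
    \<comment> \<open>Equality of two random addresses is a countable union over their common
      value.\<close>
    have "(\<lambda>w. leaf_of (t w) (xs j w) = leaf_of (t w) (x w)) =
        (\<lambda>w. \<exists>p. leaf_of (t w) (xs j w) = p \<and> leaf_of (t w) (x w) = p)" by auto
    then show ?thesis by (simp only:) measurable
  qed
  note [measurable] = eq[OF i]
  have [measurable]: "(\<lambda>w. \<Sum>j<n. of_bool (leaf_of (t w) (xs j w) = leaf_of (t w) (x w)) :: real) \<in>
      borel_measurable N"
    using eq by (intro borel_measurable_sum) (simp add: of_bool_def)
  show ?thesis unfolding tree_weight_leaf_of of_bool_def[of "leaf_of _ (xs i _) = _"] by measurable
qed

section \<open>Honest noise and weighted responses\<close>

context regression_forest begin

abbreviation wt :: "nat \<Rightarrow> nat \<Rightarrow> 'a \<Rightarrow> nat \<Rightarrow> real" where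
  "wt n b \<omega> i \<equiv> tree_weight n (\<lambda>i. Xs i \<omega>) (T n b \<omega>) (X \<omega>) i"

text \<open>The weight as a function of test point, data and randomization, so that the data can be
  integrated over their product law. \<open>grow\<close> receives the full data with responses, and
  honesty has to be invoked to discount them.\<close>

definition data_weight where
  "data_weight n b x d us i = tree_weight n (\<lambda>i. fst (d i)) (grow n (us b) d) x i"
  for n b :: nat and x :: "real ^ 'v" and d :: "nat \<Rightarrow> (real ^ 'v) \<times> real" and us :: "nat \<Rightarrow> 't" and i :: nat

lemma data_weight_sample:
  assumes "b < B" "i < n"
  shows "data_weight n b (X \<omega>) (sample Xs Ys n \<omega>) (\<theta>s n \<omega>) i = wt n b \<omega> i"
  unfolding data_weight_def tree_of_joint[OF assms(1), symmetric]
  by (rule tree_weight_cong) (use assms in \<open>auto simp: sample_def\<close>)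

lemma measurable_coord [measurable]:
  assumes "i < n"
  shows "(\<lambda>w. fst (snd w) i) \<in> borel_measurable (joint_space n)"
proof -
  have "(\<lambda>d. d i) \<in> measurable (data_space n) borel"
    using assms by (intro measurable_component_singleton) simp
  then show ?thesis by measurable
qed

lemma measurable_data_weight:
  assumes b: "b < B" and i: "i < n"
  shows "(\<lambda>w. data_weight n b (fst (fst w)) (fst (snd w)) (snd (snd w)) i) \<in>
      borel_measurable (joint_space n)"
  unfolding data_weight_def
proof (rule measurable_tree_weight[OF _ _ _ i])
  have "snd \<in> measurable (joint_space n) (data_space n \<Otimes>\<^sub>M \<Theta>s)" by measurable
  from measurable_compose[OF this measurable_tree[OF b]]
  show "(\<lambda>w. grow n (snd (snd w) b) (fst (snd w))) \<in> measurable (joint_space n) tree_space" .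
  show "(\<lambda>w. fst (fst w)) \<in> borel_measurable (joint_space n)" by measurable
  show "(\<lambda>w. fst (fst (snd w) j)) \<in> borel_measurable (joint_space n)" if "j < n" for j
    by (rule measurable_compose[OF measurable_coord[OF that] fst_snd_borel(1)])
qed

lemma rv_joint_map [measurable]: "joint n \<in> measurable M (joint_space n)"
  using rv_joint[of n] by measurable

lemma rv_wt:
  assumes b: "b < B" and i: "i < n"
  shows "(\<lambda>\<omega>. wt n b \<omega> i) \<in> borel_measurable M"
  using measurable_compose[OF rv_joint_map measurable_data_weight[OF b i]]
  by (simp add: data_weight_sample[OF b i])

lemma cdf_K_measurable2:
  assumes [measurable]: "g \<in> borel_measurable N" "y \<in> borel_measurable N"
  shows "(\<lambda>w. cdf (K (g w)) (y w)) \<in> borel_measurable N"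
proof -
  have "(\<lambda>w. K (g w)) \<in> measurable N (prob_algebra borel)"
    using K_kernel by measurable
  moreover have "Sigma (space N) (\<lambda>w. {..y w}) \<in> sets (N \<Otimes>\<^sub>M borel)"
  proof -
    have "Sigma (space N) (\<lambda>w. {..y w}) = {z \<in> space (N \<Otimes>\<^sub>M borel). snd z \<le> y (fst z)}"
      by (auto simp: space_pair_measure)
    also have "\<dots> \<in> sets (N \<Otimes>\<^sub>M borel)" by measurable
    finally show ?thesis .
  qed
  ultimately show ?thesis unfolding cdf_def by (intro measure_measurable_prob_algebra2)
qed

lemma cdf_K_bounds: "0 \<le> cdf (K x) y" "cdf (K x) y \<le> 1"
  using prob_space.prob_le_1[OF K_prob] by (auto simp: cdf_def)

text \<open>The level is a function of the test point because it will be the conditional quantile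
  shifted by a constant. Once the test pair is frozen it is a constant for the sample.\<close>

definition noise :: "nat \<Rightarrow> nat \<Rightarrow> (real ^ 'v \<Rightarrow> real) \<Rightarrow> 'a \<Rightarrow> real" where
  "noise n b y \<omega> = (\<Sum>i<n. wt n b \<omega> i * (indicator {..y (X \<omega>)} (Ys i \<omega>) - cdf (K (Xs i \<omega>)) (y (X \<omega>))))"

text \<open>With test pair and randomization frozen, honesty makes the weights functions of the
  covariates. The second moment bound then applies to the integral over the sample alone.\<close>

lemma nn_integral_noise:
  assumes n: "0 < n" and b: "b < B" and y [measurable]: "y \<in> borel_measurable borel"
  shows "(\<integral>\<^sup>+\<omega>. ennreal ((noise n b y \<omega>)\<^sup>2) \<partial>M) \<le>
    (\<integral>\<^sup>+\<omega>. ennreal (1 / real (count n b \<omega> (leaf n b \<omega>))) \<partial>M)"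
proof -
  interpret S: cond_sample P \<mu> K "{..<n}" by (rule cond_sample)
  define N where "N = PiM {..<n} (\<lambda>_. P)"
  have sets_N [measurable_cong]: "sets N = sets (data_space n)"
    unfolding N_def by (intro sets_PiM_cong) (auto simp: sets_P)
  define V where "V z d us = (\<Sum>i<n. data_weight n b (fst z) d us i *
      (indicator {..y (fst z)} (snd (d i)) - cdf (K (fst (d i))) (y (fst z))))"
    for z :: "(real ^ 'v) \<times> real" and d us
  define h where "h w = ennreal ((V (fst w) (fst (snd w)) (snd (snd w)))\<^sup>2)"
    for w :: "((real ^ 'v) \<times> real) \<times> (nat \<Rightarrow> (real ^ 'v) \<times> real) \<times> (nat \<Rightarrow> 't)"
  define g where "g w = ennreal (\<Sum>i<n. (data_weight n b (fst (fst w)) (fst (snd w)) (snd (snd w)) i)\<^sup>2)"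
    for w :: "((real ^ 'v) \<times> real) \<times> (nat \<Rightarrow> (real ^ 'v) \<times> real) \<times> (nat \<Rightarrow> 't)"
  have yfst: "(\<lambda>w. y (fst (fst w))) \<in> borel_measurable (joint_space n)" by measurable
  have h: "h \<in> borel_measurable (joint_space n)"
    unfolding h_def V_def
  proof (intro measurable_compose[OF _ measurable_ennreal] borel_measurable_power borel_measurable_sum
      borel_measurable_times borel_measurable_diff)
    fix i assume "i \<in> {..<n}"
    then have i: "i < n" by simp
    note [measurable] = measurable_coord[OF i]
    show "(\<lambda>w. data_weight n b (fst (fst w)) (fst (snd w)) (snd (snd w)) i) \<in>
        borel_measurable (joint_space n)"
      by (rule measurable_data_weight[OF b i])
    show "(\<lambda>w. cdf (K (fst (fst (snd w) i))) (y (fst (fst w)))) \<in> borel_measurable (joint_space n)"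
      by (intro cdf_K_measurable2 yfst) measurable
    have "Measurable.pred (joint_space n) (\<lambda>w. snd (fst (snd w) i) \<le> y (fst (fst w)))"
      by measurable
    then show "(\<lambda>w. indicator {..y (fst (fst w))} (snd (fst (snd w) i)) :: real) \<in>
        borel_measurable (joint_space n)"
      unfolding indicator_def of_bool_def atMost_iff by measurable
  qed
  have g: "g \<in> borel_measurable (joint_space n)"
    unfolding g_def
    by (intro measurable_compose[OF _ measurable_ennreal] borel_measurable_power borel_measurable_sum
        measurable_data_weight b) auto
  have "(\<integral>\<^sup>+\<omega>. ennreal ((noise n b y \<omega>)\<^sup>2) \<partial>M) = (\<integral>\<^sup>+\<omega>. h (joint n \<omega>) \<partial>M)"
  proof (rule nn_integral_cong)
    fix \<omega>
    have "noise n b y \<omega> = V (X \<omega>, Y \<omega>) (sample Xs Ys n \<omega>) (\<theta>s n \<omega>)"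
      unfolding noise_def V_def fst_conv
      by (intro sum.cong refl) (simp add: data_weight_sample[OF b], simp add: sample_def)
    then show "ennreal ((noise n b y \<omega>)\<^sup>2) = h (joint n \<omega>)" by (simp add: h_def)
  qed
  also have "\<dots> = (\<integral>\<^sup>+\<omega>. \<integral>\<^sup>+d. h ((X \<omega>, Y \<omega>), (d, \<theta>s n \<omega>)) \<partial>N \<partial>M)"
    unfolding N_def by (rule nn_integral_joint_sample[OF n h])
  also have "\<dots> \<le> (\<integral>\<^sup>+\<omega>. \<integral>\<^sup>+d. g ((X \<omega>, Y \<omega>), (d, \<theta>s n \<omega>)) \<partial>N \<partial>M)"
  proof (rule nn_integral_mono)
    fix \<omega> assume \<omega>: "\<omega> \<in> space M"
    have us: "\<theta>s n \<omega> \<in> space \<Theta>s" using measurable_space[OF rv_\<theta>s \<omega>] .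
    then have u: "\<theta>s n \<omega> b \<in> space \<Theta>" using b by (auto simp: space_PiM)
    have space_N: "space N = extensional {..<n}"
      unfolding N_def by (rule S.space_N)
    have "(\<integral>\<^sup>+d. ennreal ((\<Sum>i\<in>{..<n}. data_weight n b (X \<omega>) d (\<theta>s n \<omega>) i *
        (indicator {..y (X \<omega>)} (snd (d i)) - cdf (K (fst (d i))) (y (X \<omega>))))\<^sup>2) \<partial>PiM {..<n} (\<lambda>_. P))
      \<le> (\<integral>\<^sup>+d. ennreal (\<Sum>i\<in>{..<n}. (data_weight n b (X \<omega>) d (\<theta>s n \<omega>) i)\<^sup>2) \<partial>PiM {..<n} (\<lambda>_. P))"
    proof (rule S.second_moment_weighted_noise)
      show "(\<lambda>d. data_weight n b (X \<omega>) d (\<theta>s n \<omega>) i) \<in> borel_measurable (PiM {..<n} (\<lambda>_. P))"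
        if "i \<in> {..<n}" for i
      proof -
        have "(\<lambda>d. ((X \<omega>, Y \<omega>), (d, \<theta>s n \<omega>))) \<in> measurable N (joint_space n)"
          using us by measurable
        from measurable_compose[OF this measurable_data_weight[OF b, of i]] that
        show ?thesis by (simp add: N_def)
      qed
      fix i d d'
      show "0 \<le> data_weight n b (X \<omega>) d (\<theta>s n \<omega>) i" "data_weight n b (X \<omega>) d (\<theta>s n \<omega>) i \<le> 1"
        by (simp_all add: data_weight_def tree_weight_bounds)
      assume d: "d \<in> space (PiM {..<n} (\<lambda>_. P))" "d' \<in> space (PiM {..<n} (\<lambda>_. P))"
        and eq: "\<And>j. j \<in> {..<n} \<Longrightarrow> fst (d j) = fst (d' j)"
      have ext: "d \<in> extensional {..<n}" "d' \<in> extensional {..<n}"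
        using d space_N by (auto simp: N_def)
      have "grow n (\<theta>s n \<omega> b) d = grow n (\<theta>s n \<omega> b) d'"
        using honesty(1)[unfolded honest_def, rule_format, OF u ext] eq by blast
      \<comment> \<open>For \<open>i \<ge> n\<close> both entries are \<open>undefined\<close>,
        since the data are extensional.\<close>
      moreover have "fst (d i) = fst (d' i)"
        using eq[of i] ext by (cases "i < n") (simp_all add: extensional_def)
      ultimately show "data_weight n b (X \<omega>) d (\<theta>s n \<omega>) i = data_weight n b (X \<omega>) d' (\<theta>s n \<omega>) i"
        unfolding data_weight_def using eq by (simp only:) (rule tree_weight_cong, simp_all)
    qed
    then show "(\<integral>\<^sup>+d. h ((X \<omega>, Y \<omega>), (d, \<theta>s n \<omega>)) \<partial>N) \<le> (\<integral>\<^sup>+d. g ((X \<omega>, Y \<omega>), (d, \<theta>s n \<omega>)) \<partial>N)"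
      unfolding h_def g_def V_def N_def fst_conv snd_conv .
  qed
  also have "\<dots> = (\<integral>\<^sup>+\<omega>. g (joint n \<omega>) \<partial>M)"
    unfolding N_def by (rule nn_integral_joint_sample[OF n g, symmetric])
  also have "\<dots> = (\<integral>\<^sup>+\<omega>. ennreal (1 / real (count n b \<omega> (leaf n b \<omega>))) \<partial>M)"
    unfolding g_def
    by (intro nn_integral_cong) (simp add: data_weight_sample[OF b] sum_tree_weight_square)
  finally show ?thesis .
qed

text \<open>A first moment analogue of the noise bound: by honesty the weight of \<open>i\<close>
  does not react to the response of \<open>i\<close>, so each summand needs one resampling. It
  serves to bound weighted moments of the responses.\<close>

lemma nn_integral_weighted_response:
  fixes \<phi> :: "real \<Rightarrow> ennreal"
  assumes n: "0 < n" and b: "b < B" and [measurable]: "\<phi> \<in> borel_measurable borel"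
  shows "(\<integral>\<^sup>+\<omega>. (\<Sum>i<n. ennreal (wt n b \<omega> i) * \<phi> (Ys i \<omega>)) \<partial>M) =
    (\<integral>\<^sup>+\<omega>. (\<Sum>i<n. ennreal (wt n b \<omega> i) * (\<integral>\<^sup>+y. \<phi> y \<partial>K (Xs i \<omega>))) \<partial>M)"
proof -
  interpret S: cond_sample P \<mu> K "{..<n}" by (rule cond_sample)
  define N where "N = PiM {..<n} (\<lambda>_. P)"
  have sets_N [measurable_cong]: "sets N = sets (data_space n)"
    unfolding N_def by (intro sets_PiM_cong) (auto simp: sets_P)
  define \<kappa> where "\<kappa> x = (\<integral>\<^sup>+y. \<phi> y \<partial>K x)" for x
  have [measurable]: "\<kappa> \<in> borel_measurable borel"
    unfolding \<kappa>_def using S.nn_integral_kernel_measurable[of "\<lambda>z. \<phi> (snd z)"] by simp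
  have "(\<integral>\<^sup>+\<omega>. ennreal (wt n b \<omega> i) * \<phi> (Ys i \<omega>) \<partial>M) = (\<integral>\<^sup>+\<omega>. ennreal (wt n b \<omega> i) * \<kappa> (Xs i \<omega>) \<partial>M)"
    if i: "i < n" for i
  proof -
    note [measurable] = measurable_data_weight[OF b i] measurable_coord[OF i]
    define h where "h w = ennreal (data_weight n b (fst (fst w)) (fst (snd w)) (snd (snd w)) i) * \<phi> (snd (fst (snd w) i))"
      for w :: "((real ^ 'v) \<times> real) \<times> (nat \<Rightarrow> (real ^ 'v) \<times> real) \<times> (nat \<Rightarrow> 't)"
    define g where "g w = ennreal (data_weight n b (fst (fst w)) (fst (snd w)) (snd (snd w)) i) * \<kappa> (fst (fst (snd w) i))"
      for w :: "((real ^ 'v) \<times> real) \<times> (nat \<Rightarrow> (real ^ 'v) \<times> real) \<times> (nat \<Rightarrow> 't)"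
    have h: "h \<in> borel_measurable (joint_space n)" unfolding h_def by measurable
    have g: "g \<in> borel_measurable (joint_space n)" unfolding g_def by measurable
    have "(\<integral>\<^sup>+\<omega>. ennreal (wt n b \<omega> i) * \<phi> (Ys i \<omega>) \<partial>M) = (\<integral>\<^sup>+\<omega>. h (joint n \<omega>) \<partial>M)"
      using i by (simp add: h_def data_weight_sample[OF b i]) (simp add: sample_def)
    also have "\<dots> = (\<integral>\<^sup>+\<omega>. \<integral>\<^sup>+d. h ((X \<omega>, Y \<omega>), (d, \<theta>s n \<omega>)) \<partial>N \<partial>M)"
      unfolding N_def by (rule nn_integral_joint_sample[OF n h])
    also have "\<dots> = (\<integral>\<^sup>+\<omega>. \<integral>\<^sup>+d. g ((X \<omega>, Y \<omega>), (d, \<theta>s n \<omega>)) \<partial>N \<partial>M)"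
    proof (rule nn_integral_cong)
      fix \<omega> assume \<omega>: "\<omega> \<in> space M"
      have us: "\<theta>s n \<omega> \<in> space \<Theta>s" using measurable_space[OF rv_\<theta>s \<omega>] .
      then have u: "\<theta>s n \<omega> b \<in> space \<Theta>" using b by (auto simp: space_PiM)
      define W where "W d = ennreal (data_weight n b (X \<omega>) d (\<theta>s n \<omega>) i)" for d
      have "(\<integral>\<^sup>+d. W d * (\<lambda>z. \<phi> (snd z)) (d i) \<partial>PiM {..<n} (\<lambda>_. P)) =
        (\<integral>\<^sup>+d. W d * (\<integral>\<^sup>+y. (\<lambda>z. \<phi> (snd z)) (fst (d i), y) \<partial>K (fst (d i))) \<partial>PiM {..<n} (\<lambda>_. P))"
      proof (rule S.nn_integral_resample)
        have "(\<lambda>d. ((X \<omega>, Y \<omega>), (d, \<theta>s n \<omega>))) \<in> measurable N (joint_space n)"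
          using us by measurable
        from measurable_compose[OF measurable_compose[OF this measurable_data_weight[OF b i]] measurable_ennreal]
        show "W \<in> borel_measurable (PiM {..<n} (\<lambda>_. P))" by (simp add: N_def W_def[abs_def])
        fix d x y y' assume d: "d \<in> space (PiM {..<n} (\<lambda>_. P))"
        have "grow n (\<theta>s n \<omega> b) (d(i := (x, y))) = grow n (\<theta>s n \<omega> b) (d(i := (x, y')))"
          using honesty(1) u d i unfolding honest_def S.space_N by (auto simp: extensional_def)
        then show "W (d(i := (x, y))) = W (d(i := (x, y')))"
          unfolding W_def data_weight_def
          by (simp, intro arg_cong[where f=ennreal] tree_weight_cong) auto
      qed (use i in auto)
      then show "(\<integral>\<^sup>+d. h ((X \<omega>, Y \<omega>), (d, \<theta>s n \<omega>)) \<partial>N) = (\<integral>\<^sup>+d. g ((X \<omega>, Y \<omega>), (d, \<theta>s n \<omega>)) \<partial>N)"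
        by (simp add: h_def g_def W_def N_def \<kappa>_def)
    qed
    also have "\<dots> = (\<integral>\<^sup>+\<omega>. g (joint n \<omega>) \<partial>M)"
      unfolding N_def by (rule nn_integral_joint_sample[OF n g, symmetric])
    also have "\<dots> = (\<integral>\<^sup>+\<omega>. ennreal (wt n b \<omega> i) * \<kappa> (Xs i \<omega>) \<partial>M)"
      using i by (simp add: g_def data_weight_sample[OF b i]) (simp add: sample_def)
    finally show ?thesis .
  qed
  moreover have "(\<lambda>\<omega>. ennreal (wt n b \<omega> i) * \<phi> (Ys i \<omega>)) \<in> borel_measurable M"
    "(\<lambda>\<omega>. ennreal (wt n b \<omega> i) * \<kappa> (Xs i \<omega>)) \<in> borel_measurable M" if "i < n" for i
    using rv_wt[OF b that] by measurable
  ultimately show ?thesis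
    unfolding \<kappa>_def[symmetric] by (subst (1 2) nn_integral_sum) auto
qed

end

section \<open>Consistency of the estimated distribution function\<close>

text \<open>Markov's inequality wants a fixed threshold, whereas \<open>g\<close> will be the
  squared distance of the conditional distribution function from the level, for which no uniform
  positive lower bound is assumed. Cutting at a small \<open>\<eta>\<close> discards an event of
  probability below \<open>e / 2\<close>.\<close>

lemma (in prob_space) prob_ge_tendsto_0:
  fixes U :: "nat \<Rightarrow> 'a \<Rightarrow> real"
  assumes [measurable]: "\<And>n. U n \<in> borel_measurable M" "g \<in> borel_measurable M"
    and lim: "(\<lambda>n. \<integral>\<^sup>+\<omega>. ennreal (U n \<omega>) \<partial>M) \<longlonglongrightarrow> 0"
    and pos: "AE \<omega> in M. 0 < g \<omega>"
  shows "(\<lambda>n. prob {\<omega> \<in> space M. g \<omega> \<le> U n \<omega>}) \<longlonglongrightarrow> 0"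
proof (rule order_tendstoI)
  fix e :: real assume e: "0 < e"
  have "(\<lambda>k. prob {\<omega> \<in> space M. g \<omega> < 1 / real (Suc k)}) \<longlonglongrightarrow> 0"
  proof (rule prob_tendsto_0_of_AE)
    show "AE \<omega> in M. \<forall>\<^sub>F k in sequentially. \<omega> \<notin> {\<omega> \<in> space M. g \<omega> < 1 / real (Suc k)}"
      using pos
    proof eventually_elim
      case (elim \<omega>)
      have "\<forall>\<^sub>F k in sequentially. 1 / real (Suc k) < g \<omega>"
        using lim_1_over_n[THEN LIMSEQ_Suc] elim by (intro order_tendstoD(2)) auto
      then show ?case by eventually_elim auto
    qed
  qed measurable
  then have "\<forall>\<^sub>F k in sequentially. prob {\<omega> \<in> space M. g \<omega> < 1 / real (Suc k)} < e / 2"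
    using e by (intro order_tendstoD(2)) auto
  then obtain k where k: "prob {\<omega> \<in> space M. g \<omega> < 1 / real (Suc k)} < e / 2"
    by (auto simp: eventually_sequentially)
  define \<eta> where "\<eta> = 1 / real (Suc k)"
  have eta: "0 < \<eta>" by (simp add: \<eta>_def)
  have "\<forall>\<^sub>F n in sequentially. (\<integral>\<^sup>+\<omega>. ennreal (U n \<omega>) \<partial>M) < ennreal (\<eta> * (e / 2))"
    using eta e lim by (intro order_tendstoD(2)) auto
  then show "\<forall>\<^sub>F n in sequentially. prob {\<omega> \<in> space M. g \<omega> \<le> U n \<omega>} < e"
  proof eventually_elim
    case (elim n)
    have "ennreal (\<eta> * prob {\<omega> \<in> space M. \<eta> \<le> U n \<omega>}) =
        (\<integral>\<^sup>+\<omega>. ennreal \<eta> * indicator {\<omega> \<in> space M. \<eta> \<le> U n \<omega>} \<omega> \<partial>M)"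
      using eta by (simp add: nn_integral_cmult_indicator emeasure_eq_measure ennreal_mult)
    also have "\<dots> \<le> (\<integral>\<^sup>+\<omega>. ennreal (U n \<omega>) \<partial>M)"
      by (intro nn_integral_mono) (auto simp: indicator_def intro: ennreal_leI)
    also have "\<dots> < ennreal (\<eta> * (e / 2))" by (rule elim)
    finally have "\<eta> * prob {\<omega> \<in> space M. \<eta> \<le> U n \<omega>} < \<eta> * (e / 2)"
      using eta e by (subst (asm) ennreal_less_iff) (auto intro!: mult_nonneg_nonneg)
    then have 1: "prob {\<omega> \<in> space M. \<eta> \<le> U n \<omega>} < e / 2" using eta by simp
    have "prob {\<omega> \<in> space M. g \<omega> \<le> U n \<omega>} \<le>
        prob ({\<omega> \<in> space M. g \<omega> < \<eta>} \<union> {\<omega> \<in> space M. \<eta> \<le> U n \<omega>})"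
      by (intro finite_measure_mono) auto
    also have "\<dots> \<le> prob {\<omega> \<in> space M. g \<omega> < \<eta>} + prob {\<omega> \<in> space M. \<eta> \<le> U n \<omega>}"
      by (intro measure_Un_le) auto
    also have "\<dots> < e" using 1 k by (simp add: \<eta>_def)
    finally show ?case .
  qed
qed (simp add: order_less_le_trans[OF _ measure_nonneg])

context regression_forest begin

text \<open>The assumption on minimal leaf sizes gives positive counts only eventually. Balance
  gives them for every positive \<open>n\<close>, so that the weights sum to one without
  exception.\<close>

lemma AE_count_pos: "AE \<omega> in M. \<forall>n b. 0 < n \<longrightarrow> b < B \<longrightarrow> 0 < count n b \<omega> (leaf n b \<omega>)"
  using AE_leaf_count
proof eventually_elim
  case (elim \<omega>)
  show ?case
  proof (intro allI impI)
    fix n b :: nat assume "0 < n" "b < B"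
    then have "\<gamma> ^ length (leaf n b \<omega>) * real n \<le> real (count n b \<omega> (leaf n b \<omega>))"
      using elim by blast
    moreover have "0 < \<gamma> ^ length (leaf n b \<omega>) * real n" using balance(1) \<open>0 < n\<close> by simp
    ultimately show "0 < count n b \<omega> (leaf n b \<omega>)" by (simp add: order_less_le_trans)
  qed
qed

lemma rv_inverse_count:
  assumes b: "b < B"
  shows "(\<lambda>\<omega>. 1 / real (count n b \<omega> (leaf n b \<omega>))) \<in> borel_measurable M"
  unfolding sum_tree_weight_square[symmetric]
  using rv_wt[OF b] by (intro borel_measurable_sum borel_measurable_power) auto

lemma inverse_count_tendsto_0:
  assumes b: "b < B"
  shows "(\<lambda>n. \<integral>\<^sup>+\<omega>. ennreal (1 / real (count n b \<omega> (leaf n b \<omega>))) \<partial>M) \<longlonglongrightarrow> 0"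
proof -
  define u where "u n \<omega> = 1 / real (count n b \<omega> (leaf n b \<omega>))" for n \<omega>
  have [measurable]: "u n \<in> borel_measurable M" for n
    unfolding u_def by (rule rv_inverse_count[OF b])
  \<comment> \<open>Counts are integers, and \<open>1 / 0\<close> is 0, so \<open>u\<close> never
    exceeds 1 and a constant dominates.\<close>
  have u: "0 \<le> u n \<omega>" "u n \<omega> \<le> 1" for n \<omega>
    by (auto simp: u_def divide_le_eq)
  have "(\<lambda>n. \<integral>\<omega>. u n \<omega> \<partial>M) \<longlonglongrightarrow> (\<integral>\<omega>. 0 \<partial>M)"
  proof (rule integral_dominated_convergence[where w="\<lambda>_. 1"])
    show "AE \<omega> in M. (\<lambda>n. u n \<omega>) \<longlonglongrightarrow> 0"
      using min_leaf
    proof eventually_elim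
      case (elim \<omega>)
      let ?m = "\<lambda>n. Min (leaf_counts n (\<lambda>i. Xs i \<omega>) B (\<lambda>b. T n b \<omega>))"
      have "(\<lambda>n. 1 / real (?m n)) \<longlonglongrightarrow> 0"
        using smalloD_tendsto[OF conjunct2[OF elim]] by simp
      moreover have "\<forall>\<^sub>F n in sequentially. norm (u n \<omega>) \<le> 1 / real (?m n)"
        using conjunct1[OF elim]
      proof eventually_elim
        case (elim n)
        have "?m n \<le> count n b \<omega> (leaf n b \<omega>)"
          by (rule leaf_counts_bounds(1)[OF b])
        then show ?case using elim by (simp add: u_def frac_le)
      qed
      ultimately show ?case by (rule Lim_null_comparison[rotated])
    qed
    show "AE \<omega> in M. norm (u n \<omega>) \<le> 1" for n using u by simp
  qed auto
  then have "(\<lambda>n. ennreal (\<integral>\<omega>. u n \<omega> \<partial>M)) \<longlonglongrightarrow> ennreal 0"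
    by (intro tendsto_ennrealI) simp
  moreover have "(\<integral>\<^sup>+\<omega>. ennreal (u n \<omega>) \<partial>M) = ennreal (\<integral>\<omega>. u n \<omega> \<partial>M)" for n
    using u by (intro nn_integral_eq_integral integrable_const_bound[where B=1]) auto
  ultimately show ?thesis by (simp add: u_def)
qed

lemma cdf_K_lipschitz:
  assumes "x \<in> \<X>" "x' \<in> \<X>"
  shows "\<bar>cdf (K x) y - cdf (K x') y\<bar> \<le> C * l1_norm (x - x')"
proof -
  have "\<bar>cdf (K x) y - cdf (K x') y\<bar> \<le> (SUP y. \<bar>cdf (K x) y - cdf (K x') y\<bar>)"
  proof (rule cSUP_upper)
    have "\<bar>cdf (K x) y - cdf (K x') y\<bar> \<le> 1" for y
      using cdf_K_bounds[of x y] cdf_K_bounds[of x' y] by linarith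
    then show "bdd_above (range (\<lambda>y. \<bar>cdf (K x) y - cdf (K x') y\<bar>))"
      by (intro bdd_aboveI[of _ 1]) auto
  qed simp
  also have "\<dots> \<le> C * l1_norm (x - x')" by (rule lipschitz(2)[OF assms])
  finally show ?thesis .
qed

definition ecdf :: "nat \<Rightarrow> nat \<Rightarrow> real \<Rightarrow> 'a \<Rightarrow> real" where
  "ecdf n b y \<omega> = (\<Sum>i<n. wt n b \<omega> i * indicator {..y} (Ys i \<omega>))"

lemma rv_ecdf [measurable]:
  assumes b: "b < B" and [measurable]: "z \<in> borel_measurable M"
  shows "(\<lambda>\<omega>. ecdf n b (z \<omega>) \<omega>) \<in> borel_measurable M"
proof -
  have "(\<lambda>\<omega>. wt n b \<omega> i * indicator {..z \<omega>} (Ys i \<omega>)) \<in> borel_measurable M" if "i < n" for i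
  proof -
    note [measurable] = rv_wt[OF b that]
    show ?thesis unfolding indicator_def of_bool_def atMost_iff by measurable
  qed
  then show ?thesis unfolding ecdf_def by (intro borel_measurable_sum) auto
qed

text \<open>The error is noise plus the bias \<open>e\<close>, because the weights sum to one. Only
  observations in the leaf of \<open>X\<close> enter the bias, and they differ from \<open>X\<close>
  by at most the leaf widths.\<close>

lemma AE_ecdf_error:
  "AE \<omega> in M. \<forall>n b. 0 < n \<longrightarrow> b < B \<longrightarrow>
     (ecdf n b (y (X \<omega>)) \<omega> - cdf (K (X \<omega>)) (y (X \<omega>)))\<^sup>2 \<le>
       2 * (noise n b y \<omega>)\<^sup>2 + 2 * C * (\<Sum>m\<in>UNIV. leaf_width n b m \<omega>)"
  using AE_count_pos AE_X AE_Xs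
proof eventually_elim
  case (elim \<omega>)
  show ?case
  proof (intro allI impI)
    fix n b :: nat assume n: "0 < n" and b: "b < B"
    have sum1: "(\<Sum>i<n. wt n b \<omega> i) = 1"
      using elim(1) n b by (intro sum_tree_weight) blast
    define F where "F x = cdf (K x) (y (X \<omega>))" for x
    define w where "w = C * (\<Sum>m\<in>UNIV. leaf_width n b m \<omega>)"
    define e where "e = (\<Sum>i<n. wt n b \<omega> i * (F (Xs i \<omega>) - F (X \<omega>)))"
    have split: "ecdf n b (y (X \<omega>)) \<omega> - F (X \<omega>) = noise n b y \<omega> + e"
    proof -
      have "noise n b y \<omega> + e = (\<Sum>i<n. wt n b \<omega> i * indicator {..y (X \<omega>)} (Ys i \<omega>) - wt n b \<omega> i * F (X \<omega>))"
        unfolding noise_def e_def F_def[symmetric] sum.distrib[symmetric]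
        by (intro sum.cong refl) (simp add: algebra_simps)
      also have "\<dots> = ecdf n b (y (X \<omega>)) \<omega> - (\<Sum>i<n. wt n b \<omega> i) * F (X \<omega>)"
        by (simp add: ecdf_def sum_subtractf sum_distrib_right)
      finally show ?thesis by (simp add: sum1)
    qed
    \<comment> \<open>An observation outside the leaf has weight zero, so the Lipschitz estimate is
      needed only where both points lie in the same clipped cell.\<close>
    have smooth: "wt n b \<omega> i * \<bar>F (Xs i \<omega>) - F (X \<omega>)\<bar> \<le> wt n b \<omega> i * w" for i
    proof (cases "Xs i \<omega> \<in> region (T n b \<omega>) (leaf n b \<omega>)")
      case True
      have "\<bar>F (Xs i \<omega>) - F (X \<omega>)\<bar> \<le> C * l1_norm (Xs i \<omega> - X \<omega>)"
        unfolding F_def using elim by (intro cdf_K_lipschitz) auto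
      also have "\<dots> \<le> w"
        unfolding w_def l1_norm_def
      proof (intro mult_left_mono sum_mono)
        fix m :: 'v
        have "\<bar>Xs i \<omega> $ m\<bar> \<le> r" "\<bar>X \<omega> $ m\<bar> \<le> r" using elim r(2) by auto
        moreover have "X \<omega> \<in> region (T n b \<omega>) (leaf n b \<omega>)" by (simp add: mem_region_leaf_of_iff)
        ultimately show "\<bar>(Xs i \<omega> - X \<omega>) $ m\<bar> \<le> leaf_width n b m \<omega>"
          unfolding leaf_width_def using dist_le_width[OF True, of "X \<omega>" "- r" m r] by simp
      qed (use lipschitz(1) in simp)
      finally show ?thesis by (intro mult_left_mono tree_weight_bounds)
    qed (simp add: tree_weight_def)
    have "\<bar>e\<bar> \<le> (\<Sum>i<n. wt n b \<omega> i * \<bar>F (Xs i \<omega>) - F (X \<omega>)\<bar>)"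
      unfolding e_def by (rule order_trans[OF sum_abs]) (simp add: abs_mult tree_weight_bounds)
    moreover have "\<dots> \<le> (\<Sum>i<n. wt n b \<omega> i * w)" by (intro sum_mono smooth)
    moreover have "(\<Sum>i<n. wt n b \<omega> i * w) = w" by (simp add: sum_distrib_right[symmetric] sum1)
    moreover have "(\<Sum>i<n. wt n b \<omega> i * \<bar>F (Xs i \<omega>) - F (X \<omega>)\<bar>) \<le> (\<Sum>i<n. wt n b \<omega> i * 1)"
    proof (intro sum_mono mult_left_mono tree_weight_bounds)
      fix i
      show "\<bar>F (Xs i \<omega>) - F (X \<omega>)\<bar> \<le> 1"
        using cdf_K_bounds[of "Xs i \<omega>" "y (X \<omega>)"] cdf_K_bounds[of "X \<omega>" "y (X \<omega>)"]
        unfolding F_def by linarith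
    qed
    ultimately have e: "\<bar>e\<bar> \<le> w" "\<bar>e\<bar> \<le> 1" using sum1 by auto
    \<comment> \<open>Distribution functions differ by at most 1, so the square of \<open>e\<close>
      is at most \<open>\<bar>e\<bar>\<close>. The bound thus stays linear in the widths, whose
      expectations are known to vanish.\<close>
    have "e\<^sup>2 = \<bar>e\<bar> * \<bar>e\<bar>" by (simp add: power2_eq_square)
    also have "\<dots> \<le> \<bar>e\<bar>" using e(2) by (intro mult_left_le) auto
    finally have e2: "e\<^sup>2 \<le> w" using e(1) by linarith
    have "(noise n b y \<omega> + e)\<^sup>2 \<le> 2 * (noise n b y \<omega>)\<^sup>2 + 2 * e\<^sup>2"
      using sum_squares_ge_zero zero_le_power2[of "noise n b y \<omega> - e"]
      by (simp add: power2_sum power2_diff)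
    then show "(ecdf n b (y (X \<omega>)) \<omega> - cdf (K (X \<omega>)) (y (X \<omega>)))\<^sup>2 \<le>
       2 * (noise n b y \<omega>)\<^sup>2 + 2 * C * (\<Sum>m\<in>UNIV. leaf_width n b m \<omega>)"
      using e2 split unfolding F_def w_def by simp
  qed
qed

lemma rv_noise:
  assumes b: "b < B" and [measurable]: "y \<in> borel_measurable borel"
  shows "noise n b y \<in> borel_measurable M"
  unfolding noise_def
proof (intro borel_measurable_sum borel_measurable_times borel_measurable_diff)
  fix i assume "i \<in> {..<n}"
  then show "(\<lambda>\<omega>. wt n b \<omega> i) \<in> borel_measurable M" by (intro rv_wt b) simp
  show "(\<lambda>\<omega>. indicator {..y (X \<omega>)} (Ys i \<omega>) :: real) \<in> borel_measurable M"
    unfolding indicator_def of_bool_def atMost_iff by measurable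
  show "(\<lambda>\<omega>. cdf (K (Xs i \<omega>)) (y (X \<omega>))) \<in> borel_measurable M"
    by (intro cdf_K_measurable2) measurable
qed

lemma ecdf_consistent:
  assumes b: "b < B" and y [measurable]: "y \<in> borel_measurable borel"
  shows "(\<lambda>n. \<integral>\<^sup>+\<omega>. ennreal ((ecdf n b (y (X \<omega>)) \<omega> - cdf (K (X \<omega>)) (y (X \<omega>)))\<^sup>2) \<partial>M) \<longlonglongrightarrow> 0"
proof -
  let ?I = "\<lambda>n. \<integral>\<^sup>+\<omega>. ennreal (1 / real (count n b \<omega> (leaf n b \<omega>))) \<partial>M"
  let ?W = "\<lambda>n m. \<integral>\<^sup>+\<omega>. ennreal (leaf_width n b m \<omega>) \<partial>M"
  let ?E = "\<lambda>n. \<integral>\<^sup>+\<omega>. ennreal ((ecdf n b (y (X \<omega>)) \<omega> - cdf (K (X \<omega>)) (y (X \<omega>)))\<^sup>2) \<partial>M"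
  have bound: "?E n \<le> 2 * ?I n + ennreal (2 * C) * (\<Sum>m\<in>UNIV. ?W n m)" if n: "0 < n" for n
  proof -
    note [measurable] = rv_noise[OF b y, of n] rv_leaf_width[OF b, of n]
    have "?E n \<le> (\<integral>\<^sup>+\<omega>. 2 * ennreal ((noise n b y \<omega>)\<^sup>2) +
        ennreal (2 * C) * (\<Sum>m\<in>UNIV. ennreal (leaf_width n b m \<omega>)) \<partial>M)"
    proof (rule nn_integral_mono_AE)
      show "AE \<omega> in M. ennreal ((ecdf n b (y (X \<omega>)) \<omega> - cdf (K (X \<omega>)) (y (X \<omega>)))\<^sup>2) \<le>
         2 * ennreal ((noise n b y \<omega>)\<^sup>2) + ennreal (2 * C) * (\<Sum>m\<in>UNIV. ennreal (leaf_width n b m \<omega>))"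
        using AE_ecdf_error[of y]
      proof eventually_elim
        case (elim \<omega>)
        have "ennreal ((ecdf n b (y (X \<omega>)) \<omega> - cdf (K (X \<omega>)) (y (X \<omega>)))\<^sup>2) \<le>
            ennreal (2 * (noise n b y \<omega>)\<^sup>2 + 2 * C * (\<Sum>m\<in>UNIV. leaf_width n b m \<omega>))"
          using elim n b by (intro ennreal_leI) blast
        also have "\<dots> = ennreal (2 * (noise n b y \<omega>)\<^sup>2) + ennreal (2 * C * (\<Sum>m\<in>UNIV. leaf_width n b m \<omega>))"
          using leaf_width_bounds lipschitz(1) by (intro ennreal_plus) (auto intro!: mult_nonneg_nonneg sum_nonneg)
        also have "ennreal (2 * (noise n b y \<omega>)\<^sup>2) = 2 * ennreal ((noise n b y \<omega>)\<^sup>2)"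
          by (subst ennreal_mult) auto
        also have "ennreal (2 * C * (\<Sum>m\<in>UNIV. leaf_width n b m \<omega>)) =
            ennreal (2 * C) * (\<Sum>m\<in>UNIV. ennreal (leaf_width n b m \<omega>))"
          using leaf_width_bounds lipschitz(1)
          by (subst sum_ennreal) (auto intro!: ennreal_mult sum_nonneg)
        finally show ?case .
      qed
    qed
    also have "\<dots> = 2 * (\<integral>\<^sup>+\<omega>. ennreal ((noise n b y \<omega>)\<^sup>2) \<partial>M) + ennreal (2 * C) * (\<Sum>m\<in>UNIV. ?W n m)"
      by (subst nn_integral_add) (auto simp: nn_integral_cmult nn_integral_sum)
    also have "\<dots> \<le> 2 * ?I n + ennreal (2 * C) * (\<Sum>m\<in>UNIV. ?W n m)"
      by (intro add_right_mono mult_left_mono nn_integral_noise n b y) simp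
    finally show ?thesis .
  qed
  have "(\<lambda>n. 2 * ?I n + ennreal (2 * C) * (\<Sum>m\<in>UNIV. ?W n m)) \<longlonglongrightarrow> 2 * 0 + ennreal (2 * C) * (\<Sum>m\<in>(UNIV :: 'v set). 0)"
    by (intro tendsto_add ennreal_tendsto_cmult tendsto_sum inverse_count_tendsto_0 leaf_width_tendsto_0 b) auto
  then have lim: "(\<lambda>n. 2 * ?I n + ennreal (2 * C) * (\<Sum>m\<in>UNIV. ?W n m)) \<longlonglongrightarrow> 0" by simp
  show ?thesis
  proof (rule tendsto_sandwich[OF _ _ tendsto_const lim])
    show "\<forall>\<^sub>F n in sequentially. ?E n \<le> 2 * ?I n + ennreal (2 * C) * (\<Sum>m\<in>UNIV. ?W n m)"
      using eventually_gt_at_top[of 0] by eventually_elim (rule bound)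
  qed simp
qed

section \<open>From single trees to the forest\<close>

definition fcdf :: "nat \<Rightarrow> real \<Rightarrow> 'a \<Rightarrow> real" where
  "fcdf n y \<omega> = (\<Sum>i<n. forest_weight n (\<lambda>i. Xs i \<omega>) B (\<lambda>b. T n b \<omega>) (X \<omega>) i * indicator {..y} (Ys i \<omega>))"

lemma fcdf_eq: "fcdf n y \<omega> = (\<Sum>b<B. ecdf n b y \<omega>) / real B"
proof -
  have "(\<Sum>b<B. ecdf n b y \<omega>) = (\<Sum>i<n. (\<Sum>b<B. wt n b \<omega> i) * indicator {..y} (Ys i \<omega>))"
    unfolding ecdf_def by (subst sum.swap) (simp add: sum_distrib_right)
  then show ?thesis
    unfolding fcdf_def forest_weight_def by (simp add: sum_divide_distrib)
qed

lemma rv_fcdf: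
  assumes "z \<in> borel_measurable M"
  shows "(\<lambda>\<omega>. fcdf n (z \<omega>) \<omega>) \<in> borel_measurable M"
  unfolding fcdf_eq using assms by (intro borel_measurable_divide borel_measurable_sum rv_ecdf) auto

text \<open>Trees grown from one sample may depend on each other. Cauchy-Schwarz bounds the squared
  error of the average by the sum of the squared errors, and the number of trees is fixed.\<close>

lemma fcdf_consistent:
  assumes B: "0 < B" and y [measurable]: "y \<in> borel_measurable borel"
  shows "(\<lambda>n. \<integral>\<^sup>+\<omega>. ennreal ((fcdf n (y (X \<omega>)) \<omega> - cdf (K (X \<omega>)) (y (X \<omega>)))\<^sup>2) \<partial>M) \<longlonglongrightarrow> 0"
proof -
  let ?a = "\<lambda>n b \<omega>. ecdf n b (y (X \<omega>)) \<omega> - cdf (K (X \<omega>)) (y (X \<omega>))"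
  have [measurable]: "(\<lambda>\<omega>. cdf (K (X \<omega>)) (y (X \<omega>))) \<in> borel_measurable M"
    by (intro cdf_K_measurable2) measurable
  have [measurable]: "(\<lambda>\<omega>. ?a n b \<omega>) \<in> borel_measurable M" if "b < B" for n b
    using rv_ecdf[OF that, of "\<lambda>\<omega>. y (X \<omega>)" n] by measurable
  have le: "(fcdf n (y (X \<omega>)) \<omega> - cdf (K (X \<omega>)) (y (X \<omega>)))\<^sup>2 \<le> (\<Sum>b<B. (?a n b \<omega>)\<^sup>2)" for n \<omega>
  proof -
    have "fcdf n (y (X \<omega>)) \<omega> - cdf (K (X \<omega>)) (y (X \<omega>)) = (\<Sum>b<B. ?a n b \<omega>) / real B"
      using B by (simp add: fcdf_eq sum_subtractf field_simps)
    then have "(fcdf n (y (X \<omega>)) \<omega> - cdf (K (X \<omega>)) (y (X \<omega>)))\<^sup>2 = (\<Sum>b<B. ?a n b \<omega>)\<^sup>2 / (real B)\<^sup>2"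
      by (simp add: power_divide)
    also have "\<dots> \<le> ((\<Sum>b<B. (?a n b \<omega>)\<^sup>2) * real (card {..<B})) / (real B)\<^sup>2"
      by (intro divide_right_mono sum_squared_le_sum_of_squares) simp
    also have "\<dots> = (\<Sum>b<B. (?a n b \<omega>)\<^sup>2) / real B" using B by (simp add: power2_eq_square)
    also have "\<dots> \<le> (\<Sum>b<B. (?a n b \<omega>)\<^sup>2) / 1"
      using B by (intro divide_left_mono) (auto intro!: sum_nonneg)
    finally show ?thesis by simp
  qed
  have "(\<integral>\<^sup>+\<omega>. ennreal ((fcdf n (y (X \<omega>)) \<omega> - cdf (K (X \<omega>)) (y (X \<omega>)))\<^sup>2) \<partial>M) \<le>
      (\<Sum>b<B. \<integral>\<^sup>+\<omega>. ennreal ((?a n b \<omega>)\<^sup>2) \<partial>M)" (is "?L n \<le> ?R n") for n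
  proof -
    have "(\<integral>\<^sup>+\<omega>. ennreal ((fcdf n (y (X \<omega>)) \<omega> - cdf (K (X \<omega>)) (y (X \<omega>)))\<^sup>2) \<partial>M) \<le>
        (\<integral>\<^sup>+\<omega>. (\<Sum>b<B. ennreal ((?a n b \<omega>)\<^sup>2)) \<partial>M)"
      using le by (intro nn_integral_mono) (simp add: ennreal_leI)
    also have "\<dots> = (\<Sum>b<B. \<integral>\<^sup>+\<omega>. ennreal ((?a n b \<omega>)\<^sup>2) \<partial>M)"
      by (intro nn_integral_sum) auto
    finally show ?thesis .
  qed
  then have bound: "\<forall>\<^sub>F n in sequentially. ?L n \<le> ?R n" by (rule always_eventually[OF allI])
  have "(\<lambda>n. ?R n) \<longlonglongrightarrow> (\<Sum>b<B. 0)"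
    by (intro tendsto_sum ecdf_consistent y) simp
  then have lim: "(\<lambda>n. ?R n) \<longlonglongrightarrow> 0" by simp
  show ?thesis
    by (rule tendsto_sandwich[OF _ bound tendsto_const lim]) simp
qed

end

section \<open>Consistency of the estimated quantile\<close>

context regression_forest begin

section \<open>Conditional quantiles\<close>

lemma real_distribution_K: "real_distribution (K x)"
proof -
  interpret Kx: prob_space "K x" by (rule K_prob)
  show ?thesis using sets_eq_imp_space_eq[OF K_sets, of x] by unfold_locales (simp_all add: K_sets)
qed

lemma mono_cdf_K: "mono (cdf (K x))"
proof -
  interpret Kx: real_distribution "K x" by (rule real_distribution_K)
  show ?thesis by (intro monoI Kx.cdf_nondecreasing)
qed

lemma cdf_K_unbounded:
  assumes "0 < \<alpha>" "\<alpha> < 1"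
  shows "\<exists>z. cdf (K x) z < \<alpha>" "\<exists>z. \<alpha> \<le> cdf (K x) z"
proof -
  interpret Kx: real_distribution "K x" by (rule real_distribution_K)
  show "\<exists>z. cdf (K x) z < \<alpha>"
    using order_tendstoD(2)[OF Kx.cdf_lim_neg_infty assms(1)] by (auto simp: eventually_sequentially)
  show "\<exists>z. \<alpha> \<le> cdf (K x) z"
    using order_tendstoD(1)[OF Kx.cdf_lim_infty_prob assms(2)]
    by (auto simp: eventually_sequentially intro: less_imp_le)
qed

lemma cdf_K_cond_quantile:
  assumes "0 < \<alpha>" "\<alpha> < 1"
  shows "\<alpha> \<le> cdf (K x) (cond_quantile K \<alpha> x)"
  using cdf_K_unbounded(2)[OF assms, of x] real_distribution.cdf_generalized_inverse_ge[OF real_distribution_K]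
  unfolding cond_quantile_def by blast

text \<open>The Galois property of the quantile; right continuity gives the forward direction. It
  yields measurability and the lower gap at the quantile.\<close>

lemma cond_quantile_le_iff:
  assumes "0 < \<alpha>" "\<alpha> < 1"
  shows "cond_quantile K \<alpha> x \<le> y \<longleftrightarrow> \<alpha> \<le> cdf (K x) y"
proof
  assume "cond_quantile K \<alpha> x \<le> y"
  then show "\<alpha> \<le> cdf (K x) y"
    using cdf_K_cond_quantile[OF assms, of x] monoD[OF mono_cdf_K, of "cond_quantile K \<alpha> x" y x]
    by linarith
next
  assume "\<alpha> \<le> cdf (K x) y"
  then show "cond_quantile K \<alpha> x \<le> y"
    using cdf_K_unbounded(1)[OF assms, of x] generalized_inverse_le[OF mono_cdf_K]
    unfolding cond_quantile_def by blast
qed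

lemma measurable_cond_quantile:
  assumes "0 < \<alpha>" "\<alpha> < 1"
  shows "cond_quantile K \<alpha> \<in> borel_measurable borel"
proof (rule borel_measurableI_le)
  fix y
  have "(\<lambda>x. cdf (K x) y) \<in> borel_measurable borel" by (intro cdf_K_measurable2) measurable
  then show "{x \<in> space borel. cond_quantile K \<alpha> x \<le> y} \<in> sets borel"
    unfolding cond_quantile_le_iff[OF assms] by measurable
qed

text \<open>Markov's inequality for \<open>K x\<close> supplies the two tail bounds that
  \<open>generalized_inverse_moment\<close> asks for.\<close>

lemma cond_quantile_moment:
  assumes \<alpha>: "0 < \<alpha>" "\<alpha> < 1" and q: "0 < q" and M: "0 \<le> M\<^sub>0"
    and mom: "(\<integral>\<^sup>+y. ennreal (\<bar>y\<bar> powr q) \<partial>K x) \<le> ennreal M\<^sub>0"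
  shows "\<bar>cond_quantile K \<alpha> x\<bar> powr q \<le> 2 powr q / min \<alpha> (1 - \<alpha>) * M\<^sub>0"
proof -
  interpret Kx: real_distribution "K x" by (rule real_distribution_K)
  have tail: "measure (K x) A * t powr q \<le> M\<^sub>0"
    if A: "A \<in> sets borel" "\<And>y. y \<in> A \<Longrightarrow> t \<le> \<bar>y\<bar>" and t: "0 < t" for A t
  proof -
    have "ennreal (measure (K x) A * t powr q) = ennreal (t powr q) * emeasure (K x) A"
      by (simp add: Kx.emeasure_eq_measure ennreal_mult mult.commute)
    also have "\<dots> = (\<integral>\<^sup>+y. ennreal (t powr q) * indicator A y \<partial>K x)"
      using A by (intro nn_integral_cmult_indicator[symmetric]) simp
    also have "\<dots> \<le> (\<integral>\<^sup>+y. ennreal (\<bar>y\<bar> powr q) \<partial>K x)"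
      using A(2) t q by (intro nn_integral_mono) (auto simp: indicator_def intro!: ennreal_leI powr_mono2)
    also have "\<dots> \<le> ennreal M\<^sub>0" by (rule mom)
    finally show ?thesis using M by (simp add: ennreal_le_iff)
  qed
  obtain z z' where z: "cdf (K x) z < \<alpha>" "\<alpha> \<le> cdf (K x) z'"
    using cdf_K_unbounded[OF \<alpha>, of x] by blast
  show ?thesis
    unfolding cond_quantile_def
  proof (rule generalized_inverse_moment[OF mono_cdf_K z \<alpha> q M])
    fix t :: real assume t: "0 < t"
    have "1 - cdf (K x) t = measure (K x) {t<..}"
      using Kx.prob_compl[of "{..t}"] by (simp add: cdf_def Compl_eq_Diff_UNIV[symmetric] Compl_atMost)
    then show "(1 - cdf (K x) t) * t powr q \<le> M\<^sub>0"
      using tail[of "{t<..}" t] t by auto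
    show "cdf (K x) (- t) * t powr q \<le> M\<^sub>0"
      unfolding cdf_def using tail[of "{..- t}" t] t by auto
  qed
qed

section \<open>Estimated quantiles and their moments\<close>

lemma qrf_eq: "qrf \<alpha> n (\<lambda>i. Xs i \<omega>) (\<lambda>i. Ys i \<omega>) B (\<lambda>b. T n b \<omega>) (X \<omega>) = Inf {y. \<alpha> \<le> fcdf n y \<omega>}"
  by (simp add: qrf_def fcdf_def)

abbreviation fw :: "nat \<Rightarrow> 'a \<Rightarrow> nat \<Rightarrow> real" where
  "fw n \<omega> i \<equiv> forest_weight n (\<lambda>i. Xs i \<omega>) B (\<lambda>b. T n b \<omega>) (X \<omega>) i"

lemma fw_nonneg: "0 \<le> fw n \<omega> i"
  unfolding forest_weight_def by (intro mult_nonneg_nonneg sum_nonneg tree_weight_bounds) simp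

lemma mono_fcdf: "mono (\<lambda>y. fcdf n y \<omega>)"
  unfolding fcdf_def
  by (intro monoI sum_mono mult_left_mono fw_nonneg) (auto simp: indicator_def)

lemma AE_sum_fw:
  assumes B: "0 < B"
  shows "AE \<omega> in M. \<forall>n>0. (\<Sum>i<n. fw n \<omega> i) = 1"
  using AE_count_pos
proof eventually_elim
  case (elim \<omega>)
  have "(\<Sum>i<n. fw n \<omega> i) = 1" if n: "0 < n" for n
  proof -
    have "(\<Sum>i<n. fw n \<omega> i) = (\<Sum>b<B. \<Sum>i<n. wt n b \<omega> i) / real B"
      unfolding forest_weight_def by (subst sum.swap) (simp add: sum_divide_distrib)
    also have "(\<Sum>b<B. \<Sum>i<n. wt n b \<omega> i) = (\<Sum>b<B. 1)"
      using elim n by (intro sum.cong sum_tree_weight) auto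
    finally show ?thesis using B by simp
  qed
  then show ?case by blast
qed

text \<open>The weighted empirical law of the responses plays the part of \<open>K x\<close>: its
  tails satisfy Markov's inequality with the weighted moment as bound.\<close>

lemma qrf_moment:
  assumes \<alpha>: "0 < \<alpha>" "\<alpha> < 1" and q: "0 < q" and sum1: "(\<Sum>i<n. fw n \<omega> i) = 1"
  shows "\<bar>Inf {y. \<alpha> \<le> fcdf n y \<omega>}\<bar> powr q \<le> 2 powr q / min \<alpha> (1 - \<alpha>) * (\<Sum>i<n. fw n \<omega> i * \<bar>Ys i \<omega>\<bar> powr q)"
proof (rule generalized_inverse_moment[OF mono_fcdf _ _ \<alpha> q])
  \<comment> \<open>Every response has absolute value strictly below \<open>m\<close>, owing to the
    added 1, so \<open>fcdf\<close> is 0 at \<open>- m\<close> and 1 at \<open>m\<close>.\<close>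
  define m where "m = (\<Sum>i<n. \<bar>Ys i \<omega>\<bar>) + 1"
  have m: "\<bar>Ys i \<omega>\<bar> < m" if "i < n" for i
    using member_le_sum[of i "{..<n}" "\<lambda>i. \<bar>Ys i \<omega>\<bar>"] that by (simp add: m_def)
  have "fcdf n (- m) \<omega> = (\<Sum>i<n. 0)"
    unfolding fcdf_def using m by (intro sum.cong) (fastforce simp: indicator_def)+
  then show "fcdf n (- m) \<omega> < \<alpha>" using \<alpha> by simp
  have "fcdf n m \<omega> = (\<Sum>i<n. fw n \<omega> i)"
    unfolding fcdf_def using m by (intro sum.cong) (fastforce simp: indicator_def)+
  then show "\<alpha> \<le> fcdf n m \<omega>" using \<alpha> sum1 by simp
  show "0 \<le> (\<Sum>i<n. fw n \<omega> i * \<bar>Ys i \<omega>\<bar> powr q)"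
    by (intro sum_nonneg mult_nonneg_nonneg fw_nonneg) simp
  fix t :: real assume t: "0 < t"
  have "1 - fcdf n t \<omega> = (\<Sum>i<n. fw n \<omega> i - fw n \<omega> i * indicator {..t} (Ys i \<omega>))"
    by (simp add: fcdf_def sum_subtractf sum1)
  then have "(1 - fcdf n t \<omega>) * t powr q = (\<Sum>i<n. fw n \<omega> i * (if t < Ys i \<omega> then t powr q else 0))"
    by (simp only: sum_distrib_right) (intro sum.cong refl, auto simp: indicator_def)
  also have "\<dots> \<le> (\<Sum>i<n. fw n \<omega> i * \<bar>Ys i \<omega>\<bar> powr q)"
    using t q by (intro sum_mono mult_left_mono fw_nonneg) (auto intro!: powr_mono2)
  finally show "(1 - fcdf n t \<omega>) * t powr q \<le> (\<Sum>i<n. fw n \<omega> i * \<bar>Ys i \<omega>\<bar> powr q)" .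
  have "fcdf n (- t) \<omega> * t powr q = (\<Sum>i<n. fw n \<omega> i * (if Ys i \<omega> \<le> - t then t powr q else 0))"
    by (simp only: fcdf_def sum_distrib_right) (intro sum.cong refl, auto simp: indicator_def)
  also have "\<dots> \<le> (\<Sum>i<n. fw n \<omega> i * \<bar>Ys i \<omega>\<bar> powr q)"
    using t q by (intro sum_mono mult_left_mono fw_nonneg) (auto intro!: powr_mono2)
  finally show "fcdf n (- t) \<omega> * t powr q \<le> (\<Sum>i<n. fw n \<omega> i * \<bar>Ys i \<omega>\<bar> powr q)" .
qed

lemma rv_fw: "i < n \<Longrightarrow> (\<lambda>\<omega>. fw n \<omega> i) \<in> borel_measurable M"
  unfolding forest_weight_def
  by (intro borel_measurable_times borel_measurable_const borel_measurable_sum rv_wt) auto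

text \<open>After the responses of a tree have been averaged over their conditional laws, a convex
  combination of conditional moments at points of the support remains, and each of these is at most
  \<open>M\<^sub>0\<close>.\<close>

lemma nn_integral_forest_moment:
  assumes B: "0 < B" and n: "0 < n"
    and mom: "\<And>x. x \<in> \<X> \<Longrightarrow> (\<integral>\<^sup>+y. ennreal (\<bar>y\<bar> powr q) \<partial>K x) \<le> ennreal M\<^sub>0"
  shows "(\<integral>\<^sup>+\<omega>. ennreal (\<Sum>i<n. fw n \<omega> i * \<bar>Ys i \<omega>\<bar> powr q) \<partial>M) \<le> ennreal M\<^sub>0"
proof -
  define \<phi> where "\<phi> y = ennreal (\<bar>y\<bar> powr q)" for y :: real
  have \<phi> [measurable]: "\<phi> \<in> borel_measurable borel" unfolding \<phi>_def by measurable
  have tree: "(\<integral>\<^sup>+\<omega>. (\<Sum>i<n. ennreal (wt n b \<omega> i) * \<phi> (Ys i \<omega>)) \<partial>M) \<le> ennreal M\<^sub>0" if b: "b < B" for b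
  proof -
    have "(\<integral>\<^sup>+\<omega>. (\<Sum>i<n. ennreal (wt n b \<omega> i) * \<phi> (Ys i \<omega>)) \<partial>M) =
        (\<integral>\<^sup>+\<omega>. (\<Sum>i<n. ennreal (wt n b \<omega> i) * (\<integral>\<^sup>+y. \<phi> y \<partial>K (Xs i \<omega>))) \<partial>M)"
      by (rule nn_integral_weighted_response[OF n b \<phi>])
    also have "\<dots> \<le> (\<integral>\<^sup>+\<omega>. ennreal M\<^sub>0 \<partial>M)"
    proof (rule nn_integral_mono_AE)
      show "AE \<omega> in M. (\<Sum>i<n. ennreal (wt n b \<omega> i) * (\<integral>\<^sup>+y. \<phi> y \<partial>K (Xs i \<omega>))) \<le> ennreal M\<^sub>0"
        using AE_Xs AE_count_pos
      proof eventually_elim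
        case (elim \<omega>)
        have "(\<Sum>i<n. ennreal (wt n b \<omega> i) * (\<integral>\<^sup>+y. \<phi> y \<partial>K (Xs i \<omega>))) \<le>
            (\<Sum>i<n. ennreal (wt n b \<omega> i) * ennreal M\<^sub>0)"
          using elim(1) mom by (intro sum_mono mult_left_mono) (auto simp: \<phi>_def)
        also have "\<dots> = ennreal (\<Sum>i<n. wt n b \<omega> i) * ennreal M\<^sub>0"
          by (simp add: sum_distrib_right[symmetric] sum_ennreal tree_weight_bounds)
        also have "(\<Sum>i<n. wt n b \<omega> i) = 1"
          using elim(2) n b by (intro sum_tree_weight) blast
        finally show ?case by simp
      qed
    qed
    finally show ?thesis by (simp add: emeasure_space_1)
  qed
  have eq: "ennreal (\<Sum>i<n. fw n \<omega> i * \<bar>Ys i \<omega>\<bar> powr q) =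
      ennreal (1 / real B) * (\<Sum>b<B. \<Sum>i<n. ennreal (wt n b \<omega> i) * \<phi> (Ys i \<omega>))" for \<omega>
  proof -
    have "(\<Sum>i<n. fw n \<omega> i * \<bar>Ys i \<omega>\<bar> powr q) = 1 / real B * (\<Sum>b<B. \<Sum>i<n. wt n b \<omega> i * \<bar>Ys i \<omega>\<bar> powr q)"
      unfolding forest_weight_def
      by (subst sum.swap) (simp add: sum_divide_distrib sum_distrib_right)
    also have "ennreal \<dots> = ennreal (1 / real B) * ennreal (\<Sum>b<B. \<Sum>i<n. wt n b \<omega> i * \<bar>Ys i \<omega>\<bar> powr q)"
      by (intro ennreal_mult) (auto intro!: sum_nonneg mult_nonneg_nonneg tree_weight_bounds)
    also have "ennreal (\<Sum>b<B. \<Sum>i<n. wt n b \<omega> i * \<bar>Ys i \<omega>\<bar> powr q) =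
        (\<Sum>b<B. \<Sum>i<n. ennreal (wt n b \<omega> i * \<bar>Ys i \<omega>\<bar> powr q))"
      by (subst sum_ennreal[symmetric])
        (auto intro!: sum_nonneg mult_nonneg_nonneg tree_weight_bounds sum.cong sum_ennreal[symmetric] simp del: sum_ennreal)
    finally show ?thesis by (simp add: \<phi>_def ennreal_mult tree_weight_bounds)
  qed
  have meas: "(\<lambda>\<omega>. \<Sum>i<n. ennreal (wt n b \<omega> i) * \<phi> (Ys i \<omega>)) \<in> borel_measurable M" if "b < B" for b
  proof (intro borel_measurable_sum)
    fix i assume "i \<in> {..<n}"
    then have "(\<lambda>\<omega>. wt n b \<omega> i) \<in> borel_measurable M" by (intro rv_wt that) simp
    then show "(\<lambda>\<omega>. ennreal (wt n b \<omega> i) * \<phi> (Ys i \<omega>)) \<in> borel_measurable M" by measurable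
  qed
  have swap: "(\<integral>\<^sup>+\<omega>. (\<Sum>b<B. \<Sum>i<n. ennreal (wt n b \<omega> i) * \<phi> (Ys i \<omega>)) \<partial>M) =
      (\<Sum>b<B. \<integral>\<^sup>+\<omega>. (\<Sum>i<n. ennreal (wt n b \<omega> i) * \<phi> (Ys i \<omega>)) \<partial>M)"
    by (rule nn_integral_sum, rule meas, simp)
  have meas': "(\<lambda>\<omega>. \<Sum>b<B. \<Sum>i<n. ennreal (wt n b \<omega> i) * \<phi> (Ys i \<omega>)) \<in> borel_measurable M"
    by (rule borel_measurable_sum, rule meas, simp)
  have "(\<integral>\<^sup>+\<omega>. ennreal (\<Sum>i<n. fw n \<omega> i * \<bar>Ys i \<omega>\<bar> powr q) \<partial>M) =
      ennreal (1 / real B) * (\<Sum>b<B. \<integral>\<^sup>+\<omega>. (\<Sum>i<n. ennreal (wt n b \<omega> i) * \<phi> (Ys i \<omega>)) \<partial>M)"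
    unfolding eq swap[symmetric] by (rule nn_integral_cmult[OF meas'])
  also have "\<dots> \<le> ennreal (1 / real B) * (\<Sum>b<B. ennreal M\<^sub>0)"
    by (intro mult_left_mono sum_mono tree) auto
  also have "\<dots> = ennreal (1 / real B) * ennreal (real B) * ennreal M\<^sub>0"
    by (simp add: ennreal_of_nat_eq_real_of_nat mult.assoc)
  also have "\<dots> = ennreal M\<^sub>0"
    using B by (simp add: ennreal_mult[symmetric])
  finally show ?thesis .
qed

text \<open>Outside these events the estimated distribution function at
  \<open>y (X \<omega>)\<close> lies on the same side of \<open>\<alpha>\<close> as the true one.
  Squares are compared so that the mean square consistency applies directly.\<close>

lemma prob_cdf_gap:
  assumes B: "0 < B" and y [measurable]: "y \<in> borel_measurable borel"
    and gap: "\<And>x. x \<in> \<X> \<Longrightarrow> cdf (K x) (y x) \<noteq> \<alpha>"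
  shows "(\<lambda>n. prob {\<omega> \<in> space M. (cdf (K (X \<omega>)) (y (X \<omega>)) - \<alpha>)\<^sup>2 \<le>
      (fcdf n (y (X \<omega>)) \<omega> - cdf (K (X \<omega>)) (y (X \<omega>)))\<^sup>2}) \<longlonglongrightarrow> 0"
proof (rule prob_ge_tendsto_0)
  have [measurable]: "(\<lambda>\<omega>. cdf (K (X \<omega>)) (y (X \<omega>))) \<in> borel_measurable M"
    by (intro cdf_K_measurable2) measurable
  have [measurable]: "(\<lambda>\<omega>. fcdf n (y (X \<omega>)) \<omega>) \<in> borel_measurable M" for n
    by (intro rv_fcdf) measurable
  show "(\<lambda>\<omega>. (fcdf n (y (X \<omega>)) \<omega> - cdf (K (X \<omega>)) (y (X \<omega>)))\<^sup>2) \<in> borel_measurable M" for n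
    by measurable
  show "(\<lambda>\<omega>. (cdf (K (X \<omega>)) (y (X \<omega>)) - \<alpha>)\<^sup>2) \<in> borel_measurable M" by measurable
  show "AE \<omega> in M. 0 < (cdf (K (X \<omega>)) (y (X \<omega>)) - \<alpha>)\<^sup>2"
    using AE_X by eventually_elim (use gap in simp)
qed (rule fcdf_consistent[OF B y])

text \<open>Above the quantile the strict inequality comes from strict monotonicity, below it from
  minimality of the quantile.\<close>

lemma cond_quantile_gap:
  assumes \<alpha>: "0 < \<alpha>" "\<alpha> < 1" and inc: "strict_mono (cdf (K x))" and "0 < \<epsilon>"
  shows "\<alpha> < cdf (K x) (cond_quantile K \<alpha> x + \<epsilon>)" "cdf (K x) (cond_quantile K \<alpha> x - \<epsilon>) < \<alpha>"
proof -
  have "cdf (K x) (cond_quantile K \<alpha> x) < cdf (K x) (cond_quantile K \<alpha> x + \<epsilon>)"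
    using \<open>0 < \<epsilon>\<close> by (intro strict_monoD[OF inc]) simp
  then show "\<alpha> < cdf (K x) (cond_quantile K \<alpha> x + \<epsilon>)"
    using cdf_K_cond_quantile[OF \<alpha>, of x] by linarith
  show "cdf (K x) (cond_quantile K \<alpha> x - \<epsilon>) < \<alpha>"
    using cond_quantile_le_iff[OF \<alpha>, of x "cond_quantile K \<alpha> x - \<epsilon>"] \<open>0 < \<epsilon>\<close> by auto
qed

text \<open>Where the estimated distribution function is on the right side of
  \<open>\<alpha>\<close> at both shifted quantiles, the error is at most \<open>\<epsilon>\<close>.
  Elsewhere it is unbounded, so it is truncated at \<open>L\<close>, and the part above
  \<open>L\<close> is paid by the weighted moment \<open>Z\<close>.\<close>

theorem qrf_mean_square_consistent:
  assumes \<alpha>: "0 < \<alpha>" "\<alpha> < 1" and B: "0 < B"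
    and inc: "\<And>x. x \<in> \<X> \<Longrightarrow> strict_mono (cdf (K x))"
    and \<delta>: "0 < \<delta>"
    and mom: "\<And>x. x \<in> \<X> \<Longrightarrow> (\<integral>\<^sup>+y. ennreal (\<bar>y\<bar> powr (2 + \<delta>)) \<partial>K x) \<le> ennreal M\<^sub>0"
  shows "(\<lambda>n. \<integral>\<^sup>+\<omega>. ennreal ((qrf \<alpha> n (\<lambda>i. Xs i \<omega>) (\<lambda>i. Ys i \<omega>) B (\<lambda>b. T n b \<omega>) (X \<omega>)
            - cond_quantile K \<alpha> (X \<omega>))\<^sup>2) \<partial>M) \<longlonglongrightarrow> 0"
proof -
  define v where "v = cond_quantile K \<alpha>"
  define Q where "Q n \<omega> = Inf {y. \<alpha> \<le> fcdf n y \<omega>}" for n \<omega>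
  define q where "q = 2 + \<delta>"
  \<comment> \<open>A negative \<open>M\<^sub>0\<close> is read as 0 by \<open>ennreal\<close>; the
    maximum makes this explicit for the real estimates.\<close>
  define M\<^sub>1 where "M\<^sub>1 = max 0 M\<^sub>0"
  define c where "c = 2 powr q / min \<alpha> (1 - \<alpha>)"
  define Z where "Z n \<omega> = (\<Sum>i<n. fw n \<omega> i * \<bar>Ys i \<omega>\<bar> powr q)" for n \<omega>
  have q: "0 < q" using \<delta> by (simp add: q_def)
  have c: "0 < c" using \<alpha> by (simp add: c_def)
  have M1: "0 \<le> M\<^sub>1" by (simp add: M\<^sub>1_def)
  have mom1: "(\<integral>\<^sup>+y. ennreal (\<bar>y\<bar> powr q) \<partial>K x) \<le> ennreal M\<^sub>1" if "x \<in> \<X>" for x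
    using mom[OF that] unfolding q_def M\<^sub>1_def by (rule order_trans) (simp add: ennreal_leI)
  have v_meas [measurable]: "v \<in> borel_measurable borel"
    unfolding v_def by (rule measurable_cond_quantile[OF \<alpha>])
  \<comment> \<open>Truncation at level 1 bounds the true quantile uniformly on the support.\<close>
  have v2: "(v x)\<^sup>2 \<le> 1 + c * M\<^sub>1" if x: "x \<in> \<X>" for x
  proof -
    have "(v x)\<^sup>2 \<le> 1\<^sup>2 + 1 powr (- \<delta>) * \<bar>v x\<bar> powr (2 + \<delta>)"
      by (rule abs_square_le_powr) (use \<delta> in auto)
    moreover have "\<bar>v x\<bar> powr q \<le> c * M\<^sub>1"
      unfolding v_def c_def by (rule cond_quantile_moment[OF \<alpha> q M1 mom1[OF x]])
    ultimately show ?thesis by (simp add: q_def)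
  qed
  have Z_meas [measurable]: "Z n \<in> borel_measurable M" for n
    unfolding Z_def using rv_fw by (intro borel_measurable_sum borel_measurable_times) auto
  have Z0: "0 \<le> Z n \<omega>" for n \<omega>
    unfolding Z_def by (intro sum_nonneg mult_nonneg_nonneg fw_nonneg) simp
  have EZ: "(\<integral>\<^sup>+\<omega>. ennreal (Z n \<omega>) \<partial>M) \<le> ennreal M\<^sub>1" if "0 < n" for n
    unfolding Z_def by (rule nn_integral_forest_moment[OF B that mom1])
  \<comment> \<open>At the level \<open>v (X \<omega>) + \<epsilon>\<close> the estimate errs by at
    least the distance of the true value from \<open>\<alpha>\<close>. Both signs of
    \<open>\<epsilon>\<close> are used.\<close>
  define bad where "bad \<epsilon> n = {\<omega> \<in> space M. (cdf (K (X \<omega>)) (v (X \<omega>) + \<epsilon>) - \<alpha>)\<^sup>2 \<le>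
      (fcdf n (v (X \<omega>) + \<epsilon>) \<omega> - cdf (K (X \<omega>)) (v (X \<omega>) + \<epsilon>))\<^sup>2}" for \<epsilon> n
  have bad_meas [measurable]: "bad \<epsilon> n \<in> sets M" for \<epsilon> n
  proof -
    have [measurable]: "(\<lambda>\<omega>. cdf (K (X \<omega>)) (v (X \<omega>) + \<epsilon>)) \<in> borel_measurable M"
      by (intro cdf_K_measurable2) measurable
    have [measurable]: "(\<lambda>\<omega>. fcdf n (v (X \<omega>) + \<epsilon>) \<omega>) \<in> borel_measurable M"
      by (intro rv_fcdf) measurable
    show ?thesis unfolding bad_def by measurable
  qed
  have bad_prob: "(\<lambda>n. prob (bad \<epsilon> n)) \<longlonglongrightarrow> 0" if "\<epsilon> \<noteq> 0" for \<epsilon>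
    unfolding bad_def
  proof (rule prob_cdf_gap[OF B, of "\<lambda>x. v x + \<epsilon>"])
    fix x assume "x \<in> \<X>"
    then show "cdf (K x) (v x + \<epsilon>) \<noteq> \<alpha>"
      using cond_quantile_gap[OF \<alpha> inc, of x "\<bar>\<epsilon>\<bar>"] that by (cases "0 < \<epsilon>") (auto simp: v_def)
  qed measurable
  have pointwise: "AE \<omega> in M. (Q n \<omega> - v (X \<omega>))\<^sup>2 \<le> \<epsilon>\<^sup>2 +
      (2 * L\<^sup>2 + 2 * (1 + c * M\<^sub>1)) * indicator (bad \<epsilon> n \<union> bad (- \<epsilon>) n) \<omega> + 2 * L powr (- \<delta>) * c * Z n \<omega>"
    if n: "0 < n" and \<epsilon>: "0 < \<epsilon>" and L: "0 < L" for n \<epsilon> L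
    using AE_sum_fw[OF B] AE_X AE_space
  proof eventually_elim
    case (elim \<omega>)
    have tail0: "0 \<le> 2 * L powr (- \<delta>) * c * Z n \<omega>" using c Z0 by (intro mult_nonneg_nonneg) auto
    show ?case
    proof (cases "\<omega> \<in> bad \<epsilon> n \<union> bad (- \<epsilon>) n")
      case False
      let ?F = "\<lambda>e. cdf (K (X \<omega>)) (v (X \<omega>) + e)"
      let ?G = "\<lambda>e. fcdf n (v (X \<omega>) + e) \<omega>"
      have "\<bar>?G \<epsilon> - ?F \<epsilon>\<bar> < \<bar>?F \<epsilon> - \<alpha>\<bar>" "\<bar>?G (- \<epsilon>) - ?F (- \<epsilon>)\<bar> < \<bar>?F (- \<epsilon>) - \<alpha>\<bar>"
        using False elim(3) by (auto simp: bad_def not_le abs_le_square_iff[symmetric])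
      moreover have "\<alpha> < ?F \<epsilon>" "?F (- \<epsilon>) < \<alpha>"
        using cond_quantile_gap[OF \<alpha> inc[OF elim(2)] \<epsilon>] by (simp_all add: v_def)
      \<comment> \<open>Errors smaller than the gaps leave \<open>\<alpha>\<close> between the two
        estimated values, which traps the estimated quantile.\<close>
      ultimately have G: "\<alpha> \<le> ?G \<epsilon>" "?G (- \<epsilon>) < \<alpha>" by linarith+
      have "Q n \<omega> \<le> v (X \<omega>) + \<epsilon>" "v (X \<omega>) + - \<epsilon> \<le> Q n \<omega>"
        unfolding Q_def
        by (rule generalized_inverse_le[OF mono_fcdf G(2,1)],
            rule generalized_inverse_ge[OF mono_fcdf G(1,2)])
      then have "\<bar>Q n \<omega> - v (X \<omega>)\<bar> \<le> \<bar>\<epsilon>\<bar>" using \<epsilon> by (simp add: abs_le_iff)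
      then have "(Q n \<omega> - v (X \<omega>))\<^sup>2 \<le> \<epsilon>\<^sup>2" by (simp only: abs_le_square_iff)
      moreover have "indicator (bad \<epsilon> n \<union> bad (- \<epsilon>) n) \<omega> = (0 :: real)" using False by simp
      ultimately show ?thesis using tail0 by (simp only: mult_zero_right)
    next
      case True
      have "(Q n \<omega>)\<^sup>2 \<le> L\<^sup>2 + L powr (- \<delta>) * \<bar>Q n \<omega>\<bar> powr (2 + \<delta>)"
        by (rule abs_square_le_powr[OF L \<delta>])
      also have "\<dots> \<le> L\<^sup>2 + L powr (- \<delta>) * (c * Z n \<omega>)"
        using qrf_moment[OF \<alpha> q, of n \<omega>] elim(1) n
        by (intro add_left_mono mult_left_mono) (auto simp: Q_def Z_def c_def q_def)
      finally have Q2: "(Q n \<omega>)\<^sup>2 \<le> L\<^sup>2 + L powr (- \<delta>) * (c * Z n \<omega>)" .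
      have "(Q n \<omega> - v (X \<omega>))\<^sup>2 \<le> 2 * (Q n \<omega>)\<^sup>2 + 2 * (v (X \<omega>))\<^sup>2"
        using zero_le_power2[of "Q n \<omega> + v (X \<omega>)"] by (simp add: power2_sum power2_diff)
      also have "\<dots> \<le> 2 * (L\<^sup>2 + L powr (- \<delta>) * (c * Z n \<omega>)) + 2 * (1 + c * M\<^sub>1)"
        by (intro add_mono mult_left_mono Q2 v2[OF elim(2)]) simp_all
      also have "\<dots> = (2 * L\<^sup>2 + 2 * (1 + c * M\<^sub>1)) + 2 * L powr (- \<delta>) * c * Z n \<omega>"
        by (simp add: algebra_simps)
      finally have "(Q n \<omega> - v (X \<omega>))\<^sup>2 \<le>
        (2 * L\<^sup>2 + 2 * (1 + c * M\<^sub>1)) + 2 * L powr (- \<delta>) * c * Z n \<omega>" .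
      moreover have "indicator (bad \<epsilon> n \<union> bad (- \<epsilon>) n) \<omega> = (1 :: real)" using True by simp
      moreover have "0 \<le> \<epsilon>\<^sup>2" by simp
      ultimately show ?thesis by (simp only: mult_1_right)
    qed
  qed
  have bound: "(\<integral>\<^sup>+\<omega>. ennreal ((Q n \<omega> - v (X \<omega>))\<^sup>2) \<partial>M) \<le> ennreal (\<epsilon>\<^sup>2 +
      (2 * L\<^sup>2 + 2 * (1 + c * M\<^sub>1)) * (prob (bad \<epsilon> n) + prob (bad (- \<epsilon>) n)) + 2 * L powr (- \<delta>) * c * M\<^sub>1)"
    if n: "0 < n" and \<epsilon>: "0 < \<epsilon>" and L: "0 < L" for n \<epsilon> L
  proof -
    define A where "A = 2 * L\<^sup>2 + 2 * (1 + c * M\<^sub>1)"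
    define D where "D = 2 * L powr (- \<delta>) * c"
    have A: "0 \<le> A" using c M1 by (simp add: A_def)
    have D: "0 \<le> D" using c by (simp add: D_def)
    let ?S = "bad \<epsilon> n \<union> bad (- \<epsilon>) n"
    have "(\<integral>\<^sup>+\<omega>. ennreal ((Q n \<omega> - v (X \<omega>))\<^sup>2) \<partial>M) \<le>
        (\<integral>\<^sup>+\<omega>. ennreal (\<epsilon>\<^sup>2) + (ennreal A * indicator ?S \<omega> + ennreal D * ennreal (Z n \<omega>)) \<partial>M)"
    \<comment> \<open>Monotonicity of the nonnegative integral holds for arbitrary integrands, so
      the estimated quantile enters only through its measurable upper bound.\<close>
    proof (rule nn_integral_mono_AE)
      show "AE \<omega> in M. ennreal ((Q n \<omega> - v (X \<omega>))\<^sup>2) \<le>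
          ennreal (\<epsilon>\<^sup>2) + (ennreal A * indicator ?S \<omega> + ennreal D * ennreal (Z n \<omega>))"
        using pointwise[OF n \<epsilon> L]
      proof eventually_elim
        case (elim \<omega>)
        have "ennreal ((Q n \<omega> - v (X \<omega>))\<^sup>2) \<le> ennreal (\<epsilon>\<^sup>2 + (A * indicator ?S \<omega> + D * Z n \<omega>))"
          using elim by (intro ennreal_leI) (simp add: A_def D_def add.assoc)
        also have "\<dots> = ennreal (\<epsilon>\<^sup>2) + (ennreal (A * indicator ?S \<omega>) + ennreal (D * Z n \<omega>))"
        proof -
          have "0 \<le> A * indicator ?S \<omega>" "0 \<le> D * Z n \<omega>" using A D Z0 by simp_all
          then show ?thesis by (simp only: ennreal_plus add_nonneg_nonneg zero_le_power2)
        qed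
        also have "ennreal (A * indicator ?S \<omega>) = ennreal A * indicator ?S \<omega>"
          by (simp add: indicator_def)
        also have "ennreal (D * Z n \<omega>) = ennreal D * ennreal (Z n \<omega>)"
          using D Z0 by (intro ennreal_mult)
        finally show ?case .
      qed
    qed
    also have "\<dots> = ennreal (\<epsilon>\<^sup>2) + (ennreal A * emeasure M ?S + ennreal D * (\<integral>\<^sup>+\<omega>. ennreal (Z n \<omega>) \<partial>M))"
      by (subst nn_integral_add, simp, measurable)
        (subst nn_integral_add, auto simp: nn_integral_cmult emeasure_space_1 nn_integral_cmult_indicator)
    also have "\<dots> \<le> ennreal (\<epsilon>\<^sup>2) + (ennreal A * ennreal (prob (bad \<epsilon> n) + prob (bad (- \<epsilon>) n)) + ennreal D * ennreal M\<^sub>1)"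
      unfolding emeasure_eq_measure
      by (intro add_left_mono add_mono mult_left_mono EZ n ennreal_leI measure_Un_le bad_meas) auto
    also have "\<dots> = ennreal (\<epsilon>\<^sup>2 + (A * (prob (bad \<epsilon> n) + prob (bad (- \<epsilon>) n)) + D * M\<^sub>1))"
      using A D M1 by (simp add: ennreal_mult ennreal_plus)
    finally show ?thesis by (simp add: A_def D_def add.assoc)
  qed
  have "(\<lambda>n. \<integral>\<^sup>+\<omega>. ennreal ((Q n \<omega> - v (X \<omega>))\<^sup>2) \<partial>M) \<longlonglongrightarrow> 0"
  proof (rule order_tendstoI)
    fix e :: ennreal assume "0 < e"
    obtain e' where e': "0 < e'" "ennreal e' < e"
    proof -
      obtain c where c: "0 < c" "c < e" using dense[OF \<open>0 < e\<close>] by auto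
      then show ?thesis using that by (cases c) auto
    qed
    \<comment> \<open>The tolerance is split into three: \<open>\<epsilon>\<close> is fixed first,
      then \<open>L\<close> for the tail term, and \<open>n\<close> last, since the factor
      \<open>A\<close> of the bad probabilities depends on \<open>L\<close>.\<close>
    define \<epsilon> where "\<epsilon> = sqrt (e' / 3)"
    have \<epsilon>: "0 < \<epsilon>" "\<epsilon>\<^sup>2 = e' / 3" using e'(1) by (auto simp: \<epsilon>_def)
    have "((\<lambda>L. 2 * L powr (- \<delta>) * c * M\<^sub>1) \<longlongrightarrow> 2 * 0 * c * M\<^sub>1) at_top"
      using \<delta> by (intro tendsto_intros tendsto_neg_powr filterlim_ident) auto
    then have "\<forall>\<^sub>F L in at_top. 2 * L powr (- \<delta>) * c * M\<^sub>1 < e' / 3"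
      using e'(1) by (intro order_tendstoD(2)) auto
    then have "\<forall>\<^sub>F L in at_top. 0 < L \<and> 2 * L powr (- \<delta>) * c * M\<^sub>1 < e' / 3"
      using eventually_gt_at_top[of 0] by eventually_elim auto
    then obtain L where L: "0 < L" "2 * L powr (- \<delta>) * c * M\<^sub>1 < e' / 3"
      by (auto simp: eventually_at_top_linorder)
    define A where "A = 2 * L\<^sup>2 + 2 * (1 + c * M\<^sub>1)"
    have "(\<lambda>n. A * (prob (bad \<epsilon> n) + prob (bad (- \<epsilon>) n))) \<longlonglongrightarrow> A * (0 + 0)"
      using \<epsilon>(1) by (intro tendsto_intros bad_prob) auto
    then have "\<forall>\<^sub>F n in sequentially. A * (prob (bad \<epsilon> n) + prob (bad (- \<epsilon>) n)) < e' / 3"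
      using e'(1) by (intro order_tendstoD(2)) auto
    then show "\<forall>\<^sub>F n in sequentially. (\<integral>\<^sup>+\<omega>. ennreal ((Q n \<omega> - v (X \<omega>))\<^sup>2) \<partial>M) < e"
      using eventually_gt_at_top[of 0]
    proof eventually_elim
      case (elim n)
      have "(\<integral>\<^sup>+\<omega>. ennreal ((Q n \<omega> - v (X \<omega>))\<^sup>2) \<partial>M) \<le>
          ennreal (\<epsilon>\<^sup>2 + A * (prob (bad \<epsilon> n) + prob (bad (- \<epsilon>) n)) + 2 * L powr (- \<delta>) * c * M\<^sub>1)"
        unfolding A_def by (rule bound[OF elim(2) \<epsilon>(1) L(1)])
      also have "\<dots> \<le> ennreal e'" using elim(1) L(2) \<epsilon>(2) by (intro ennreal_leI) linarith
      also have "\<dots> < e" by (rule e'(2))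
      finally show ?case .
    qed
  qed simp
  then show ?thesis by (simp add: qrf_eq Q_def v_def)
qed

end

theorem theorem2:
  fixes M :: "'a measure"
    and X :: "'a \<Rightarrow> real ^ 'v" and Y :: "'a \<Rightarrow> real"
    and Xs :: "nat \<Rightarrow> 'a \<Rightarrow> real ^ 'v" and Ys :: "nat \<Rightarrow> 'a \<Rightarrow> real"
    and \<Theta> :: "'t measure" and \<theta> :: "nat \<Rightarrow> nat \<Rightarrow> 'a \<Rightarrow> 't"
    and grow :: "nat \<Rightarrow> 't \<Rightarrow> (nat \<Rightarrow> (real ^ 'v) \<times> real) \<Rightarrow> 'v::finite rtree"
    and T :: "nat \<Rightarrow> nat \<Rightarrow> 'a \<Rightarrow> 'v rtree"
    and K :: "real ^ 'v \<Rightarrow> real measure"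
    and f :: "real ^ 'v \<Rightarrow> real"
    and \<X> :: "(real ^ 'v) set"
    and B :: nat
    and \<alpha> c\<^sub>1 c\<^sub>2 C\<^sub>0 \<gamma> C \<delta> M\<^sub>0 :: real
  assumes prob: "prob_space M"
    and alpha: "0 < \<alpha>" "\<alpha> < 1"
    and trees: "0 < B"
    \<comment> \<open>the test pair, the offline sample and the forest\<close>
    and pair: "X \<in> borel_measurable M" "Y \<in> borel_measurable M"
    and sample_indep: "prob_space.indep_vars M (\<lambda>_. borel) (\<lambda>i \<omega>. (Xs i \<omega>, Ys i \<omega>)) UNIV"
    and sample_distr: "\<And>i. distr M borel (\<lambda>\<omega>. (Xs i \<omega>, Ys i \<omega>)) = distr M borel (\<lambda>\<omega>. (X \<omega>, Y \<omega>))"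
    and pair_indep: "\<And>n. indep_rv M borel (\<lambda>\<omega>. (X \<omega>, Y \<omega>))
          (PiM {..<n} (\<lambda>_. borel) \<Otimes>\<^sub>M PiM {..<B} (\<lambda>_. \<Theta>))
          (\<lambda>\<omega>. (sample Xs Ys n \<omega>, \<lambda>b\<in>{..<B}. \<theta> n b \<omega>))"
    and grow_measurable: "\<And>n. (\<lambda>(u, d). grow n u d)
          \<in> measurable (\<Theta> \<Otimes>\<^sub>M PiM {..<n} (\<lambda>_. borel)) tree_space"
    and T_eq: "\<And>n b \<omega>. T n b \<omega> = grow n (\<theta> n b \<omega>) (sample Xs Ys n \<omega>)"
    and cond_law: "regular_cond_law M X Y K"
    \<comment> \<open>support and density of the covariates\<close>
    and support: "\<X> = topological_support (distr M borel X)" "bounded \<X>"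
    and density: "distributed M lborel X (\<lambda>x. ennreal (f x))"
      "0 < c\<^sub>1" "0 < c\<^sub>2" "\<And>x. x \<in> \<X> \<Longrightarrow> c\<^sub>1 \<le> f x \<and> f x \<le> c\<^sub>2"
    \<comment> \<open>leaf sizes\<close>
    and max_leaf: "AE \<omega> in M.
          (\<lambda>n. real (Max (leaf_counts n (\<lambda>i. Xs i \<omega>) B (\<lambda>b. T n b \<omega>)))) \<in> o(\<lambda>n. real n)"
    and min_leaf: "AE \<omega> in M.
          (\<forall>\<^sub>F n in sequentially. 0 < Min (leaf_counts n (\<lambda>i. Xs i \<omega>) B (\<lambda>b. T n b \<omega>))) \<and>
          (\<lambda>n. 1 / real (Min (leaf_counts n (\<lambda>i. Xs i \<omega>) B (\<lambda>b. T n b \<omega>)))) \<in> o(\<lambda>n. 1)"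
    \<comment> \<open>split variables and balance of the splits\<close>
    and split_prob: "0 < C\<^sub>0"
      "\<And>n b p m. 0 < n \<Longrightarrow> b < B \<Longrightarrow>
         AE \<omega> in M. split_at (T n b \<omega>) p \<noteq> None \<longrightarrow>
           C\<^sub>0 \<le> real_cond_exp M (node_history M (T n b) p)
             (indicator {\<omega> \<in> space M. map_option fst (split_at (T n b \<omega>) p) = Some m}) \<omega>"
    and balance: "0 < \<gamma>" "\<gamma> \<le> 1/2"
      "\<And>n b. 0 < n \<Longrightarrow> b < B \<Longrightarrow>
         AE \<omega> in M. \<forall>p c. split_at (T n b \<omega>) p \<noteq> None \<longrightarrow>
           \<gamma> \<le> real (node_count n (\<lambda>i. Xs i \<omega>) (T n b \<omega>) (p @ [c]))
                / real (node_count n (\<lambda>i. Xs i \<omega>) (T n b \<omega>) p)"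
    \<comment> \<open>Lipschitz conditional distribution function\<close>
    and lipschitz: "0 < C"
      "\<And>x x'. x \<in> \<X> \<Longrightarrow> x' \<in> \<X> \<Longrightarrow>
         (SUP y. \<bar>cdf (K x) y - cdf (K x') y\<bar>) \<le> C * l1_norm (x - x')"
    \<comment> \<open>strict monotonicity\<close>
    and increasing: "\<And>x. x \<in> \<X> \<Longrightarrow> strict_mono (cdf (K x))"
    \<comment> \<open>conditional moments\<close>
    and moments: "0 < \<delta>"
      "\<And>x. x \<in> \<X> \<Longrightarrow> (\<integral>\<^sup>+y. ennreal (\<bar>y\<bar> powr (2 + \<delta>)) \<partial>K x) \<le> ennreal M\<^sub>0"
    \<comment> \<open>honesty\<close>
    and honesty: "honest \<Theta> grow"
      "\<And>n. indep_rv M (PiM {..<B} (\<lambda>_. \<Theta>)) (\<lambda>\<omega>. \<lambda>b\<in>{..<B}. \<theta> n b \<omega>)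
         (PiM {..<n} (\<lambda>_. borel)) (sample Xs Ys n)"
  shows "(\<lambda>n. \<integral>\<^sup>+\<omega>. ennreal ((qrf \<alpha> n (\<lambda>i. Xs i \<omega>) (\<lambda>i. Ys i \<omega>) B (\<lambda>b. T n b \<omega>) (X \<omega>)
            - cond_quantile K \<alpha> (X \<omega>))\<^sup>2) \<partial>M) \<longlonglongrightarrow> 0"
proof -
  interpret prob_space M by (rule prob)
  interpret regression_forest M X Y Xs Ys \<Theta> \<theta> grow T K \<X> B C\<^sub>0 \<gamma> C
    by (rule regression_forest.intro[OF prob], rule regression_forest_axioms.intro)
      (fact pair sample_indep sample_distr pair_indep grow_measurable T_eq cond_law support
        max_leaf min_leaf split_prob balance lipschitz honesty)+
  show ?thesis
    by (rule qrf_mean_square_consistent[OF alpha trees increasing moments])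
qed

end
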